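(* Let $k\ge 0$ be an integer, $\ell\in\{k,k-1\}$, and $\boldsymbol\tau_h\in\Sigma_k^{\mathrm{tn}}$. If $$(\mathrm{div}_w\boldsymbol\tau_h,\boldsymbol v_h)_{0,h}=0\qquad\forall\,\boldsymbol v_h\in\mathring{\mathbb V}^{\mathrm{div}}_{k,\ell}\cap\ker(\mathrm{div}),$$ then $$\langle\mathrm{div}\,\boldsymbol\tau_h,\boldsymbol v\rangle=0\qquad\forall\,\boldsymbol v\in H_0^1(\Omega;\mathbb R^d)\cap\ker(\mathrm{div}).$$
   Context: Setting. $\Omega\subset\mathbb R^d$ ($d\ge 2$) is a bounded polytope and $\mathcal T_h$ is a simplicial mesh of $\Omega$ from a shape-regular family. $\mathring{\mathcal F}_h$ is the set of interior faces. Each face $F$ carries a fixed unit normal $\boldsymbol n_F$ (outward to $\Omega$ if $F\subset\partial\Omega$). The jump $[\![v]\!]$ on an interior face is the trace from the element for which $\boldsymbol n_F$ is outward minus the trace from the other element. In integrals over $F$, $\boldsymbol n=\boldsymbol n_F$. $\Pi_F\boldsymbol v=\boldsymbol v-(\boldsymbol v\cdot\boldsymbol n_F)\boldsymbol n_F$. $\mathbb T$ is the space of traceless $d\times d$ real matrices. The divergence of matrix fields is row-wise; $(\cdot,\cdot)_D$ is the $L^2(D)$ inner product. $\mathbb P_k(D)$: polynomials of degree $\le k$; $\mathbb H_k(D)$: homogeneous polynomials of degree $k$; $\mathbb P_{-1}=\mathbb H_{-1}=\{0\}$. Velocity space: $\mathbb V^{\mathrm{div}}_{k,\ell}(T)=\mathbb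 P_k(T;\mathbb R^d)+\mathbb H_\ell(T)\boldsymbol x$ and $\mathring{\mathbb V}^{\mathrm{div}}_{k,\ell}=\{\boldsymbol v\in H(\mathrm{div},\Omega):\boldsymbol v|_T\in\mathbb V^{\mathrm{div}}_{k,\ell}(T)\ \forall T\in\mathcal T_h,\ \boldsymbol v\cdot\boldsymbol n=0\text{ on }\partial\Omega\}$. $\ker(\mathrm{div})$ denotes the divergence-free fields. Stress space: $\Sigma_k^{\mathrm{tn}}=\{\boldsymbol\tau\in L^2(\Omega;\mathbb T):\boldsymbol\tau|_T\in\mathbb P_k(T;\mathbb T)\ \forall T\in\mathcal T_h,\ [\![\Pi_F\boldsymbol\tau\boldsymbol n]\!]=0\ \forall F\in\mathring{\mathcal F}_h\}$. Weak divergence form: $(\mathrm{div}_w\boldsymbol\tau,\boldsymbol v)_{0,h}=\sum_{T\in\mathcal T_h}(\mathrm{div}\,\boldsymbol\tau,\boldsymbol v)_T-\sum_{F\in\mathring{\mathcal F}_h}([\![\boldsymbol n^{\intercal}\boldsymbol\tau\boldsymbol n]\!],\boldsymbol n\cdot\boldsymbol v)_F$. $\langle\mathrm{div}\,\boldsymbol\tau_h,\boldsymbol v\rangle$ is the distributional ($H^{-1}$–$H_0^1$) pairing, i.e. $\langle\mathrm{div}\,\boldsymbol\tau_h,\boldsymbol v\rangle=-(\boldsymbol\tau_h,\mathrm{grad}\,\boldsymbol v)_\Omega$. *)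

theory Defs
  imports "HOL-Analysis.Analysis"
begin

section \<open>Function spaces\<close>

definition partial :: "'n::finite \<Rightarrow> (real^'n \<Rightarrow> 'b::real_normed_vector) \<Rightarrow> real^'n \<Rightarrow> 'b" where
  "partial j f x = frechet_derivative f (at x) (axis j 1)"

primrec Ck :: "nat \<Rightarrow> (real^'n::finite \<Rightarrow> 'b::real_normed_vector) \<Rightarrow> bool" where
  "Ck 0 f \<longleftrightarrow> continuous_on UNIV f"
| "Ck (Suc m) f \<longleftrightarrow> (\<forall>x. f differentiable (at x)) \<and> (\<forall>j. Ck m (partial j f))"

definition test_functions :: "(real^'n::finite) set \<Rightarrow> (real^'n \<Rightarrow> 'b::real_normed_vector) set" where
  "test_functions \<Omega> = {\<phi>. (\<forall>m. Ck m \<phi>) \<and>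
     compact (closure {x. \<phi> x \<noteq> 0}) \<and> closure {x. \<phi> x \<noteq> 0} \<subseteq> \<Omega>}"

text \<open>
  Elements of Lebesgue and Sobolev spaces are represented by functions on the whole space;
  only their values on \<open>\<Omega>\<close>, up to null sets, matter. The norm on \<open>real^'n^'n\<close> is the
  Frobenius norm and the inner product is the Frobenius inner product.
\<close>

definition L2 :: "(real^'n::finite) set \<Rightarrow> (real^'n \<Rightarrow> 'b::euclidean_space) set" where
  "L2 \<Omega> = {f. f \<in> borel_measurable (lebesgue_on \<Omega>) \<and>
     integrable (lebesgue_on \<Omega>) (\<lambda>x. (norm (f x))\<^sup>2)}"

definition has_weak_grad ::
    "(real^'n::finite) set \<Rightarrow> (real^'n \<Rightarrow> real^'n) \<Rightarrow> (real^'n \<Rightarrow> real^'n^'n) \<Rightarrow> bool" where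
  "has_weak_grad \<Omega> v G \<longleftrightarrow> G \<in> L2 \<Omega> \<and>
     (\<forall>\<phi>\<in>test_functions \<Omega>. \<forall>i j.
        (LINT x|lebesgue_on \<Omega>. v x $ i * partial j \<phi> x) =
        - (LINT x|lebesgue_on \<Omega>. G x $ i $ j * \<phi> x))"

definition has_weak_div ::
    "(real^'n::finite) set \<Rightarrow> (real^'n \<Rightarrow> real^'n) \<Rightarrow> (real^'n \<Rightarrow> real) \<Rightarrow> bool" where
  "has_weak_div \<Omega> v g \<longleftrightarrow> g \<in> L2 \<Omega> \<and>
     (\<forall>\<phi>\<in>test_functions \<Omega>.
        (LINT x|lebesgue_on \<Omega>. (\<Sum>j\<in>UNIV. v x $ j * partial j \<phi> x)) =
        - (LINT x|lebesgue_on \<Omega>. g x * \<phi> x))"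

definition H1 :: "(real^'n::finite) set \<Rightarrow> (real^'n \<Rightarrow> real^'n) set" where
  "H1 \<Omega> = {v \<in> L2 \<Omega>. \<exists>G. has_weak_grad \<Omega> v G}"

text \<open>The weak gradient is unique up to null sets.\<close>

definition weak_grad ::
    "(real^'n::finite) set \<Rightarrow> (real^'n \<Rightarrow> real^'n) \<Rightarrow> real^'n \<Rightarrow> real^'n^'n" where
  "weak_grad \<Omega> v = (SOME G. has_weak_grad \<Omega> v G)"

text \<open>The closure of the smooth compactly supported fields in the \<open>H\<^sup>1\<close> norm.\<close>

definition H1_0 :: "(real^'n::finite) set \<Rightarrow> (real^'n \<Rightarrow> real^'n) set" where
  "H1_0 \<Omega> = {v \<in> H1 \<Omega>. \<exists>\<phi> :: nat \<Rightarrow> real^'n \<Rightarrow> real^'n.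
     (\<forall>m. \<phi> m \<in> test_functions \<Omega>) \<and>
     (\<lambda>m. LINT x|lebesgue_on \<Omega>.
        (norm (\<phi> m x - v x))\<^sup>2 + (norm (jacobian (\<phi> m) (at x) - weak_grad \<Omega> v x))\<^sup>2)
       \<longlonglongrightarrow> 0}"

definition Hdiv :: "(real^'n::finite) set \<Rightarrow> (real^'n \<Rightarrow> real^'n) set" where
  "Hdiv \<Omega> = {v \<in> L2 \<Omega>. \<exists>g. has_weak_div \<Omega> v g}"

definition ker_div :: "(real^'n::finite) set \<Rightarrow> (real^'n \<Rightarrow> real^'n) set" where
  "ker_div \<Omega> = {v \<in> L2 \<Omega>. has_weak_div \<Omega> v (\<lambda>x. 0)}"

text \<open>The distributional pairing of \<open>div \<tau>\<close> with a field in \<^term>\<open>H1_0 \<Omega>\<close>.\<close>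

definition div_pairing ::
    "(real^'n::finite) set \<Rightarrow> (real^'n \<Rightarrow> real^'n^'n) \<Rightarrow> (real^'n \<Rightarrow> real^'n) \<Rightarrow> real" where
  "div_pairing \<Omega> \<tau> v = - (LINT x|lebesgue_on \<Omega>. \<tau> x \<bullet> weak_grad \<Omega> v x)"


section \<open>Polynomials\<close>

text \<open>
  Degrees are integers, so that degree \<open>-1\<close> gives the zero space. An exponent
  \<open>\<alpha>\<close> stands for the monomial \<open>x\<^sup>\<alpha>\<close>.
\<close>

definition monomial :: "('n::finite \<Rightarrow> nat) \<Rightarrow> real^'n \<Rightarrow> real" where
  "monomial \<alpha> x = (\<Prod>i\<in>UNIV. (x $ i) ^ \<alpha> i)"

definition polys :: "int \<Rightarrow> (real^'n::finite \<Rightarrow> 'b::real_vector) set" where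
  "polys k = {p. \<exists>c. p = (\<lambda>x. \<Sum>\<alpha> | int (sum \<alpha> UNIV) \<le> k. monomial \<alpha> x *\<^sub>R c \<alpha>)}"

definition hom_polys :: "int \<Rightarrow> (real^'n::finite \<Rightarrow> 'b::real_vector) set" where
  "hom_polys k = {p. \<exists>c. p = (\<lambda>x. \<Sum>\<alpha> | int (sum \<alpha> UNIV) = k. monomial \<alpha> x *\<^sub>R c \<alpha>)}"


section \<open>Meshes\<close>

text \<open>
  The domain is an open set and need not be convex, so the library's \<^const>\<open>polytope\<close>, a
  convex hull, is only the building block. Being the interior of its closure rules out slits.
\<close>

definition polytopal_domain :: "'a::euclidean_space set \<Rightarrow> bool" where
  "polytopal_domain \<Omega> \<longleftrightarrow> \<Omega> \<noteq> {} \<and> open \<Omega> \<and> bounded \<Omega> \<and> \<Omega> = interior (closure \<Omega>) \<and>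
     (\<exists>\<P>. finite \<P> \<and> (\<forall>P\<in>\<P>. polytope P) \<and> closure \<Omega> = \<Union>\<P>)"

definition simplicial_mesh :: "'a::euclidean_space set \<Rightarrow> 'a set set \<Rightarrow> bool" where
  "simplicial_mesh \<Omega> \<T> \<longleftrightarrow> triangulation \<T> \<and> (\<forall>T\<in>\<T>. int DIM('a) simplex T) \<and>
     \<Union>\<T> = closure \<Omega>"

definition inradius :: "'a::euclidean_space set \<Rightarrow> real" where
  "inradius T = Sup {r. 0 \<le> r \<and> (\<exists>x. cball x r \<subseteq> T)}"

definition shape_regular_family :: "'a::euclidean_space set \<Rightarrow> 'a set set set \<Rightarrow> bool" where
  "shape_regular_family \<Omega> \<M> \<longleftrightarrow> (\<forall>\<T>\<in>\<M>. simplicial_mesh \<Omega> \<T>) \<and>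
     (\<exists>\<sigma>. \<forall>\<T>\<in>\<M>. \<forall>T\<in>\<T>. diameter T \<le> \<sigma> * inradius T)"

definition faces :: "'a::euclidean_space set set \<Rightarrow> 'a set set" where
  "faces \<T> = {F. \<exists>T\<in>\<T>. F facet_of T}"

definition boundary_faces :: "'a::euclidean_space set \<Rightarrow> 'a set set \<Rightarrow> 'a set set" where
  "boundary_faces \<Omega> \<T> = {F \<in> faces \<T>. F \<subseteq> frontier \<Omega>}"

definition interior_faces :: "'a::euclidean_space set \<Rightarrow> 'a set set \<Rightarrow> 'a set set" where
  "interior_faces \<Omega> \<T> = faces \<T> - boundary_faces \<Omega> \<T>"

definition points_outward :: "'a::euclidean_space set \<Rightarrow> 'a set \<Rightarrow> 'a \<Rightarrow> bool" where
  "points_outward T F m \<longleftrightarrow> (\<forall>x\<in>F. \<forall>y\<in>T. m \<bullet> (y - x) \<le> 0)"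

text \<open>
  The orientation of \<open>\<nu> F\<close> is arbitrary on interior faces. A boundary face lies in exactly one
  element, and there outward to the domain means outward to that element.
\<close>

definition face_normals ::
    "'a::euclidean_space set \<Rightarrow> 'a set set \<Rightarrow> ('a set \<Rightarrow> 'a) \<Rightarrow> bool" where
  "face_normals \<Omega> \<T> \<nu> \<longleftrightarrow>
     (\<forall>F\<in>faces \<T>. norm (\<nu> F) = 1 \<and> (\<forall>x\<in>F. \<forall>y\<in>F. \<nu> F \<bullet> (y - x) = 0)) \<and>
     (\<forall>F\<in>boundary_faces \<Omega> \<T>. \<forall>T\<in>\<T>. F facet_of T \<longrightarrow> points_outward T F (\<nu> F))"

definition plus_elt :: "'a::euclidean_space set set \<Rightarrow> ('a set \<Rightarrow> 'a) \<Rightarrow> 'a set \<Rightarrow> 'a set" where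
  "plus_elt \<T> \<nu> F = (THE T. T \<in> \<T> \<and> F facet_of T \<and> points_outward T F (\<nu> F))"

definition minus_elt :: "'a::euclidean_space set set \<Rightarrow> ('a set \<Rightarrow> 'a) \<Rightarrow> 'a set \<Rightarrow> 'a set" where
  "minus_elt \<T> \<nu> F = (THE T. T \<in> \<T> \<and> F facet_of T \<and> points_outward T F (- \<nu> F))"

text \<open>
  Traces are only taken of functions that coincide with a polynomial on the interior of each
  element, so the limit from inside the element exists at every point of it.
\<close>

definition elt_trace ::
    "'a::euclidean_space set \<Rightarrow> ('a \<Rightarrow> 'b::real_normed_vector) \<Rightarrow> 'a \<Rightarrow> 'b" where
  "elt_trace T v x = Lim (at x within interior T) v"

definition jump ::
    "'a::euclidean_space set set \<Rightarrow> ('a set \<Rightarrow> 'a) \<Rightarrow> 'a set \<Rightarrow> ('a \<Rightarrow> 'b::real_normed_vector) \<Rightarrow> 'a \<Rightarrow> 'b" where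
  "jump \<T> \<nu> F v x = elt_trace (plus_elt \<T> \<nu> F) v x - elt_trace (minus_elt \<T> \<nu> F) v x"

definition tangential :: "'a::euclidean_space \<Rightarrow> 'a \<Rightarrow> 'a" where
  "tangential m w = w - (w \<bullet> m) *\<^sub>R m"

text \<open>
  Lebesgue measure of dimension \<open>aff_dim F\<close> on the affine hull of \<open>F\<close>: the image of the product
  Lebesgue measure under Cartesian coordinates \<open>c \<mapsto> a + (\<Sum>b\<in>B. c b *\<^sub>R b)\<close>, with \<open>B\<close> an
  orthonormal basis of the direction space. It does not depend on the choice of \<open>a\<close> and \<open>B\<close>.
  Compare the definition of \<^const>\<open>lborel\<close>.
\<close>

definition hull_basis :: "'a::euclidean_space set \<Rightarrow> 'a set" where
  "hull_basis F = (SOME B. pairwise orthogonal B \<and> (\<forall>b\<in>B. norm b = 1) \<and>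
     span B = span {y - x | x y. x \<in> F \<and> y \<in> F})"

definition hull_lebesgue :: "'a::euclidean_space set \<Rightarrow> 'a measure" where
  "hull_lebesgue F =
     distr (Pi\<^sub>M (hull_basis F) (\<lambda>_. lborel)) borel
       (\<lambda>c. (SOME a. a \<in> F) + (\<Sum>b\<in>hull_basis F. c b *\<^sub>R b))"


section \<open>Discrete spaces and the weak divergence\<close>

text \<open>
  A discrete field is represented by a function that is polynomial at every point of the interior
  of each element; its values on the mesh skeleton, a null set, are arbitrary.
\<close>

definition Sigma_tn ::
    "(real^'n::finite) set \<Rightarrow> (real^'n) set set \<Rightarrow> ((real^'n) set \<Rightarrow> real^'n) \<Rightarrow> int \<Rightarrow>
     (real^'n \<Rightarrow> real^'n^'n) set" where
  "Sigma_tn \<Omega> \<T> \<nu> k = {\<tau> \<in> L2 \<Omega>.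
     (\<forall>T\<in>\<T>. \<exists>p\<in>polys k. \<forall>x\<in>interior T. \<tau> x = p x \<and> trace (\<tau> x) = 0) \<and>
     (\<forall>F\<in>interior_faces \<Omega> \<T>. \<forall>x\<in>F. jump \<T> \<nu> F (\<lambda>y. tangential (\<nu> F) (\<tau> y *v \<nu> F)) x = 0)}"

definition Vdiv_elt :: "int \<Rightarrow> int \<Rightarrow> (real^'n::finite) set \<Rightarrow> (real^'n \<Rightarrow> real^'n) set" where
  "Vdiv_elt k l T = {v. \<exists>p\<in>polys k. \<exists>q\<in>hom_polys l. \<forall>x\<in>interior T. v x = p x + q x *\<^sub>R x}"

definition Vdiv0 ::
    "(real^'n::finite) set \<Rightarrow> (real^'n) set set \<Rightarrow> ((real^'n) set \<Rightarrow> real^'n) \<Rightarrow> int \<Rightarrow> int \<Rightarrow>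
     (real^'n \<Rightarrow> real^'n) set" where
  "Vdiv0 \<Omega> \<T> \<nu> k l = {v \<in> Hdiv \<Omega>. (\<forall>T\<in>\<T>. v \<in> Vdiv_elt k l T) \<and>
     (\<forall>F\<in>boundary_faces \<Omega> \<T>. \<forall>T\<in>\<T>. F facet_of T \<longrightarrow> (\<forall>x\<in>F. elt_trace T v x \<bullet> \<nu> F = 0))}"

definition row_div :: "(real^'n::finite \<Rightarrow> real^'n^'n) \<Rightarrow> real^'n \<Rightarrow> real^'n" where
  "row_div \<tau> x = (\<chi> i. \<Sum>j\<in>UNIV. partial j (\<lambda>y. \<tau> y $ i $ j) x)"

text \<open>
  The normal component of a piecewise polynomial field in \<^term>\<open>Hdiv \<Omega>\<close> has the same trace from
  both sides of an interior face; the one from the plus element is used below.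
\<close>

definition div_w ::
    "(real^'n::finite) set \<Rightarrow> (real^'n) set set \<Rightarrow> ((real^'n) set \<Rightarrow> real^'n) \<Rightarrow>
     (real^'n \<Rightarrow> real^'n^'n) \<Rightarrow> (real^'n \<Rightarrow> real^'n) \<Rightarrow> real" where
  "div_w \<Omega> \<T> \<nu> \<tau> v =
     (\<Sum>T\<in>\<T>. LINT x|lebesgue_on T. row_div \<tau> x \<bullet> v x) -
     (\<Sum>F\<in>interior_faces \<Omega> \<T>. LINT x:F|hull_lebesgue F.
        jump \<T> \<nu> F (\<lambda>y. \<nu> F \<bullet> (\<tau> y *v \<nu> F)) x *
        (\<nu> F \<bullet> elt_trace (plus_elt \<T> \<nu> F) v x))"

end

theory Submission
  imports Defs "HOL-Computational_Algebra.Polynomial"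
begin

text \<open>
  Let \<open>v\<^sub>h\<close> range over the Raviart--Thomas fields of degree \<open>k\<close> on the mesh. Those with zero
  divergence are piecewise of degree \<open>k\<close>, so the hypothesis says that \<open>div\<^sub>w \<tau>\<close> vanishes on the
  kernel of the divergence. By linear algebra there is a discontinuous piecewise polynomial \<open>p\<close> of
  degree \<open>k\<close> with \<open>(div\<^sub>w \<tau>, v\<^sub>h) = (p, div v\<^sub>h)\<close> for all \<open>v\<^sub>h\<close>. After integration by parts the
  difference of the two sides pairs \<open>v\<^sub>h\<close> with residuals \<open>r\<close> of degree \<open>k - 1\<close> on the elements and
  \<open>v\<^sub>h \<cdot> n\<close> with residuals \<open>s\<close> of degree \<open>k\<close> on the interior faces. Explicit fields built from \<open>r\<close>
  and \<open>s\<close> show that both are zero; no interpolation operator and no unisolvence is needed. Hence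
  \<open>(\<tau>, grad \<phi>) = - (p, div \<phi>)\<close> for every smooth \<open>\<phi>\<close> with compact support, and by density
  for every \<open>\<phi>\<close> in \<open>H\<^sub>0\<^sup>1\<close>; the right-hand side vanishes if \<open>div \<phi> = 0\<close>.
\<close>

section \<open>Polynomials\<close>

text \<open>The obstacle is that a divergence-free field of \<open>H1_0\<close> is approximated by
  test functions whose divergence need not vanish, so the hypothesis does not pass to the limit
  directly. The multiplier \<open>p\<close> lifts the constraint: the stress corrected by
  \<open>p\<close> times the identity annihilates the gradients of all test fields. Plain density
  extends this to \<open>H1_0\<close>, and only there does the constraint return, as a weak gradient
  of trace zero. Raviart--Thomas fields suit the residuals because
  \<open>p x *\<^sub>R (x - c)\<close> is one of them for every \<open>p\<close> of degree
  \<open>k\<close>. If \<open>c\<close> is a vertex, this field is tangential on all facets through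
  \<open>c\<close>, and \<open>x - c\<close> has constant normal component on the opposite facet,
  which yields the face fields. Weighted with barycentric coordinates, such fields add up to bubbles
  tangential on every facet. Face integrals are taken in arbitrarily chosen orthonormal coordinates.
  The divergence theorem on a simplex is therefore derived from Lebesgue measure itself, by its
  invariance under isometries and Fubini in the direction normal to a facet.\<close>

lemma finite_exponents: "finite {\<alpha>::'n::finite \<Rightarrow> nat. int (sum \<alpha> UNIV) \<le> k}"
proof (rule finite_subset)
  show "{\<alpha>::'n \<Rightarrow> nat. int (sum \<alpha> UNIV) \<le> k} \<subseteq> PiE UNIV (\<lambda>_. {..nat k})"
  proof
    fix \<alpha> :: "'n \<Rightarrow> nat" assume "\<alpha> \<in> {\<alpha>. int (sum \<alpha> UNIV) \<le> k}"
    moreover have "\<alpha> i \<le> sum \<alpha> UNIV" for i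
      by (rule member_le_sum) auto
    ultimately have "\<alpha> i \<le> nat k" for i
      by (metis le_nat_iff le_trans mem_Collect_eq nat_int nat_mono)
    then show "\<alpha> \<in> PiE UNIV (\<lambda>_. {..nat k})" by auto
  qed
qed (auto intro: finite_PiE)

lemma polysI: "p = (\<lambda>x. \<Sum>\<alpha> | int (sum \<alpha> UNIV) \<le> k. monomial \<alpha> x *\<^sub>R c \<alpha>) \<Longrightarrow> p \<in> polys k"
  unfolding polys_def by blast

lemma hom_polysI: "p = (\<lambda>x. \<Sum>\<alpha> | int (sum \<alpha> UNIV) = k. monomial \<alpha> x *\<^sub>R c \<alpha>) \<Longrightarrow> p \<in> hom_polys k"
  unfolding hom_polys_def by blast

lemma hom_polys_subset: "hom_polys k \<subseteq> polys k"
proof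
  fix p :: "real^'n \<Rightarrow> 'b::real_vector" assume "p \<in> hom_polys k"
  then obtain c where c: "p = (\<lambda>x. \<Sum>\<alpha> | int (sum \<alpha> UNIV) = k. monomial \<alpha> x *\<^sub>R c \<alpha>)"
    by (auto simp: hom_polys_def)
  let ?c = "\<lambda>\<alpha>. if int (sum \<alpha> UNIV) = k then c \<alpha> else 0"
  have "p = (\<lambda>x. \<Sum>\<alpha> | int (sum \<alpha> UNIV) \<le> k. monomial \<alpha> x *\<^sub>R ?c \<alpha>)"
    unfolding c by (rule ext, rule sum.mono_neutral_cong_left[OF finite_exponents]) auto
  then show "p \<in> polys k" by (rule polysI[where c = ?c])
qed

lemma polys_zero [simp]: "(\<lambda>x. 0) \<in> polys k"
  unfolding polys_def by (auto intro!: exI[of _ "\<lambda>_. 0"])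

lemma hom_polys_zero [simp]: "(\<lambda>x. 0) \<in> hom_polys k"
  unfolding hom_polys_def by (auto intro!: exI[of _ "\<lambda>_. 0"])

lemma polys_add:
  assumes "p \<in> polys k" "q \<in> polys k" shows "(\<lambda>x. p x + q x) \<in> polys k"
proof -
  from assms obtain c d where "p = (\<lambda>x. \<Sum>\<alpha> | int (sum \<alpha> UNIV) \<le> k. monomial \<alpha> x *\<^sub>R c \<alpha>)"
    "q = (\<lambda>x. \<Sum>\<alpha> | int (sum \<alpha> UNIV) \<le> k. monomial \<alpha> x *\<^sub>R d \<alpha>)"
    unfolding polys_def by blast
  then have "(\<lambda>x. p x + q x) = (\<lambda>x. \<Sum>\<alpha> | int (sum \<alpha> UNIV) \<le> k. monomial \<alpha> x *\<^sub>R (c \<alpha> + d \<alpha>))"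
    by (simp add: scaleR_add_right sum.distrib)
  then show ?thesis by (rule polysI[where c = "\<lambda>\<alpha>. c \<alpha> + d \<alpha>"])
qed

lemma hom_polys_add:
  assumes "p \<in> hom_polys k" "q \<in> hom_polys k" shows "(\<lambda>x. p x + q x) \<in> hom_polys k"
proof -
  from assms obtain c d where "p = (\<lambda>x. \<Sum>\<alpha> | int (sum \<alpha> UNIV) = k. monomial \<alpha> x *\<^sub>R c \<alpha>)"
    "q = (\<lambda>x. \<Sum>\<alpha> | int (sum \<alpha> UNIV) = k. monomial \<alpha> x *\<^sub>R d \<alpha>)"
    unfolding hom_polys_def by blast
  then have "(\<lambda>x. p x + q x) = (\<lambda>x. \<Sum>\<alpha> | int (sum \<alpha> UNIV) = k. monomial \<alpha> x *\<^sub>R (c \<alpha> + d \<alpha>))"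
    by (simp add: scaleR_add_right sum.distrib)
  then show ?thesis by (rule hom_polysI[where c = "\<lambda>\<alpha>. c \<alpha> + d \<alpha>"])
qed

lemma hom_polys_scaleR:
  assumes "p \<in> hom_polys k" shows "(\<lambda>x. a *\<^sub>R p x) \<in> hom_polys k"
proof -
  from assms obtain c where "p = (\<lambda>x. \<Sum>\<alpha> | int (sum \<alpha> UNIV) = k. monomial \<alpha> x *\<^sub>R c \<alpha>)"
    unfolding hom_polys_def by blast
  then have "(\<lambda>x. a *\<^sub>R p x) = (\<lambda>x. \<Sum>\<alpha> | int (sum \<alpha> UNIV) = k. monomial \<alpha> x *\<^sub>R (a *\<^sub>R c \<alpha>))"
    by (simp add: scaleR_sum_right mult.commute)
  then show ?thesis by (rule hom_polysI[where c = "\<lambda>\<alpha>. a *\<^sub>R c \<alpha>"])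
qed

lemma monomial_in_polys:
  assumes "int (sum \<alpha> UNIV) \<le> k" shows "(\<lambda>x. monomial \<alpha> x *\<^sub>R c) \<in> polys k"
proof -
  have "(\<Sum>\<beta> | int (sum \<beta> UNIV) \<le> k. monomial \<beta> x *\<^sub>R (if \<beta> = \<alpha> then c else 0)) =
      (\<Sum>\<beta> | int (sum \<beta> UNIV) \<le> k. if \<beta> = \<alpha> then monomial \<beta> x *\<^sub>R c else 0)" for x
    by (rule sum.cong) auto
  also have "\<dots> x = monomial \<alpha> x *\<^sub>R c" for x
    unfolding sum.delta[OF finite_exponents] using assms by auto
  finally have "(\<lambda>x. monomial \<alpha> x *\<^sub>R c) =
      (\<lambda>x. \<Sum>\<beta> | int (sum \<beta> UNIV) \<le> k. monomial \<beta> x *\<^sub>R (if \<beta> = \<alpha> then c else 0))"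
    by (simp add: fun_eq_iff)
  then show ?thesis by (rule polysI[where c = "\<lambda>\<beta>. if \<beta> = \<alpha> then c else 0"])
qed

text \<open>The definition carries one coefficient function for all exponents; this rule hides it,
  so that closure properties need checking only on single monomials and on sums.\<close>

lemma polys_induct [consumes 1, case_names zero monomial add]:
  assumes "p \<in> polys k"
    and "P (\<lambda>x. 0)" and mono: "\<And>\<alpha> c. int (sum \<alpha> UNIV) \<le> k \<Longrightarrow> P (\<lambda>x. monomial \<alpha> x *\<^sub>R c)"
    and add: "\<And>p q. p \<in> polys k \<Longrightarrow> q \<in> polys k \<Longrightarrow> P p \<Longrightarrow> P q \<Longrightarrow> P (\<lambda>x. p x + q x)"
  shows "P p"
proof -
  obtain c where c: "p = (\<lambda>x. \<Sum>\<alpha> | int (sum \<alpha> UNIV) \<le> k. monomial \<alpha> x *\<^sub>R c \<alpha>)"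
    using assms(1) by (auto simp: polys_def)
  have "(\<lambda>x. \<Sum>\<alpha>\<in>A. monomial \<alpha> x *\<^sub>R c \<alpha>) \<in> polys k \<and> P (\<lambda>x. \<Sum>\<alpha>\<in>A. monomial \<alpha> x *\<^sub>R c \<alpha>)"
    if "finite A" "A \<subseteq> {\<alpha>. int (sum \<alpha> UNIV) \<le> k}" for A
    using that
  proof (induction A rule: finite_induct)
    case empty then show ?case using assms(2) by simp
  next
    case (insert \<alpha> A)
    then have 1: "int (sum \<alpha> UNIV) \<le> k" by simp
    show ?case using insert add[OF monomial_in_polys[OF 1] _ mono[OF 1], of "\<lambda>x. \<Sum>\<alpha>\<in>A. monomial \<alpha> x *\<^sub>R c \<alpha>" "c \<alpha>"]
        polys_add[OF monomial_in_polys[OF 1], of "\<lambda>x. \<Sum>\<alpha>\<in>A. monomial \<alpha> x *\<^sub>R c \<alpha>" "c \<alpha>"]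
      by simp
  qed
  from this[OF finite_exponents order_refl] show ?thesis unfolding c by blast
qed

lemma polys_mono:
  assumes "p \<in> polys k" "k \<le> m" shows "p \<in> polys m"
  using assms(1) by (induction rule: polys_induct) (use assms(2) in \<open>auto intro: monomial_in_polys polys_add\<close>)

lemma polys_linear:
  assumes "p \<in> polys k" "linear h" shows "(\<lambda>x. h (p x)) \<in> polys k"
  using assms(1)
proof (induction rule: polys_induct)
  case zero then show ?case using linear_0[OF assms(2)] by simp
next
  case (monomial \<alpha> c) then show ?case using linear_scale[OF assms(2)] by (simp add: monomial_in_polys)
next
  case (add p q) then show ?case using linear_add[OF assms(2)] by (simp add: polys_add)
qed

lemma polys_sum: "(\<And>i. i \<in> I \<Longrightarrow> p i \<in> polys k) \<Longrightarrow> (\<lambda>x. \<Sum>i\<in>I. p i x) \<in> polys k"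
  by (induction I rule: infinite_finite_induct) (auto intro: polys_add)

lemma monomial_mult: "monomial \<alpha> x * monomial \<beta> x = monomial (\<lambda>i. \<alpha> i + \<beta> i) x"
  by (simp add: monomial_def power_add prod.distrib)

lemma polys_scaleR_mult:
  fixes p :: "real^'n \<Rightarrow> real"
  assumes p: "p \<in> polys a" and q: "q \<in> polys b"
  shows "(\<lambda>x. p x *\<^sub>R q x) \<in> polys (a + b)"
  using p
proof (induction rule: polys_induct)
  case zero then show ?case by simp
next
  case (monomial \<alpha> c)
  from q show ?case
  proof (induction rule: polys_induct)
    case zero then show ?case by simp
  next
    case m: (monomial \<beta> d)
    have "int (sum (\<lambda>i. \<alpha> i + \<beta> i) UNIV) \<le> a + b" using m monomial by (simp add: sum.distrib)
    from monomial_in_polys[OF this, of "c *\<^sub>R d"] show ?case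
      by (simp add: monomial_mult[symmetric] mult_ac)
  next
    case (add p q) then show ?case by (simp add: polys_add scaleR_add_right)
  qed
next
  case (add p q) then show ?case by (simp add: polys_add scaleR_add_left)
qed

lemma polys_mult:
  fixes p q :: "real^'n \<Rightarrow> real"
  shows "p \<in> polys a \<Longrightarrow> q \<in> polys b \<Longrightarrow> (\<lambda>x. p x * q x) \<in> polys (a + b)"
  using polys_scaleR_mult[of p a q b] by simp

lemma const_in_polys: "0 \<le> k \<Longrightarrow> (\<lambda>x. c) \<in> polys k"
  using monomial_in_polys[of "\<lambda>_. 0" k c] by (simp add: monomial_def)

lemma coord_in_polys: "(\<lambda>x::real^'n. x $ i) \<in> polys 1"
proof -
  let ?\<alpha> = "\<lambda>j. if j = i then 1 else (0::nat)"
  have "monomial ?\<alpha> x = x $ i" for x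
    unfolding monomial_def using prod.delta[of UNIV i "\<lambda>j. x $ j"]
    by (simp add: if_distrib cong: if_cong)
  then show ?thesis using monomial_in_polys[of ?\<alpha> 1 "1::real"] by simp
qed

lemma polys_componentwise:
  fixes p :: "real^'n \<Rightarrow> real^'m"
  assumes "\<And>i. (\<lambda>x. p x $ i) \<in> polys k" shows "p \<in> polys k"
proof -
  have "(\<lambda>x. axis i (p x $ i)) \<in> polys k" for i
    using assms by (rule polys_linear) (auto simp: axis_def linear_iff vec_eq_iff)
  then have "(\<lambda>x. \<Sum>i\<in>UNIV. axis i (p x $ i)) \<in> polys k" by (rule polys_sum)
  moreover have "(\<Sum>i\<in>UNIV. axis i (p x $ i)) = p x" for x
    by (simp add: vec_eq_iff axis_def sum.delta)
  ultimately show ?thesis by simp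
qed

lemma id_in_polys: "(\<lambda>x::real^'n. x) \<in> polys 1"
  by (rule polys_componentwise) (rule coord_in_polys)

lemma affine_in_polys: "(\<lambda>x::real^'n. g \<bullet> x + b) \<in> polys 1"
  using polys_add[OF polys_linear[OF id_in_polys, of "(\<bullet>) g"] const_in_polys[of 1 b]]
  by (simp add: bounded_linear.linear bounded_linear_inner_right)

section \<open>Derivatives of polynomials\<close>

lemma monomial_has_derivative:
  fixes c :: "'b::real_normed_vector"
  shows "((\<lambda>x. monomial \<alpha> x *\<^sub>R c) has_derivative
    (\<lambda>h. (\<Sum>j\<in>UNIV. h $ j * (of_nat (\<alpha> j) * monomial (\<alpha>(j := \<alpha> j - 1)) x)) *\<^sub>R c)) (at x)"
proof -
  have *: "monomial (\<alpha>(j := \<alpha> j - 1)) x = (x $ j) ^ (\<alpha> j - 1) * (\<Prod>i\<in>UNIV - {j}. (x $ i) ^ \<alpha> i)" for j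
    unfolding monomial_def by (subst prod.remove[of UNIV j]) (auto intro: prod.cong)
  show ?thesis
    unfolding * unfolding monomial_def
    apply (rule derivative_eq_intros refl)+
    apply (rule bounded_linear.has_derivative[OF bounded_linear_vec_nth has_derivative_ident])
    apply (rule derivative_eq_intros refl)+
    apply (simp add: mult_ac)
    done
qed

lemma partial_eqI: "(f has_derivative f') (at x) \<Longrightarrow> partial j f x = f' (axis j 1)"
  unfolding partial_def using frechet_derivative_at by metis

text \<open>The truncated subtraction in the exponent is harmless: where
  \<open>\<alpha> j = 0\<close>, the factor \<open>of_nat (\<alpha> j)\<close> is zero.\<close>

lemma partial_monomial:
  "partial j (\<lambda>x. monomial \<alpha> x *\<^sub>R c) x = monomial (\<alpha>(j := \<alpha> j - 1)) x *\<^sub>R (of_nat (\<alpha> j) *\<^sub>R c)"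
proof -
  have "(\<Sum>i\<in>UNIV. axis j 1 $ i * (of_nat (\<alpha> i) * monomial (\<alpha>(i := \<alpha> i - 1)) x)) =
      (\<Sum>i\<in>UNIV. if i = j then of_nat (\<alpha> i) * monomial (\<alpha>(i := \<alpha> i - 1)) x else 0)"
    by (rule sum.cong) (auto simp: axis_def)
  then show ?thesis unfolding partial_eqI[OF monomial_has_derivative] by (simp add: mult.commute)
qed

lemma frechet_derivative_worksI:
  "f differentiable F \<Longrightarrow> (f has_derivative frechet_derivative f F) F"
  by (simp add: frechet_derivative_works)

lemma partial_add:
  "f differentiable at x \<Longrightarrow> g differentiable at x \<Longrightarrow> partial j (\<lambda>x. f x + g x) x = partial j f x + partial j g x"
  using partial_eqI[OF has_derivative_add[OF frechet_derivative_worksI frechet_derivative_worksI]]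
  by (simp add: partial_def)

lemma partial_linear:
  assumes "f differentiable at x" "bounded_linear h"
  shows "partial j (\<lambda>x. h (f x)) x = h (partial j f x)"
  using partial_eqI[OF bounded_linear.has_derivative[OF assms(2) assms(1)[unfolded frechet_derivative_works]]]
  by (simp add: partial_def)

lemma polys_differentiable:
  assumes "p \<in> polys k" shows "p differentiable at x"
  using assms by (induction rule: polys_induct) (auto simp: differentiable_def intro: monomial_has_derivative, 
    metis has_derivative_add)

lemma polys_partial:
  fixes p :: "real^'n \<Rightarrow> 'b::real_normed_vector"
  assumes "p \<in> polys k" shows "partial j p \<in> polys (k - 1)"
  using assms
proof (induction rule: polys_induct)
  case zero
  have "partial j (\<lambda>x. 0 :: 'b) = (\<lambda>x::real^'n. 0)" by (simp add: partial_def fun_eq_iff)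
  then show ?case by simp
next
  case (monomial \<alpha> c)
  have sum: "sum (\<alpha>(j := \<alpha> j - 1)) UNIV + 1 = sum \<alpha> UNIV" if "\<alpha> j > 0"
    using that by (simp add: sum.remove[of UNIV j])
  show ?case
  proof (cases "\<alpha> j = 0")
    case True then show ?thesis by (simp add: partial_monomial[abs_def])
  next
    case False
    have "int (sum (\<alpha>(j := \<alpha> j - 1)) UNIV) \<le> k - 1"
      using sum False monomial by (simp del: fun_upd_apply of_nat_sum)
    then show ?thesis unfolding partial_monomial[abs_def] by (rule monomial_in_polys)
  qed
next
  case (add p q)
  have "partial j (\<lambda>x. p x + q x) = (\<lambda>x. partial j p x + partial j q x)"
    using add(1,2) by (auto intro: partial_add polys_differentiable)
  then show ?case using add by (simp add: polys_add)
qed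

lemma polys_continuous: "p \<in> polys k \<Longrightarrow> continuous_on S (p :: real^'n \<Rightarrow> 'b::real_normed_vector)"
  using polys_differentiable by (metis continuous_at_imp_continuous_on differentiable_imp_continuous_within)

text \<open>Only the part of top degree may be multiplied by \<open>x\<close> in a Raviart--Thomas
  field as the homogeneous summand; membership proofs have to isolate it.\<close>

lemma polys_split_top:
  fixes p :: "real^'n \<Rightarrow> 'b::real_vector"
  assumes "p \<in> polys k"
  obtains p' q where "p' \<in> polys (k - 1)" "q \<in> hom_polys k" "p = (\<lambda>x. p' x + q x)"
proof -
  obtain c where c: "p = (\<lambda>x. \<Sum>\<alpha> | int (sum \<alpha> UNIV) \<le> k. monomial \<alpha> x *\<^sub>R c \<alpha>)"
    using assms by (auto simp: polys_def)
  have *: "{\<alpha>::'n \<Rightarrow> nat. int (sum \<alpha> UNIV) \<le> k} = {\<alpha>. int (sum \<alpha> UNIV) \<le> k - 1} \<union> {\<alpha>. int (sum \<alpha> UNIV) = k}"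
    by auto
  have "finite {\<alpha>::'n \<Rightarrow> nat. int (sum \<alpha> UNIV) = k}" by (rule finite_subset[OF _ finite_exponents[of k]]) auto
  then have "p = (\<lambda>x. (\<Sum>\<alpha> | int (sum \<alpha> UNIV) \<le> k - 1. monomial \<alpha> x *\<^sub>R c \<alpha>) + (\<Sum>\<alpha> | int (sum \<alpha> UNIV) = k. monomial \<alpha> x *\<^sub>R c \<alpha>))"
    unfolding c * by (subst sum.union_disjoint[OF finite_exponents]) auto
  then show ?thesis by (rule that[rotated 2]) (auto simp: polys_def hom_polys_def)
qed

text \<open>The local Raviart--Thomas space, taken as fields on the whole space and not on one
  element: traces on faces are then plain evaluations.\<close>

definition RT :: "int \<Rightarrow> (real^'n::finite \<Rightarrow> real^'n) set" where
  "RT k = {v. \<exists>p\<in>polys k. \<exists>q\<in>hom_polys k. v = (\<lambda>x. p x + q x *\<^sub>R x)}"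

lemma RTI: "p \<in> polys k \<Longrightarrow> q \<in> hom_polys k \<Longrightarrow> v = (\<lambda>x. p x + q x *\<^sub>R x) \<Longrightarrow> v \<in> RT k"
  unfolding RT_def by blast

lemma RT_add:
  assumes "u \<in> RT k" "v \<in> RT k" shows "(\<lambda>x. u x + v x) \<in> RT k"
proof -
  from assms obtain p p' q q' where "p \<in> polys k" "p' \<in> polys k" "q \<in> hom_polys k" "q' \<in> hom_polys k"
    "u = (\<lambda>x. p x + q x *\<^sub>R x)" "v = (\<lambda>x. p' x + q' x *\<^sub>R x)"
    unfolding RT_def by blast
  then show ?thesis
    by (intro RTI[OF polys_add[of p k p'] hom_polys_add[of q k q']]) (auto simp: algebra_simps)
qed

lemma RT_scaleR:
  assumes "u \<in> RT k" shows "(\<lambda>x. c *\<^sub>R u x) \<in> RT k"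
proof -
  from assms obtain p q where "p \<in> polys k" "q \<in> hom_polys k" "u = (\<lambda>x. p x + q x *\<^sub>R x)"
    unfolding RT_def by blast
  then show ?thesis
    by (intro RTI[OF polys_linear[of p k "\<lambda>x. c *\<^sub>R x"] hom_polys_scaleR[of q k c]])
      (auto simp: algebra_simps linear_iff)
qed

lemma RT_sum: "(\<And>i. i \<in> I \<Longrightarrow> p i \<in> RT k) \<Longrightarrow> (\<lambda>x. \<Sum>i\<in>I. p i x) \<in> RT k"
proof (induction I rule: infinite_finite_induct)
  case empty
  show ?case unfolding RT_def by (simp, intro bexI[of _ "\<lambda>x. 0"]) auto
next
  case (infinite A)
  show ?case unfolding RT_def using infinite by (simp, intro bexI[of _ "\<lambda>x. 0"]) auto
qed (auto intro: RT_add)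

lemma RT_subset_polys: "v \<in> RT k \<Longrightarrow> v \<in> polys (k + 1)"
  unfolding RT_def using polys_add[OF polys_mono[of _ k "k+1"] polys_scaleR_mult[OF subsetD[OF hom_polys_subset] id_in_polys]]
  by auto

lemma RT_radial:
  assumes "p \<in> polys k" shows "(\<lambda>x. p x *\<^sub>R (x - c)) \<in> RT k"
proof -
  obtain p' q where pq: "p' \<in> polys (k - 1)" "q \<in> hom_polys k" "p = (\<lambda>x. p' x + q x)"
    using polys_split_top[OF assms] by metis
  have "(\<lambda>x. p x *\<^sub>R (- c)) \<in> polys k" by (rule polys_linear[OF assms]) (simp add: linear_iff algebra_simps)
  then have "(\<lambda>x. p' x *\<^sub>R x + p x *\<^sub>R (- c)) \<in> polys k"
    using polys_add polys_scaleR_mult[OF pq(1) id_in_polys] by fastforce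
  moreover have "(\<lambda>x. p x *\<^sub>R (x - c)) = (\<lambda>x. (p' x *\<^sub>R x + p x *\<^sub>R (- c)) + q x *\<^sub>R x)"
    unfolding pq(3) by (auto simp: algebra_simps)
  ultimately show ?thesis using RTI pq(2) by blast
qed

section \<open>Polynomials along lines, and divergence-free Raviart-Thomas fields\<close>

lemma polys_restrict_line:
  fixes p :: "real^'n \<Rightarrow> real"
  assumes "p \<in> polys k" obtains P where "\<And>t. p (y + t *\<^sub>R z) = poly P t"
proof -
  have "\<exists>P. \<forall>t. p (y + t *\<^sub>R z) = poly P t" using assms
  proof (induction rule: polys_induct)
    case zero then show ?case by (intro exI[of _ 0]) simp
  next
    case (monomial \<alpha> c)
    then show ?case
      by (intro exI[of _ "smult c (\<Prod>i\<in>UNIV. [:y $ i, z $ i:] ^ \<alpha> i)"])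
        (simp add: monomial_def poly_prod mult_ac)
  next
    case (add p q) then show ?case by (metis poly_add)
  qed
  then show ?thesis using that by blast
qed

text \<open>The segment from \<open>y\<close> towards \<open>x\<close> starts inside
  \<open>U\<close>, so the univariate restriction to that line has infinitely many roots and is the
  zero polynomial.\<close>

lemma polys_eq_0_of_open:
  fixes p :: "real^'n \<Rightarrow> real"
  assumes "p \<in> polys k" "open U" "y \<in> U" "\<And>x. x \<in> U \<Longrightarrow> p x = 0"
  shows "p x = 0"
proof -
  obtain P where P: "\<And>t. p (y + t *\<^sub>R (x - y)) = poly P t"
    using polys_restrict_line[OF assms(1)] by metis
  have "((\<lambda>t. y + t *\<^sub>R (x - y)) \<longlongrightarrow> y + 0 *\<^sub>R (x - y)) (at_right 0)"
    by (intro tendsto_intros)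
  then have "\<forall>\<^sub>F t in at_right 0. y + t *\<^sub>R (x - y) \<in> U"
    using topological_tendstoD assms(2,3) by fastforce
  then obtain b where b: "b > 0" "\<And>t. 0 < t \<Longrightarrow> t < b \<Longrightarrow> y + t *\<^sub>R (x - y) \<in> U"
    unfolding eventually_at_right_field by auto
  have "{0<..<b} \<subseteq> {t. poly P t = 0}" using b assms(4) P by force
  then have "infinite {t. poly P t = 0}"
    using b(1) finite_subset infinite_Ioo by blast
  then have "P = 0" using poly_roots_finite by blast
  then show ?thesis using P[of 1] by simp
qed

lemma monomial_scaleR: "monomial \<alpha> (t *\<^sub>R x) = t ^ (sum \<alpha> UNIV) * monomial \<alpha> x"
  by (simp add: monomial_def power_mult_distrib prod.distrib power_sum)

text \<open>Growth of order \<open>k - 1\<close> along a ray. The factor \<open>t\<close> stands on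
  the left so that \<open>k = 0\<close> needs no negative power.\<close>

lemma polys_growth:
  fixes p :: "real^'n \<Rightarrow> real"
  assumes "p \<in> polys (int k - 1)"
  shows "\<exists>C. \<forall>t\<ge>1. \<bar>p (t *\<^sub>R x)\<bar> * t \<le> C * t ^ k"
  using assms
proof (induction rule: polys_induct)
  case zero then show ?case by (intro exI[of _ 0]) simp
next
  case (monomial \<alpha> c)
  show ?case
  proof (intro exI[of _ "\<bar>monomial \<alpha> x * c\<bar>"] allI impI)
    fix t :: real assume t: "1 \<le> t"
    have "t ^ (Suc (sum \<alpha> UNIV)) \<le> t ^ k" using monomial t by (intro power_increasing) (auto simp del: of_nat_sum)
    then have "\<bar>monomial \<alpha> x * c\<bar> * t ^ (Suc (sum \<alpha> UNIV)) \<le> \<bar>monomial \<alpha> x * c\<bar> * t ^ k"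
      by (rule mult_left_mono) simp
    then show "\<bar>monomial \<alpha> (t *\<^sub>R x) *\<^sub>R c\<bar> * t \<le> \<bar>monomial \<alpha> x * c\<bar> * t ^ k"
      using t by (simp add: monomial_scaleR abs_mult mult_ac)
  qed
next
  case (add p q)
  then obtain C D where "\<forall>t\<ge>1. \<bar>p (t *\<^sub>R x)\<bar> * t \<le> C * t ^ k" "\<forall>t\<ge>1. \<bar>q (t *\<^sub>R x)\<bar> * t \<le> D * t ^ k" by blast
  moreover have "\<bar>p (t *\<^sub>R x) + q (t *\<^sub>R x)\<bar> * t \<le> \<bar>p (t *\<^sub>R x)\<bar> * t + \<bar>q (t *\<^sub>R x)\<bar> * t" if "t \<ge> 1" for t
    using that by (simp add: distrib_right[symmetric] mult_right_mono abs_triangle_ineq)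
  ultimately show ?case
    by (intro exI[of _ "C + D"]) (smt (verit) distrib_right)
qed

lemma hom_polys_scaled:
  assumes "q \<in> hom_polys (int k)" shows "q (t *\<^sub>R x) = t ^ k *\<^sub>R q x"
  using assms unfolding hom_polys_def
  by (auto simp: scaleR_sum_right monomial_scaleR simp del: of_nat_sum intro!: sum.cong)

definition vdiv :: "(real^'n::finite \<Rightarrow> real^'n) \<Rightarrow> real^'n \<Rightarrow> real" where
  "vdiv w x = (\<Sum>j\<in>UNIV. partial j (\<lambda>y. w y $ j) x)"

lemma polys_vdiv:
  assumes "p \<in> polys k" shows "vdiv p \<in> polys (k - 1)"
  unfolding vdiv_def[abs_def]
  by (intro polys_sum polys_partial polys_linear[OF assms]) (simp add: linear_iff)

lemma polys_comp: "p \<in> polys k \<Longrightarrow> (\<lambda>x. p x $ i) \<in> polys k"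
  by (erule polys_linear) (simp add: linear_iff)

lemma partial_mult:
  fixes f g :: "real^'n \<Rightarrow> real"
  assumes "f differentiable at x" "g differentiable at x"
  shows "partial j (\<lambda>x. f x * g x) x = f x * partial j g x + partial j f x * g x"
  using partial_eqI[OF has_derivative_mult[OF assms[unfolded frechet_derivative_works]]]
  by (simp add: partial_def)

lemma partial_coord: "partial j (\<lambda>x::real^'n. x $ i) x = (if i = j then 1 else 0)"
  using partial_eqI[OF bounded_linear.has_derivative[OF bounded_linear_vec_nth has_derivative_ident], of j i x]
  by (simp add: axis_def)

text \<open>Both sides are the derivative at \<open>t = 1\<close> of
  \<open>q (t *\<^sub>R x)\<close>, computed once by the chain rule and once from
  homogeneity.\<close>

lemma euler_hom_polys:
  fixes q :: "real^'n \<Rightarrow> real"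
  assumes "q \<in> hom_polys (int k)"
  shows "(\<Sum>j\<in>UNIV. x $ j * partial j q x) = real k * q x"
proof -
  have d: "q differentiable at x" for x
    using assms hom_polys_subset polys_differentiable by blast
  have line: "((\<lambda>t. q (t *\<^sub>R x)) has_real_derivative (\<Sum>j\<in>UNIV. x $ j * partial j q x)) (at 1)"
  proof -
    have "(q has_derivative frechet_derivative q (at x)) (at (1 *\<^sub>R x))"
      using frechet_derivative_worksI[OF d[of x]] by simp
    then have "((\<lambda>t. q (t *\<^sub>R x)) has_derivative (\<lambda>h. frechet_derivative q (at x) (h *\<^sub>R x))) (at 1)"
      by (rule has_derivative_compose[rotated]) (auto intro!: derivative_eq_intros)
    moreover have "frechet_derivative q (at x) (h *\<^sub>R x) = (\<Sum>j\<in>UNIV. x $ j * partial j q x) * h" for h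
    proof -
      interpret linear "frechet_derivative q (at x)" using d linear_frechet_derivative by blast
      have "frechet_derivative q (at x) x = frechet_derivative q (at x) (\<Sum>j\<in>UNIV. x $ j *\<^sub>R axis j 1)"
        by (simp add: basis_expansion scalar_mult_eq_scaleR[symmetric])
      also have "\<dots> = (\<Sum>j\<in>UNIV. x $ j * partial j q x)"
        by (simp add: sum scaleR partial_def)
      finally show ?thesis by (simp add: scaleR)
    qed
    ultimately show ?thesis by (simp add: has_field_derivative_def)
  qed
  have "((\<lambda>t. t ^ k *\<^sub>R q x) has_real_derivative real k * q x) (at 1)"
    by (auto intro!: derivative_eq_intros)
  with line show ?thesis unfolding hom_polys_scaled[OF assms] using DERIV_unique by blast
qed

text \<open>Euler's relation gives \<open>div (q x) = (d + k) q\<close>, the part of degree \<open>k\<close> of the divergence.\<close>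

lemma RT_div_free:
  fixes v :: "real^'n \<Rightarrow> real^'n"
  assumes "v \<in> RT (int k)" "open U" "U \<noteq> {}" "\<And>x. x \<in> U \<Longrightarrow> vdiv v x = 0"
  shows "v \<in> polys (int k)"
proof -
  obtain p q where pq: "p \<in> polys (int k)" "q \<in> hom_polys (int k)" "v = (\<lambda>x. p x + q x *\<^sub>R x)"
    using assms(1) by (auto simp: RT_def)
  have dq: "q differentiable at x" for x
    using pq(2) hom_polys_subset polys_differentiable by blast
  have dx: "(\<lambda>x::real^'n. x $ j) differentiable at x" for j x
    using polys_differentiable[OF coord_in_polys] .
  have dp: "(\<lambda>x. p x $ j) differentiable at x" for j x
    using polys_differentiable[OF polys_comp[OF pq(1)]] .
  have v: "vdiv v x = vdiv p x + (real CARD('n) + real k) * q x" for x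
  proof -
    have "partial j (\<lambda>y. v y $ j) x = partial j (\<lambda>y. p y $ j) x + (q x + x $ j * partial j q x)" for j
      unfolding pq(3) using dq dx dp
      by (simp add: partial_add partial_mult partial_coord)
    then show ?thesis unfolding vdiv_def
      by (simp add: sum.distrib euler_hom_polys[OF pq(2)] algebra_simps)
  qed
  have v0: "vdiv v x = 0" for x
    using polys_eq_0_of_open[OF polys_vdiv[OF RT_subset_polys[OF assms(1)]] assms(2)] assms(3,4) by blast
  \<comment> \<open>Along the ray through \<open>x\<close> the contribution of \<open>q\<close>
    grows like \<open>t ^ k\<close>, whereas \<open>vdiv p\<close> has degree \<open>k - 1\<close>
    and cannot cancel it. The value \<open>?t\<close> below is chosen so that \<open>?c * ?t\<close>
    exceeds the growth constant \<open>C\<close>.\<close>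
  have "q x = 0" for x
  proof (rule ccontr)
    assume q: "q x \<noteq> 0"
    obtain C where C: "\<And>t. t \<ge> 1 \<Longrightarrow> \<bar>vdiv p (t *\<^sub>R x)\<bar> * t \<le> C * t ^ k"
      using polys_growth[OF polys_vdiv[OF pq(1)], of x] by blast
    let ?c = "(real CARD('n) + real k) * \<bar>q x\<bar>"
    have c: "?c > 0" using q by (simp add: add_pos_nonneg)
    have le: "?c * t \<le> C" if t: "t \<ge> 1" for t
    proof -
      have "vdiv p (t *\<^sub>R x) = - ((real CARD('n) + real k) * (t ^ k * q x))"
        using v[of "t *\<^sub>R x"] v0[of "t *\<^sub>R x"] hom_polys_scaled[OF pq(2), of t x] by simp
      then have "\<bar>vdiv p (t *\<^sub>R x)\<bar> = ?c * t ^ k" using t by (simp add: abs_mult)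
      then have "(?c * t) * t ^ k \<le> C * t ^ k" using C[OF t] by (simp add: mult_ac)
      then show ?thesis using t by (simp add: mult_le_cancel_right zero_less_power not_less)
    qed
    let ?t = "max 1 ((C + 1) / ?c)"
    have "C + 1 = ?c * ((C + 1) / ?c)" using c by (metis less_irrefl nonzero_mult_div_cancel_left times_divide_eq_right)
    also have "\<dots> \<le> ?c * ?t" using c by (intro mult_left_mono) auto
    also have "\<dots> \<le> C" by (rule le) simp
    finally show False by simp
  qed
  then show ?thesis using pq(1) unfolding pq(3) by simp
qed

section \<open>Simplices in barycentric coordinates\<close>

text \<open>\<open>g c \<bullet> x + b c\<close> is the barycentric coordinate of \<open>x\<close> belonging to the vertex \<open>c\<close>.\<close>

definition barycentric :: "'a::euclidean_space set \<Rightarrow> ('a \<Rightarrow> 'a) \<Rightarrow> ('a \<Rightarrow> real) \<Rightarrow> bool" where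
  "barycentric C g b \<longleftrightarrow> finite C \<and> (\<forall>x. (\<Sum>c\<in>C. g c \<bullet> x + b c) = 1) \<and>
     (\<forall>x. (\<Sum>c\<in>C. (g c \<bullet> x + b c) *\<^sub>R c) = x) \<and>
     (\<forall>c\<in>C. \<forall>c'\<in>C. g c \<bullet> c' + b c = (if c' = c then 1 else 0))"

text \<open>Differences of affinely independent points are linearly independent, so a linear
  functional may be prescribed on them; made affine by a constant, it is the coordinate
  wanted.\<close>

lemma barycentric_exists:
  fixes C :: "'a::euclidean_space set"
  assumes C: "\<not> affine_dependent C" "card C = DIM('a) + 1"
  obtains g b where "barycentric C g b"
proof -
  have fin: "finite C" using C(1) aff_independent_finite by blast
  have "\<exists>g b. \<forall>c'\<in>C. g \<bullet> c' + b = (if c' = c then 1 else 0)" if c: "c \<in> C" for c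
  proof -
    \<comment> \<open>The base point \<open>c0\<close> must differ from \<open>c\<close>: the
      functional \<open>L\<close> is 1 on \<open>c - c0\<close> and 0 on the other differences, and
      subtracting \<open>L c0\<close> gives the value 0 at \<open>c0\<close> itself.\<close>
    have "card (C - {c}) > 0" using c C(2) fin by (simp add: DIM_positive)
    then obtain c0 where c0: "c0 \<in> C" "c0 \<noteq> c" by (metis Diff_iff card_gt_0_iff ex_in_conv insertI1)
    let ?S = "(\<lambda>x. x - c0) ` (C - {c0})"
    have "insert c0 (C - {c0}) = C" using c0 by blast
    then have "independent ?S"
      using affine_dependent_iff_dependent2[OF c0(1)] C(1) by (simp add: image_def)
    then obtain L where L: "linear L" "\<forall>x\<in>?S. L x = (if x = c - c0 then 1 else 0::real)"
      using linear_independent_extend[of ?S "\<lambda>x. if x = c - c0 then 1 else 0::real"] by auto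
    \<comment> \<open>The Riesz representative of \<open>L\<close>.\<close>
    define g where "g = (\<Sum>i\<in>Basis. L i *\<^sub>R i)"
    have gL: "g \<bullet> x = L x" for x
    proof -
      have "L x = L (\<Sum>i\<in>Basis. (x \<bullet> i) *\<^sub>R i)" by (simp add: euclidean_representation)
      also have "\<dots> = (\<Sum>i\<in>Basis. (x \<bullet> i) * L i)" using L(1) by (simp add: linear_sum linear_scale)
      also have "\<dots> = g \<bullet> x" unfolding g_def by (simp add: inner_sum_left inner_sum_right inner_commute mult.commute)
      finally show ?thesis by simp
    qed
    show ?thesis
    proof (intro exI[of _ g] exI[of _ "- L c0"] ballI)
      fix c' assume c': "c' \<in> C"
      have "L c' - L c0 = L (c' - c0)" using L(1) by (simp add: linear_diff)
      also have "\<dots> = (if c' = c then 1 else 0)"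
        using L(2) c' c0 linear_0[OF L(1)] by (cases "c' = c0") auto
      finally show "g \<bullet> c' + - L c0 = (if c' = c then 1 else 0)" by (simp add: gL)
    qed
  qed
  then have "\<forall>c\<in>C. \<exists>p. \<forall>c'\<in>C. fst p \<bullet> c' + snd p = (if c' = c then 1 else 0)" by simp
  from bchoice[OF this] obtain f where
    f: "\<forall>c\<in>C. \<forall>c'\<in>C. fst (f c) \<bullet> c' + snd (f c) = (if c' = c then 1 else 0)" by blast
  define g where "g = (\<lambda>c. fst (f c))"
  define b where "b = (\<lambda>c. snd (f c))"
  have gb: "\<And>c c'. c \<in> C \<Longrightarrow> c' \<in> C \<Longrightarrow> g c \<bullet> c' + b c = (if c' = c then 1 else 0 :: real)"
    using f by (simp add: g_def b_def)
  \<comment> \<open>By dimension every point is an affine combination of \<open>C\<close>.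
    Evaluating the affine coordinates on it returns its weights, which settles both identities at
    once.\<close>
  have "aff_dim C = int DIM('a)" using aff_dim_affine_independent[OF C(1)] C(2) by simp
  then have aff: "affine hull C = UNIV" by (simp add: aff_dim_eq_full)
  have *: "(\<Sum>c\<in>C. g c \<bullet> x + b c) = 1 \<and> (\<Sum>c\<in>C. (g c \<bullet> x + b c) *\<^sub>R c) = x" for x
  proof -
    have "x \<in> affine hull C" by (simp add: aff)
    then obtain u where u: "sum u C = 1" "(\<Sum>v\<in>C. u v *\<^sub>R v) = x"
      using fin by (auto simp: affine_hull_finite)
    have "g c \<bullet> x + b c = u c" if c: "c \<in> C" for c
    proof -
      have "g c \<bullet> x + b c = (\<Sum>v\<in>C. u v * (g c \<bullet> v)) + (\<Sum>v\<in>C. u v) * b c"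
        unfolding u(1) u(2)[symmetric] by (simp add: inner_sum_right)
      also have "\<dots> = (\<Sum>v\<in>C. u v * (g c \<bullet> v + b c))"
        by (simp add: sum.distrib sum_distrib_right distrib_left)
      also have "\<dots> = (\<Sum>v\<in>C. if v = c then u v else 0)" using gb c by (intro sum.cong) auto
      finally show ?thesis using c fin by simp
    qed
    then show ?thesis using u by simp
  qed
  show ?thesis by (rule that[of g b]) (use * gb fin in \<open>auto simp: barycentric_def\<close>)
qed

lemma simplex_barycentric:
  fixes T :: "'a::euclidean_space set"
  assumes "int DIM('a) simplex T"
  obtains C g b where "barycentric C g b" "T = convex hull C" "\<not> affine_dependent C" "card C = DIM('a) + 1"
proof -
  obtain C where C: "\<not> affine_dependent C" "int (card C) = int DIM('a) + 1" "T = convex hull C"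
    using assms by (auto simp: simplex_def)
  then have "card C = DIM('a) + 1" by linarith
  then show ?thesis using barycentric_exists[OF C(1)] C that by metis
qed

context
  fixes C :: "'a::euclidean_space set" and g b
  assumes bary: "barycentric C g b"
begin

lemma bary_finite: "finite C"
  and bary_sum: "(\<Sum>c\<in>C. g c \<bullet> x + b c) = 1"
  and bary_repr: "(\<Sum>c\<in>C. (g c \<bullet> x + b c) *\<^sub>R c) = x"
  and bary_vertex: "c \<in> C \<Longrightarrow> c' \<in> C \<Longrightarrow> g c \<bullet> c' + b c = (if c' = c then 1 else 0)"
  using bary by (auto simp: barycentric_def)

lemma bary_convex_comb:
  assumes "c \<in> C" "sum u C = 1"
  shows "g c \<bullet> (\<Sum>v\<in>C. u v *\<^sub>R v) + b c = u c"
proof -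
  have "g c \<bullet> (\<Sum>v\<in>C. u v *\<^sub>R v) + b c = (\<Sum>v\<in>C. u v * (g c \<bullet> v)) + (\<Sum>v\<in>C. u v) * b c"
    using assms by (simp add: inner_sum_right)
  also have "\<dots> = (\<Sum>v\<in>C. u v * (g c \<bullet> v + b c))"
    by (simp add: sum.distrib sum_distrib_right distrib_left)
  also have "\<dots> = (\<Sum>v\<in>C. if v = c then u v else 0)" using bary_vertex assms(1) by (intro sum.cong) auto
  finally show ?thesis using assms(1) bary_finite by simp
qed

text \<open>The coordinates of a point are themselves the weights of an affine combination that
  represents it, and they are the only ones.\<close>

lemma convex_hull_bary: "convex hull C = {x. \<forall>c\<in>C. 0 \<le> g c \<bullet> x + b c}"
proof (intro equalityI subsetI)
  fix x assume "x \<in> convex hull C"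
  then obtain u where u: "\<forall>c\<in>C. 0 \<le> u c" "sum u C = 1" "(\<Sum>v\<in>C. u v *\<^sub>R v) = x"
    using bary_finite by (auto simp: convex_hull_finite)
  then show "x \<in> {x. \<forall>c\<in>C. 0 \<le> g c \<bullet> x + b c}" using bary_convex_comb[of _ u] by auto
next
  fix x assume "x \<in> {x. \<forall>c\<in>C. 0 \<le> g c \<bullet> x + b c}"
  then show "x \<in> convex hull C" unfolding convex_hull_finite[OF bary_finite]
    using bary_sum[of x] bary_repr[of x] by (auto intro!: exI[of _ "\<lambda>c. g c \<bullet> x + b c"])
qed

lemma convex_hull_bary_facet:
  assumes c: "c \<in> C"
  shows "convex hull (C - {c}) = convex hull C \<inter> {x. g c \<bullet> x + b c = 0}"
proof (intro equalityI subsetI)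
  fix x assume x: "x \<in> convex hull (C - {c})"
  then obtain u where u: "\<forall>c'\<in>C - {c}. 0 \<le> u c'" "sum u (C - {c}) = 1" "(\<Sum>v\<in>C - {c}. u v *\<^sub>R v) = x"
    using bary_finite by (auto simp: convex_hull_finite)
  \<comment> \<open>Weights on the facet, extended by zero to the opposite vertex.\<close>
  let ?u = "u(c := 0)"
  have "sum ?u C = 1" "(\<Sum>v\<in>C. ?u v *\<^sub>R v) = x"
    using u(2,3) bary_finite c by (simp_all add: sum.remove[OF bary_finite c])
  then have "g c \<bullet> x + b c = 0" using bary_convex_comb[OF c, of ?u] by simp
  moreover have "x \<in> convex hull C" using x hull_mono[of "C - {c}" C convex] by blast
  ultimately show "x \<in> convex hull C \<inter> {x. g c \<bullet> x + b c = 0}" by simp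
next
  fix x assume x: "x \<in> convex hull C \<inter> {x. g c \<bullet> x + b c = 0}"
  then have "\<forall>c\<in>C. 0 \<le> g c \<bullet> x + b c" using convex_hull_bary by auto
  moreover have "(\<Sum>v\<in>C - {c}. g v \<bullet> x + b v) = 1" "(\<Sum>v\<in>C - {c}. (g v \<bullet> x + b v) *\<^sub>R v) = x"
    using x bary_sum[of x] bary_repr[of x] by (simp_all add: sum.remove[OF bary_finite c])
  ultimately show "x \<in> convex hull (C - {c})" unfolding convex_hull_finite[OF finite_Diff[OF bary_finite]]
    by (auto intro!: exI[of _ "\<lambda>c. g c \<bullet> x + b c"])
qed

lemma bary_two:
  assumes "card C = DIM('a) + 1" "c \<in> C" obtains c' where "c' \<in> C" "c' \<noteq> c"
proof -
  have "card (C - {c}) > 0" using assms bary_finite by (simp add: DIM_positive)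
  then show ?thesis using that by (metis Diff_iff card_gt_0_iff ex_in_conv insertI1)
qed

text \<open>Expand \<open>x - a\<close> in barycentric coordinates; only the vertex off the facet contributes.\<close>

lemma facet_normal:
  assumes c: "c \<in> C" and a: "a \<in> C" "a \<noteq> c"
    and u: "\<And>x y. x \<in> convex hull (C - {c}) \<Longrightarrow> y \<in> convex hull (C - {c}) \<Longrightarrow> u \<bullet> (y - x) = 0"
  shows "u = (u \<bullet> (c - a)) *\<^sub>R g c"
proof -
  have *: "u \<bullet> x - u \<bullet> a = (g c \<bullet> x + b c) * (u \<bullet> (c - a))" for x
  proof -
    have "u \<bullet> x - u \<bullet> a = (\<Sum>v\<in>C. (g v \<bullet> x + b v) * (u \<bullet> v)) - (\<Sum>v\<in>C. g v \<bullet> x + b v) * (u \<bullet> a)"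
      unfolding bary_sum by (subst (1) bary_repr[of x, symmetric]) (simp add: inner_sum_right)
    also have "\<dots> = (\<Sum>v\<in>C. (g v \<bullet> x + b v) * (u \<bullet> (v - a)))"
      by (simp add: sum_distrib_right inner_diff_right right_diff_distrib sum_subtractf)
    also have "\<dots> = (\<Sum>v\<in>C. if v = c then (g v \<bullet> x + b v) * (u \<bullet> (v - a)) else 0)"
      using u[of a] a by (intro sum.cong) (auto simp: hull_inc)
    finally show ?thesis using c bary_finite by simp
  qed
  have "u \<bullet> x = ((u \<bullet> (c - a)) *\<^sub>R g c) \<bullet> x" for x
    using *[of x] *[of 0] by (simp add: algebra_simps)
  then show ?thesis using vector_eq_rdot by blast
qed

lemma bary_gradient_nz:
  assumes "c \<in> C" "a \<in> C" "a \<noteq> c" shows "g c \<noteq> 0"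
  using bary_vertex[OF assms(1,1)] bary_vertex[OF assms(1,2)] assms(3) by auto

text \<open>A small step against the gradient stays in the simplex and lowers the coordinate by
  \<open>e * norm (g c)\<close>, yet the result is still nonnegative.\<close>

lemma interior_bary_pos:
  assumes "x \<in> interior (convex hull C)" "c \<in> C" "g c \<noteq> 0"
  shows "0 < g c \<bullet> x + b c"
proof -
  obtain e where e: "e > 0" "cball x e \<subseteq> convex hull C"
    using assms(1) by (meson mem_interior_cball)
  let ?y = "x - (e / norm (g c)) *\<^sub>R g c"
  have "?y \<in> cball x e" using assms(3) e(1) by (simp add: dist_norm)
  then have "0 \<le> g c \<bullet> ?y + b c" using e assms(2) convex_hull_bary by blast
  moreover have "g c \<bullet> ?y = g c \<bullet> x - e * norm (g c)"
    by (simp add: inner_diff_right dot_square_norm power2_eq_square)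
  ultimately show ?thesis using mult_pos_pos[OF e(1), of "norm (g c)"] assms(3) by simp
qed

lemma bary_pos_interior:
  assumes "\<And>c. c \<in> C \<Longrightarrow> 0 < g c \<bullet> x + b c" shows "x \<in> interior (convex hull C)"
proof -
  have "{x. \<forall>c\<in>C. 0 < g c \<bullet> x + b c} = (\<Inter>c\<in>C. {x. - b c < g c \<bullet> x})" by (force simp: algebra_simps)
  then have "open {x. \<forall>c\<in>C. 0 < g c \<bullet> x + b c}"
    using bary_finite by (auto intro!: open_INT open_halfspace_gt)
  then have "{x. \<forall>c\<in>C. 0 < g c \<bullet> x + b c} \<subseteq> interior (convex hull C)"
    by (intro interior_maximal) (auto simp: convex_hull_bary less_imp_le)
  then show ?thesis using assms by auto
qed

end

lemma simplex_facet_iff: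
  fixes C :: "'a::euclidean_space set"
  assumes "\<not> affine_dependent C" "card C = DIM('a) + 1"
  shows "F facet_of convex hull C \<longleftrightarrow> (\<exists>c\<in>C. F = convex hull (C - {c}))"
proof -
  have "2 \<le> card C" using assms(2) DIM_positive[where 'a='a] by linarith
  then show ?thesis using facet_of_convex_hull_affine_independent_alt[OF assms(1)] by (auto simp: Bex_def)
qed

text \<open>Lets sums over facets be reindexed by the opposite vertices.\<close>

lemma simplex_facet_inj:
  fixes C :: "'a::euclidean_space set"
  assumes "barycentric C g b" "c \<in> C" "c' \<in> C" "convex hull (C - {c}) = convex hull (C - {c'})"
  shows "c = c'"
proof (rule ccontr)
  assume "c \<noteq> c'"
  then have "c \<in> convex hull (C - {c'})" using assms(2) by (simp add: hull_inc)
  then have "g c \<bullet> c + b c = 0" using convex_hull_bary_facet[OF assms(1,2)] assms(4) by auto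
  then show False using bary_vertex[OF assms(1,2,2)] by simp
qed

section \<open>Lebesgue measure on hyperplanes\<close>

lemma nn_integral_lborel_translate:
  fixes f :: "'a::euclidean_space \<Rightarrow> ennreal"
  assumes [measurable]: "f \<in> borel_measurable borel"
  shows "(\<integral>\<^sup>+x. f (x - t) \<partial>lborel) = (\<integral>\<^sup>+x. f x \<partial>lborel)"
proof -
  have "(\<integral>\<^sup>+x. f x \<partial>lborel) = (\<integral>\<^sup>+x. f x \<partial>distr lborel borel ((+) (- t)))"
    by (simp add: lborel_distr_plus)
  also have "\<dots> = (\<integral>\<^sup>+x. f (- t + x) \<partial>lborel)" by (rule nn_integral_distr) auto
  finally show ?thesis by simp
qed

lemma nn_integral_lborel_reflect:
  fixes f :: "'a::euclidean_space \<Rightarrow> ennreal"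
  assumes [measurable]: "f \<in> borel_measurable borel"
  shows "(\<integral>\<^sup>+x. f (t - x) \<partial>lborel) = (\<integral>\<^sup>+x. f x \<partial>lborel)"
proof -
  have "(\<integral>\<^sup>+x. f x \<partial>lborel) = (\<integral>\<^sup>+x. f x \<partial>distr lborel borel (\<lambda>x::'a. t + (-1) *\<^sub>R x))"
    using lborel_affine[of "-1" t] by (simp add: density_1)
  also have "\<dots> = (\<integral>\<^sup>+x. f (t + (-1) *\<^sub>R x) \<partial>lborel)" by (rule nn_integral_distr) auto
  finally show ?thesis by simp
qed

text \<open>
  Both \<open>lborel\<close> and its image are translation invariant. Integrating the indicator of
  \<open>x \<in> A \<and> U y - x \<in> D\<close> over \<open>x\<close> and \<open>y\<close> in either order, for the unit ball \<open>D\<close>, compares the two.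
\<close>

lemma lborel_isometry:
  fixes U :: "'a::euclidean_space \<Rightarrow> 'a"
  assumes U: "linear U" "\<And>x. norm (U x) = norm x"
  shows "distr lborel borel U = lborel"
proof -
  have "inj U" using U by (metis linear_injective_0 norm_eq_zero)
  then have "surj U" using linear_injective_imp_surjective U(1) by blast
  then obtain V where V: "\<And>y. U (V y) = y" by (metis surjD)
  have [measurable]: "U \<in> borel_measurable borel"
    using U(1) linear_continuous_on linear_conv_bounded_linear borel_measurable_continuous_onI by blast
  define D where "D = ball (0::'a) 1"
  have [measurable]: "D \<in> sets borel" by (simp add: D_def)
  define \<beta> where "\<beta> = emeasure lborel D"
  have "\<beta> \<noteq> \<infinity>" unfolding \<beta>_def D_def using emeasure_lborel_ball_finite[of "0::'a" 1] by simp
  have "\<beta> \<noteq> 0"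
  proof
    assume "\<beta> = 0"
    then have "negligible D" unfolding \<beta>_def
      by (simp add: negligible_iff_null_sets null_sets_completionI null_setsI)
    then show False using open_not_negligible[of D] by (simp add: D_def)
  qed
  have "emeasure lborel A = emeasure (distr lborel borel U) A" if [measurable]: "A \<in> sets borel" for A
  proof -
    have meas: "(\<lambda>p. indicator A (snd p) * indicator D (U (fst p) - snd p) :: ennreal) \<in> borel_measurable (lborel \<Otimes>\<^sub>M lborel)"
      by measurable
    have meas2: "(\<lambda>p. indicator A (U (fst p) - snd p) * indicator D (snd p) :: ennreal) \<in> borel_measurable (lborel \<Otimes>\<^sub>M lborel)"
      by measurable
    \<comment> \<open>Surjectivity writes \<open>U y - x\<close> as \<open>U (y - V x)\<close>, so
      the shift drops out; the remaining \<open>U\<close> drops out because \<open>U y\<close> and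
      \<open>y\<close> have the same norm and \<open>D\<close> is a ball about 0.\<close>
    have 1: "(\<integral>\<^sup>+y. indicator D (U y - x) \<partial>lborel) = \<beta>" for x
    proof -
      have "(\<integral>\<^sup>+y. indicator D (U y - x) \<partial>lborel) = (\<integral>\<^sup>+y. indicator D (U (y - V x)) \<partial>lborel)"
        using U(1) V by (simp add: linear_diff)
      also have "\<dots> = (\<integral>\<^sup>+y. indicator D (U y) \<partial>lborel)"
        by (rule nn_integral_lborel_translate) measurable
      also have "\<dots> = (\<integral>\<^sup>+y. indicator D y \<partial>lborel)" using U(2) by (simp add: indicator_def D_def)
      finally show ?thesis by (simp add: \<beta>_def)
    qed
    have 2: "(\<integral>\<^sup>+y. indicator A (U y - x) \<partial>lborel) = emeasure (distr lborel borel U) A" for x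
    proof -
      have "(\<integral>\<^sup>+y. indicator A (U y - x) \<partial>lborel) = (\<integral>\<^sup>+y. indicator A (U (y - V x)) \<partial>lborel)"
        using U(1) V by (simp add: linear_diff)
      also have "\<dots> = (\<integral>\<^sup>+y. indicator A (U y) \<partial>lborel)"
        by (rule nn_integral_lborel_translate) measurable
      also have "\<dots> = (\<integral>\<^sup>+y. indicator A y \<partial>distr lborel borel U)"
        by (rule nn_integral_distr[symmetric]) auto
      finally show ?thesis by simp
    qed
    have "emeasure lborel A * \<beta> = (\<integral>\<^sup>+x. indicator A x * \<beta> \<partial>lborel)"
      by (simp add: nn_integral_multc)
    also have "\<dots> = (\<integral>\<^sup>+x. \<integral>\<^sup>+y. indicator A x * indicator D (U y - x) \<partial>lborel \<partial>lborel)"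
      by (subst nn_integral_cmult) (auto simp: 1)
    also have "\<dots> = (\<integral>\<^sup>+y. \<integral>\<^sup>+x. indicator A x * indicator D (U y - x) \<partial>lborel \<partial>lborel)"
      by (rule lborel_pair.Fubini'[symmetric]) (use meas in \<open>simp add: split_beta'\<close>)
    \<comment> \<open>Reflecting \<open>x\<close> to \<open>U y - x\<close> exchanges the arguments
      of \<open>A\<close> and \<open>D\<close>, so that the inner integral over \<open>y\<close> now
      measures \<open>A\<close> under the image measure.\<close>
    also have "\<dots> = (\<integral>\<^sup>+y. \<integral>\<^sup>+x. indicator A (U y - x) * indicator D x \<partial>lborel \<partial>lborel)"
    proof (rule nn_integral_cong)
      fix y show "(\<integral>\<^sup>+x. indicator A x * indicator D (U y - x) \<partial>lborel) = (\<integral>\<^sup>+x. indicator A (U y - x) * indicator D x \<partial>lborel)"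
        using nn_integral_lborel_reflect[of "\<lambda>x. indicator A x * indicator D (U y - x)" "U y"] by simp
    qed
    also have "\<dots> = (\<integral>\<^sup>+x. \<integral>\<^sup>+y. indicator A (U y - x) * indicator D x \<partial>lborel \<partial>lborel)"
      by (rule lborel_pair.Fubini') (use meas2 in \<open>simp add: split_beta'\<close>)
    also have "\<dots> = (\<integral>\<^sup>+x. emeasure (distr lborel borel U) A * indicator D x \<partial>lborel)"
      by (subst nn_integral_multc) (auto simp: 2)
    also have "\<dots> = emeasure (distr lborel borel U) A * \<beta>"
      by (subst nn_integral_cmult) (auto simp: \<beta>_def)
    finally show ?thesis using \<open>\<beta> \<noteq> 0\<close> \<open>\<beta> \<noteq> \<infinity>\<close>
      by (metis ennreal_mult_divide_eq infinity_ennreal_def)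
  qed
  then show ?thesis by (intro measure_eqI) auto
qed

text \<open>Product measures are determined on boxes, where renaming the index set only permutes the
  factors. It serves to trade \<open>Basis\<close> for another orthonormal basis.\<close>

lemma (in product_sigma_finite) distr_PiM_reindex_bij:
  assumes "bij_betw \<pi> I J" "finite I" "\<And>i. i \<in> I \<Longrightarrow> M i = M (\<pi> i)"
  shows "distr (Pi\<^sub>M J M) (Pi\<^sub>M I M) (\<lambda>\<omega>. \<lambda>i\<in>I. \<omega> (\<pi> i)) = Pi\<^sub>M I M"
proof (rule PiM_eqI)
  have fJ: "finite J" using assms bij_betw_finite by blast
  have m: "(\<lambda>\<omega>. \<lambda>i\<in>I. \<omega> (\<pi> i)) \<in> measurable (Pi\<^sub>M J M) (Pi\<^sub>M I M)"
    using assms(1) by (auto intro!: measurable_restrict simp: assms(3) bij_betwE)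
  fix A assume A: "\<And>i. i \<in> I \<Longrightarrow> A i \<in> sets (M i)"
  define A' where "A' j = A (inv_into I \<pi> j)" for j
  have A': "A' (\<pi> i) = A i" if "i \<in> I" for i
    using that assms(1) by (simp add: A'_def bij_betw_inv_into_left)
  have J: "\<And>j. j \<in> J \<longleftrightarrow> (\<exists>i\<in>I. j = \<pi> i)" using assms(1) by (auto simp: bij_betw_def)
  have sA': "A' j \<in> sets (M j)" if "j \<in> J" for j
    using that J A' A assms(3) by auto
  interpret J: finite_product_sigma_finite M J by standard fact
  have "(\<lambda>\<omega>. \<lambda>i\<in>I. \<omega> (\<pi> i)) -` Pi\<^sub>E I A \<inter> space (Pi\<^sub>M J M) = Pi\<^sub>E J A'"
  proof (intro equalityI subsetI)
    fix \<omega> assume "\<omega> \<in> (\<lambda>\<omega>. \<lambda>i\<in>I. \<omega> (\<pi> i)) -` Pi\<^sub>E I A \<inter> space (Pi\<^sub>M J M)"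
    then show "\<omega> \<in> Pi\<^sub>E J A'" using J A' by (auto simp: space_PiM PiE_iff)
  next
    fix \<omega> assume *: "\<omega> \<in> Pi\<^sub>E J A'"
    then have "\<omega> \<in> space (Pi\<^sub>M J M)" using sA' sets.sets_into_space by (fastforce simp: space_PiM PiE_iff)
    moreover have "\<omega> (\<pi> i) \<in> A i" if "i \<in> I" for i using * J A' that by (auto simp: PiE_iff)
    ultimately show "\<omega> \<in> (\<lambda>\<omega>. \<lambda>i\<in>I. \<omega> (\<pi> i)) -` Pi\<^sub>E I A \<inter> space (Pi\<^sub>M J M)" by auto
  qed
  then have "emeasure (distr (Pi\<^sub>M J M) (Pi\<^sub>M I M) (\<lambda>\<omega>. \<lambda>i\<in>I. \<omega> (\<pi> i))) (Pi\<^sub>E I A) = emeasure (Pi\<^sub>M J M) (Pi\<^sub>E J A')"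
    using m A assms(2) by (subst emeasure_distr) (auto intro!: sets_PiM_I_finite)
  also have "\<dots> = (\<Prod>j\<in>J. emeasure (M j) (A' j))" using sA' by (simp add: J.measure_times)
  also have "\<dots> = (\<Prod>i\<in>I. emeasure (M (\<pi> i)) (A' (\<pi> i)))"
    by (rule prod.reindex_bij_betw[OF assms(1), symmetric])
  also have "\<dots> = (\<Prod>i\<in>I. emeasure (M i) (A i))" using A' assms(3) by (intro prod.cong) auto
  finally show "emeasure (distr (Pi\<^sub>M J M) (Pi\<^sub>M I M) (\<lambda>\<omega>. \<lambda>i\<in>I. \<omega> (\<pi> i))) (Pi\<^sub>E I A) = (\<Prod>i\<in>I. emeasure (M i) (A i))" .
qed (use assms in auto)

definition orthonormal :: "'a::euclidean_space set \<Rightarrow> bool" where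
  "orthonormal B \<longleftrightarrow> pairwise orthogonal B \<and> (\<forall>b\<in>B. norm b = 1)"

lemma orthonormal_inner: "orthonormal B \<Longrightarrow> b \<in> B \<Longrightarrow> c \<in> B \<Longrightarrow> b \<bullet> c = (if b = c then 1 else 0)"
  by (auto simp: orthonormal_def pairwise_def orthogonal_def dot_square_norm)

lemma orthonormal_independent: "orthonormal B \<Longrightarrow> independent B"
  by (rule pairwise_orthogonal_independent) (auto simp: orthonormal_def)

lemma borel_measurable_lincomb:
  "finite B \<Longrightarrow> (\<lambda>c. a + (\<Sum>b\<in>B. c b *\<^sub>R b)) \<in> borel_measurable (Pi\<^sub>M B (\<lambda>_. lborel :: real measure))"
  for B :: "'a::euclidean_space set"
  by (intro borel_measurable_add borel_measurable_const borel_measurable_sum borel_measurable_scaleR)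
    (auto simp: measurable_lborel1 cong: measurable_cong_sets intro: measurable_component_singleton[THEN measurable_compose])

text \<open>The linear map taking \<open>Basis\<close> to \<open>B\<close> is an isometry, and
  composing it with the standard coordinates gives the coordinates with respect to
  \<open>B\<close>.\<close>

lemma lborel_orthonormal_basis:
  fixes B :: "'a::euclidean_space set"
  assumes B: "orthonormal B" "span B = UNIV"
  shows "lborel = distr (Pi\<^sub>M B (\<lambda>_. lborel)) borel (\<lambda>c. \<Sum>b\<in>B. c b *\<^sub>R b)"
proof -
  interpret product_sigma_finite "\<lambda>_::'a. lborel :: real measure" by standard
  have fin: "finite B" using orthonormal_independent[OF B(1)] independent_imp_finite by blast
  have "card B = DIM('a)" using orthonormal_independent[OF B(1)] B(2)
    by (metis dim_UNIV dim_eq_card_independent dim_span)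
  then obtain \<pi> where \<pi>: "bij_betw \<pi> (Basis :: 'a set) B"
    using finite_same_card_bij[of "Basis :: 'a set" B] fin by auto
  define U where "U x = (\<Sum>i\<in>Basis. (x \<bullet> i) *\<^sub>R \<pi> i)" for x
  have \<pi>B: "i \<in> Basis \<Longrightarrow> \<pi> i \<in> B" for i using \<pi> bij_betwE by blast
  have \<pi>i: "\<pi> i \<bullet> \<pi> j = (if i = j then 1 else 0)" if "i \<in> Basis" "j \<in> Basis" for i j
    using orthonormal_inner[OF B(1) \<pi>B \<pi>B] that \<pi> by (auto simp: bij_betw_def inj_on_def)
  have lin: "linear U" unfolding U_def
    by (rule linearI) (simp_all add: inner_add_left scaleR_add_left sum.distrib scaleR_sum_right)
  have "U x \<bullet> U x = x \<bullet> x" for x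
  proof -
    have *: "U x \<bullet> \<pi> i = x \<bullet> i" if "i \<in> Basis" for i
    proof -
      have "U x \<bullet> \<pi> i = (\<Sum>j\<in>Basis. if j = i then x \<bullet> j else 0)"
        unfolding U_def inner_sum_left by (rule sum.cong) (use \<pi>i that in auto)
      then show ?thesis using that by simp
    qed
    have "U x \<bullet> U x = (\<Sum>i\<in>Basis. (x \<bullet> i) * (U x \<bullet> \<pi> i))"
      by (subst (2) U_def) (simp add: inner_sum_right)
    also have "\<dots> = (\<Sum>i\<in>Basis. (x \<bullet> i) * (x \<bullet> i))" using * by simp
    also have "\<dots> = x \<bullet> x" by (simp add: euclidean_inner[of x x])
    finally show ?thesis .
  qed
  then have norm: "norm (U x) = norm x" for x by (simp add: norm_eq)
  have [measurable]: "U \<in> borel_measurable borel"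
    using lin linear_continuous_on linear_conv_bounded_linear borel_measurable_continuous_onI by blast
  let ?h = "\<lambda>c. \<Sum>b\<in>Basis. c b *\<^sub>R b :: 'a"
  have hm: "?h \<in> borel_measurable (Pi\<^sub>M Basis (\<lambda>_. lborel))"
    using borel_measurable_lincomb[OF finite_Basis, of 0] by simp
  have lb: "lborel = distr (Pi\<^sub>M Basis (\<lambda>_. lborel)) borel ?h"
    by (subst lborel_def) (simp add: lborel_eq_real)
  have rm: "(\<lambda>\<omega>. \<lambda>i\<in>Basis. \<omega> (\<pi> i)) \<in> measurable (Pi\<^sub>M B (\<lambda>_. lborel)) (Pi\<^sub>M Basis (\<lambda>_. lborel :: real measure))"
    using \<pi>B by (auto intro!: measurable_restrict)
  have "lborel = distr (distr (Pi\<^sub>M Basis (\<lambda>_. lborel)) borel ?h) borel U"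
    using lborel_isometry[OF lin norm] lb by simp
  also have "\<dots> = distr (Pi\<^sub>M Basis (\<lambda>_. lborel)) borel (U \<circ> ?h)"
    by (rule distr_distr) (use hm in auto)
  also have "\<dots> = distr (distr (Pi\<^sub>M B (\<lambda>_. lborel)) (Pi\<^sub>M Basis (\<lambda>_. lborel)) (\<lambda>\<omega>. \<lambda>i\<in>Basis. \<omega> (\<pi> i))) borel (U \<circ> ?h)"
    by (subst distr_PiM_reindex_bij[OF \<pi>]) auto
  also have "\<dots> = distr (Pi\<^sub>M B (\<lambda>_. lborel)) borel ((U \<circ> ?h) \<circ> (\<lambda>\<omega>. \<lambda>i\<in>Basis. \<omega> (\<pi> i)))"
    by (rule distr_distr) (use hm rm in \<open>auto intro: measurable_comp\<close>)
  also have "(U \<circ> ?h) \<circ> (\<lambda>\<omega>. \<lambda>i\<in>Basis. \<omega> (\<pi> i)) = (\<lambda>c. \<Sum>b\<in>B. c b *\<^sub>R b)"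
  proof
    fix c
    have "U (\<Sum>i\<in>Basis. c (\<pi> i) *\<^sub>R i) = (\<Sum>i\<in>Basis. c (\<pi> i) *\<^sub>R \<pi> i)"
      unfolding U_def by (rule sum.cong) (auto simp: inner_sum_left_Basis)
    then show "((U \<circ> ?h) \<circ> (\<lambda>\<omega>. \<lambda>i\<in>Basis. \<omega> (\<pi> i))) c = (\<Sum>b\<in>B. c b *\<^sub>R b)"
      using sum.reindex_bij_betw[OF \<pi>, of "\<lambda>b. c b *\<^sub>R b"] by (simp cong: sum.cong)
  qed
  finally show ?thesis .
qed

section \<open>Hyperplane measure and Fubini in the normal direction\<close>

lemma orthonormal_basis_span:
  fixes S :: "'a::euclidean_space set"
  shows "\<exists>B. pairwise orthogonal B \<and> (\<forall>b\<in>B. norm b = 1) \<and> span B = span S"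
  using orthonormal_basis_subspace[OF subspace_span, of S] by metis

lemma hull_basis:
  fixes F :: "'a::euclidean_space set"
  shows "orthonormal (hull_basis F)" "span (hull_basis F) = span {y - x | x y. x \<in> F \<and> y \<in> F}"
proof -
  note H = someI_ex[OF orthonormal_basis_span[of "{y - x | x y. x \<in> F \<and> y \<in> F}"],
      folded hull_basis_def]
  show "orthonormal (hull_basis F)"
    unfolding orthonormal_def using H[THEN conjunct1] H[THEN conjunct2, THEN conjunct1] by (rule conjI)
  show "span (hull_basis F) = span {y - x | x y. x \<in> F \<and> y \<in> F}"
    by (rule H[THEN conjunct2, THEN conjunct2])
qed

lemma sets_hull_lebesgue [simp, measurable_cong]: "sets (hull_lebesgue F) = sets borel"
  by (simp add: hull_lebesgue_def)

lemma space_hull_lebesgue [simp]: "space (hull_lebesgue F) = UNIV"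
  by (simp add: hull_lebesgue_def)

text \<open>\<open>normal_unique\<close> expresses that the directions of \<open>F\<close> have
  codimension one. This form is chosen because \<open>facet_normal\<close> delivers it directly for
  facets of a simplex.\<close>

locale hyperplane_set =
  fixes F :: "'a::euclidean_space set" and m :: 'a
  assumes nonempty: "F \<noteq> {}" and unit: "norm m = 1"
    and normal: "\<And>x y. x \<in> F \<Longrightarrow> y \<in> F \<Longrightarrow> m \<bullet> (y - x) = 0"
    and normal_unique: "\<And>u. (\<And>x y. x \<in> F \<Longrightarrow> y \<in> F \<Longrightarrow> u \<bullet> (y - x) = 0) \<Longrightarrow> \<exists>\<kappa>. u = \<kappa> *\<^sub>R m"
begin

abbreviation "B \<equiv> hull_basis F"
definition "base = (SOME a. a \<in> F)"

lemma base: "base \<in> F"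
  unfolding base_def using nonempty some_in_eq by blast

lemma orth_B: "b \<in> B \<Longrightarrow> m \<bullet> b = 0"
proof -
  assume "b \<in> B"
  then have "b \<in> span {y - x | x y. x \<in> F \<and> y \<in> F}" using hull_basis(2) span_base by blast
  moreover have "orthogonal m z" if "z \<in> {y - x | x y. x \<in> F \<and> y \<in> F}" for z
    unfolding orthogonal_def using that normal by blast
  ultimately have "orthogonal m b" by (rule orthogonal_to_span)
  then show ?thesis by (simp add: orthogonal_def)
qed

lemma m_notin: "m \<notin> B"
  using orth_B[of m] unit by (auto simp: dot_square_norm)

lemma finite_B: "finite B"
  using hull_basis(1) orthonormal_independent independent_imp_finite by blast

lemma orthonormal_insert: "orthonormal (insert m B)"
  using hull_basis(1)[of F] orth_B unit
  by (auto simp: orthonormal_def pairwise_insert orthogonal_def inner_commute)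

text \<open>A vector orthogonal to \<open>m\<close> and to \<open>B\<close> is normal to
  \<open>F\<close>, hence a multiple of \<open>m\<close>, hence zero.\<close>

lemma span_insert: "span (insert m B) = UNIV"
proof (rule ccontr)
  assume "span (insert m B) \<noteq> UNIV"
  then have "dim (insert m B) < DIM('a)"
    using dim_eq_full[of "insert m B"] dim_subset_UNIV[of "insert m B"] by linarith
  then obtain x where x: "x \<noteq> 0" "\<And>y. y \<in> span (insert m B) \<Longrightarrow> orthogonal x y"
    by (rule orthogonal_to_subspace_exists) metis
  have "span B \<subseteq> span (insert m B)" by (rule span_mono) auto
  then have sub: "span {y - x |x y. x \<in> F \<and> y \<in> F} \<subseteq> span (insert m B)"
    by (simp only: hull_basis(2))
  have "x \<bullet> (z - y) = 0" if "y \<in> F" "z \<in> F" for y z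
  proof -
    have "z - y \<in> {y - x |x y. x \<in> F \<and> y \<in> F}" using that by blast
    from x(2)[OF subsetD[OF sub span_base[OF this]]] show ?thesis by (simp only: orthogonal_def)
  qed
  from normal_unique[OF this] obtain \<kappa> where \<kappa>: "x = \<kappa> *\<^sub>R m" ..
  have "x \<bullet> m = 0" using x(2)[of m] by (simp add: orthogonal_def span_base)
  then have "\<kappa> = 0" using \<kappa> unit by (simp add: dot_square_norm)
  then show False using x(1) \<kappa> by simp
qed

lemma measurable_param: "(\<lambda>c. base + (\<Sum>b\<in>B. c b *\<^sub>R b)) \<in> borel_measurable (Pi\<^sub>M B (\<lambda>_. lborel))"
  by (rule borel_measurable_lincomb[OF finite_B])

lemma hull_lebesgue_eq: "hull_lebesgue F = distr (Pi\<^sub>M B (\<lambda>_. lborel)) borel (\<lambda>c. base + (\<Sum>b\<in>B. c b *\<^sub>R b))"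
  by (simp add: hull_lebesgue_def base_def)

lemma lborel_eq: "lborel = distr (Pi\<^sub>M (insert m B) (\<lambda>_. lborel)) borel (\<lambda>c. base + (\<Sum>b\<in>insert m B. c b *\<^sub>R b))"
proof -
  let ?h = "\<lambda>c. \<Sum>b\<in>insert m B. c b *\<^sub>R b"
  have h: "?h \<in> borel_measurable (Pi\<^sub>M (insert m B) (\<lambda>_. lborel))"
    using borel_measurable_lincomb[of "insert m B" 0] finite_B by simp
  have "lborel = distr lborel borel ((+) base)" by (simp add: lborel_distr_plus)
  also have "\<dots> = distr (distr (Pi\<^sub>M (insert m B) (\<lambda>_. lborel)) borel ?h) borel ((+) base)"
    using lborel_orthonormal_basis[OF orthonormal_insert span_insert] by simp
  also have "\<dots> = distr (Pi\<^sub>M (insert m B) (\<lambda>_. lborel)) borel ((+) base \<circ> ?h)"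
    by (rule distr_distr) (use h in auto)
  finally show ?thesis by (simp add: comp_def)
qed

lemma measurable_param_insert:
  "(\<lambda>c. base + (\<Sum>b\<in>insert m B. c b *\<^sub>R b)) \<in> borel_measurable (Pi\<^sub>M (insert m B) (\<lambda>_. lborel))"
  using borel_measurable_lincomb[of "insert m B" base] finite_B by simp

lemma param_update:
  "base + (\<Sum>b\<in>insert m B. (c(m := r)) b *\<^sub>R b) = (base + (\<Sum>b\<in>B. c b *\<^sub>R b)) + r *\<^sub>R m"
proof -
  have "(\<Sum>b\<in>B. (c(m := r)) b *\<^sub>R b) = (\<Sum>b\<in>B. c b *\<^sub>R b)"
    using m_notin by (intro sum.cong) auto
  then show ?thesis using m_notin finite_B by (simp add: algebra_simps)
qed

text \<open>Fubini in the orthonormal coordinates \<open>insert m B\<close>: the coordinate of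
  \<open>m\<close> is the signed distance to the hyperplane, and the others are those in which
  \<open>hull_lebesgue\<close> is defined.\<close>

lemma nn_integral_slices:
  assumes [measurable]: "f \<in> borel_measurable borel"
  shows "(\<integral>\<^sup>+x. f x \<partial>lborel) = (\<integral>\<^sup>+y. (\<integral>\<^sup>+r. f (y + r *\<^sub>R m) \<partial>lborel) \<partial>hull_lebesgue F)"
proof -
  interpret product_sigma_finite "\<lambda>_::'a. lborel :: real measure" by standard
  let ?h = "\<lambda>c. base + (\<Sum>b\<in>insert m B. c b *\<^sub>R b)"
  have "(\<integral>\<^sup>+x. f x \<partial>lborel) = (\<integral>\<^sup>+c. f (?h c) \<partial>Pi\<^sub>M (insert m B) (\<lambda>_. lborel))"
    by (subst lborel_eq, rule nn_integral_distr[OF measurable_param_insert]) simp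
  also have "\<dots> = (\<integral>\<^sup>+c. (\<integral>\<^sup>+r. f (?h (c(m := r))) \<partial>lborel) \<partial>Pi\<^sub>M B (\<lambda>_. lborel))"
    by (rule product_nn_integral_insert[OF finite_B m_notin])
      (rule measurable_compose[OF measurable_param_insert], simp)
  also have "\<dots> = (\<integral>\<^sup>+c. (\<integral>\<^sup>+r. f ((base + (\<Sum>b\<in>B. c b *\<^sub>R b)) + r *\<^sub>R m) \<partial>lborel) \<partial>Pi\<^sub>M B (\<lambda>_. lborel))"
    unfolding param_update ..
  also have "\<dots> = (\<integral>\<^sup>+y. (\<integral>\<^sup>+r. f (y + r *\<^sub>R m) \<partial>lborel) \<partial>hull_lebesgue F)"
    unfolding hull_lebesgue_eq
    by (subst nn_integral_distr[OF measurable_param]) auto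
  finally show ?thesis .
qed

lemma integral_slices:
  fixes f :: "'a \<Rightarrow> real"
  assumes f: "integrable lborel f"
  shows "(LINT x|lborel. f x) = (LINT y|hull_lebesgue F. LINT r|lborel. f (y + r *\<^sub>R m))"
proof -
  interpret product_sigma_finite "\<lambda>_::'a. lborel :: real measure" by standard
  have [measurable]: "f \<in> borel_measurable borel" using f by auto
  let ?h = "\<lambda>c. base + (\<Sum>b\<in>insert m B. c b *\<^sub>R b)"
  have "integrable (distr (Pi\<^sub>M (insert m B) (\<lambda>_. lborel)) borel ?h) f" using f lborel_eq by simp
  then have i: "integrable (Pi\<^sub>M (insert m B) (\<lambda>_. lborel)) (\<lambda>c. f (?h c))"
    by (subst (asm) integrable_distr_eq[OF measurable_param_insert]) auto
  have "(LINT x|lborel. f x) = (LINT c|Pi\<^sub>M (insert m B) (\<lambda>_. lborel). f (?h c))"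
    by (subst lborel_eq, rule integral_distr[OF measurable_param_insert]) simp
  also have "\<dots> = (LINT c|Pi\<^sub>M B (\<lambda>_. lborel). LINT r|lborel. f (?h (c(m := r))))"
    by (rule product_integral_insert[OF finite_B m_notin i])
  also have "\<dots> = (LINT c|Pi\<^sub>M B (\<lambda>_. lborel). LINT r|lborel. f ((base + (\<Sum>b\<in>B. c b *\<^sub>R b)) + r *\<^sub>R m))"
    unfolding param_update ..
  also have "\<dots> = (LINT y|hull_lebesgue F. LINT r|lborel. f (y + r *\<^sub>R m))"
    unfolding hull_lebesgue_eq
    by (subst integral_distr[OF measurable_param]) auto
  finally show ?thesis .
qed

lemma AE_hyperplane: "AE y in hull_lebesgue F. m \<bullet> y = m \<bullet> base"
  unfolding hull_lebesgue_eq
proof (subst AE_distr_iff[OF measurable_param])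
  show "{x \<in> space borel. m \<bullet> x = m \<bullet> base} \<in> sets borel" by measurable
  have "m \<bullet> (base + (\<Sum>b\<in>B. c b *\<^sub>R b)) = m \<bullet> base" for c
    using orth_B by (simp add: inner_add_right inner_sum_right)
  then show "AE c in Pi\<^sub>M B (\<lambda>_. lborel). m \<bullet> (base + (\<Sum>b\<in>B. c b *\<^sub>R b)) = m \<bullet> base" by simp
qed

text \<open>The ball within the hyperplane, thickened by a segment of length one along
  \<open>m\<close>, fits into a ball of radius \<open>R + 1\<close>, whose full Lebesgue measure is
  finite.\<close>

lemma emeasure_bounded: "emeasure (hull_lebesgue F) (cball 0 R) < \<infinity>"
proof -
  have "emeasure (hull_lebesgue F) (cball 0 R) = (\<integral>\<^sup>+y. indicator (cball 0 R) y \<partial>hull_lebesgue F)"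
    by simp
  also have "\<dots> \<le> (\<integral>\<^sup>+y. (\<integral>\<^sup>+r. indicator (cball 0 (R + 1)) (y + r *\<^sub>R m) \<partial>lborel) \<partial>hull_lebesgue F)"
  proof (rule nn_integral_mono)
    fix y
    have "norm (y + r *\<^sub>R m) \<le> R + 1" if "norm y \<le> R" "0 \<le> r" "r \<le> 1" for r
      using norm_triangle_ineq[of y "r *\<^sub>R m"] that unit by simp
    then have "(\<integral>\<^sup>+r. indicator (cball 0 R) y * indicator {0..1::real} r \<partial>lborel) \<le>
        (\<integral>\<^sup>+r. indicator (cball 0 (R + 1)) (y + r *\<^sub>R m) \<partial>lborel)"
      by (intro nn_integral_mono) (auto simp: indicator_def)
    then show "indicator (cball 0 R) y \<le> (\<integral>\<^sup>+r. indicator (cball 0 (R + 1)) (y + r *\<^sub>R m) \<partial>lborel)"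
      by (subst (asm) nn_integral_cmult) auto
  qed
  also have "\<dots> = (\<integral>\<^sup>+x. indicator (cball (0::'a) (R + 1)) x \<partial>lborel)"
    by (rule nn_integral_slices[OF borel_measurable_indicator[OF borel_closed[OF closed_cball]], symmetric])
  also have "\<dots> < \<infinity>" using emeasure_lborel_cball_finite[of "0::'a" "R + 1"] by (simp add: top.not_eq_extremum)
  finally show ?thesis .
qed

text \<open>Made constant along \<open>m\<close>, the affine function has a hyperplane of Lebesgue
  measure zero as its zero set. Each normal line lies wholly inside that set or misses it, so its
  trace on the hyperplane of \<open>F\<close> must be null as well.\<close>

lemma AE_affine_nonzero:
  assumes y0: "y0 \<in> F" "w \<bullet> y0 + \<beta> \<noteq> 0"
  shows "AE y in hull_lebesgue F. w \<bullet> y + \<beta> \<noteq> 0"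
proof -
  define w' where "w' = w - (w \<bullet> m) *\<^sub>R m"
  define \<gamma> where "\<gamma> = (w \<bullet> m) * (m \<bullet> base) + \<beta>"
  have w: "w \<bullet> y + \<beta> = w' \<bullet> y + \<gamma>" if "m \<bullet> y = m \<bullet> base" for y
    using that by (simp add: w'_def \<gamma>_def inner_diff_left)
  have w'm: "w' \<bullet> m = 0" using unit by (simp add: w'_def inner_diff_left dot_square_norm)
  have y0m: "m \<bullet> y0 = m \<bullet> base" using normal[OF base y0(1)] by (simp add: inner_diff_right)
  have "AE y in hull_lebesgue F. w' \<bullet> y + \<gamma> \<noteq> 0"
  proof (cases "w' = 0")
    \<comment> \<open>Here the function is constant on the hyperplane, and \<open>y0\<close> shows
      that the constant is not zero.\<close>
    case True then show ?thesis using w[OF y0m] y0(2) by simp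
  next
    case False
    let ?N = "{x. w' \<bullet> x = - \<gamma>}"
    have [measurable]: "?N \<in> sets borel" by measurable
    have "negligible ?N" using False by (intro negligible_hyperplane) simp
    then have "emeasure lborel ?N = 0"
      by (simp add: negligible_iff_emeasure0 emeasure_completion)
    then have "(\<integral>\<^sup>+x. indicator ?N x \<partial>lborel) = 0" by simp
    then have "0 = (\<integral>\<^sup>+y. (\<integral>\<^sup>+r. indicator ?N (y + r *\<^sub>R m) \<partial>lborel) \<partial>hull_lebesgue F)"
      by (subst (asm) nn_integral_slices) auto
    also have "\<dots> = (\<integral>\<^sup>+y. indicator ?N y * \<infinity> \<partial>hull_lebesgue F)"
    proof (rule nn_integral_cong)
      fix y
      have "indicator ?N (y + r *\<^sub>R m) = (indicator ?N y :: ennreal)" for r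
        using w'm by (simp add: indicator_def inner_add_right)
      then show "(\<integral>\<^sup>+r. indicator ?N (y + r *\<^sub>R m) \<partial>lborel) = (indicator ?N y * \<infinity> :: ennreal)" by simp
    qed
    finally have "(\<integral>\<^sup>+y. indicator ?N y * \<infinity> \<partial>hull_lebesgue F) = 0" by simp
    then have "AE y in hull_lebesgue F. indicator ?N y * \<infinity> = (0::ennreal)"
      by (subst (asm) nn_integral_0_iff_AE) auto
    then show ?thesis by eventually_elim (auto simp: indicator_def split: if_splits)
  qed
  with AE_hyperplane show ?thesis by eventually_elim (use w in auto)
qed

end

section \<open>The divergence theorem on a simplex\<close>

text \<open>A continuously differentiable, bounded substitute for the Heaviside function: the square
  smooths the kink at 0 and the denominator makes the limit at infinity 1. Scaling the argument
  turns it into the indicator of the positive half-line.\<close>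

definition ramp :: "real \<Rightarrow> real" where "ramp t = (max 0 t)\<^sup>2 / (1 + t\<^sup>2)"
definition ramp' :: "real \<Rightarrow> real" where "ramp' t = 2 * max 0 t / (1 + t\<^sup>2)\<^sup>2"

lemma one_plus_sq_pos: "1 + (t::real)\<^sup>2 > 0" "1 + (t::real)\<^sup>2 \<noteq> 0"
  by (simp_all add: add_pos_nonneg add_nonneg_eq_0_iff)

lemma ramp_nonpos [simp]: "t \<le> 0 \<Longrightarrow> ramp t = 0" "t \<le> 0 \<Longrightarrow> ramp' t = 0"
  by (simp_all add: ramp_def ramp'_def)

lemma ramp_bounds: "0 \<le> ramp t" "ramp t \<le> 1" "\<bar>ramp t\<bar> \<le> 1"
proof -
  show "0 \<le> ramp t" by (simp add: ramp_def)
  have "(max 0 t)\<^sup>2 \<le> 1 + t\<^sup>2" by (auto simp: max_def)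
  then show "ramp t \<le> 1" using one_plus_sq_pos[of t] by (simp add: ramp_def)
  with \<open>0 \<le> ramp t\<close> show "\<bar>ramp t\<bar> \<le> 1" by simp
qed

lemma ramp'_nonneg: "0 \<le> ramp' t" by (simp add: ramp'_def)

lemma continuous_ramp [continuous_intros]:
  "continuous_on S f \<Longrightarrow> continuous_on S (\<lambda>x. ramp (f x))"
  "continuous_on S f \<Longrightarrow> continuous_on S (\<lambda>x. ramp' (f x))"
  unfolding ramp_def ramp'_def using one_plus_sq_pos(2) by (auto intro!: continuous_intros)

lemma DERIV_max_sq: "((\<lambda>t::real. (max 0 t)\<^sup>2) has_real_derivative 2 * max 0 t) (at t)"
proof (cases "t = 0")
  case False
  then consider "t < 0" | "t > 0" by linarith
  then show ?thesis
  proof cases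
    case 1
    have "((\<lambda>t. 0) has_real_derivative 0) (at t)" by simp
    then have "((\<lambda>t::real. (max 0 t)\<^sup>2) has_real_derivative 0) (at t)"
      by (rule has_field_derivative_transform_within_open[of _ _ _ "{..<0}"]) (use 1 in auto)
    then show ?thesis using 1 by simp
  next
    case 2
    have "((\<lambda>t. t\<^sup>2) has_real_derivative 2 * t) (at t)" by (auto intro!: derivative_eq_intros)
    then have "((\<lambda>t::real. (max 0 t)\<^sup>2) has_real_derivative 2 * t) (at t)"
      by (rule has_field_derivative_transform_within_open[of _ _ _ "{0<..}"]) (use 2 in auto)
    then show ?thesis using 2 by simp
  qed
next
  case True
  have "((\<lambda>h::real. (max 0 h)\<^sup>2 / h) \<longlongrightarrow> 0) (at 0)"
  proof (rule Lim_null_comparison)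
    show "\<forall>\<^sub>F h in at 0. norm ((max 0 h)\<^sup>2 / h) \<le> \<bar>h\<bar>"
      by (rule always_eventually) (auto simp: max_def power2_eq_square)
    show "((\<lambda>h::real. \<bar>h\<bar>) \<longlongrightarrow> 0) (at 0)" using tendsto_rabs[OF tendsto_ident_at[of "0::real" UNIV]] by simp
  qed
  then show ?thesis unfolding True by (simp add: DERIV_def)
qed

lemma DERIV_ramp: "(ramp has_real_derivative ramp' t) (at t)"
proof -
  have "((\<lambda>t. (max 0 t)\<^sup>2 / (1 + t\<^sup>2)) has_real_derivative
      (2 * max 0 t * (1 + t\<^sup>2) - (max 0 t)\<^sup>2 * (2 * t)) / ((1 + t\<^sup>2) * (1 + t\<^sup>2))) (at t)"
    using one_plus_sq_pos(2)[of t]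
    by (intro DERIV_divide DERIV_max_sq) (auto intro!: derivative_eq_intros)
  moreover have "2 * max 0 t * (1 + t\<^sup>2) - (max 0 t)\<^sup>2 * (2 * t) = 2 * max 0 t"
    by (auto simp: max_def power2_eq_square algebra_simps)
  ultimately show ?thesis by (simp add: ramp_def[abs_def] ramp'_def power2_eq_square)
qed

lemma ramp_eq: "0 \<le> t \<Longrightarrow> ramp t = 1 - 1 / (1 + t\<^sup>2)"
  using one_plus_sq_pos(2)[of t] by (simp add: ramp_def field_simps)

lemma ramp_at_top: "(ramp \<longlongrightarrow> 1) at_top"
proof -
  have "filterlim (\<lambda>t::real. 1 + t\<^sup>2) at_top at_top"
    by (intro filterlim_tendsto_add_at_top[OF tendsto_const] filterlim_pow_at_top filterlim_ident) simp
  then have "((\<lambda>t::real. 1 / (1 + t\<^sup>2)) \<longlongrightarrow> 0) at_top"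
    by (intro tendsto_divide_0[OF tendsto_const] filterlim_at_top_imp_at_infinity)
  from tendsto_diff[OF tendsto_const this, of 1] have "((\<lambda>t::real. 1 - 1 / (1 + t\<^sup>2)) \<longlongrightarrow> 1) at_top" by simp
  then show ?thesis
    by (rule Lim_transform_eventually) (use eventually_ge_at_top[of 0] in \<open>eventually_elim, simp add: ramp_eq\<close>)
qed

text \<open>The mass of \<open>ramp'\<close> is the total rise of \<open>ramp\<close>. Scaled copies
  of \<open>ramp'\<close> therefore act like unit point masses, and the constant 1 is why no factor
  appears in front of the facet integrals.\<close>

lemma has_bochner_integral_ramp': "has_bochner_integral lborel ramp' 1"
proof (rule has_bochner_integral_nn_integral)
  have [measurable]: "ramp' \<in> borel_measurable borel"
    using continuous_ramp(2)[OF continuous_on_id] by (auto intro: borel_measurable_continuous_onI)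
  then show "ramp' \<in> borel_measurable lborel" by simp
  have "(\<integral>\<^sup>+x. ennreal (ramp' x) \<partial>lborel) = (\<integral>\<^sup>+x. ennreal (ramp' x) * indicator {0..} x \<partial>lborel)"
    by (rule nn_integral_cong) (auto simp: indicator_def)
  also have "\<dots> = ennreal (1 - ramp 0)"
    by (rule nn_integral_FTC_atLeast[OF _ DERIV_ramp ramp'_nonneg ramp_at_top]) simp
  finally show "(\<integral>\<^sup>+x. ennreal (ramp' x) \<partial>lborel) = ennreal 1" by simp
qed (auto simp: ramp'_nonneg)

lemma filterlim_at_top_add_const: "filterlim f at_top F \<Longrightarrow> filterlim (\<lambda>x. f x + c :: real) at_top F"
  using filterlim_tendsto_add_at_top[OF tendsto_const, of f F c] by (simp add: add.commute)

text \<open>The fixed offset \<open>b\<close> is there for \<open>facet_limit\<close>, where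
  rescaling the normal coordinate leaves such a term in the arguments of the remaining
  ramps.\<close>

lemma ramp_scaled_limit:
  assumes "a \<noteq> 0"
  shows "(\<lambda>n. ramp (real (Suc n) * a + b)) \<longlonglongrightarrow> (if a > 0 then 1 else 0)"
proof (cases "a > 0")
  case True
  have "filterlim (\<lambda>n. real (Suc n)) at_top sequentially"
    by (rule filterlim_compose[OF filterlim_real_sequentially filterlim_Suc])
  then have "filterlim (\<lambda>n. a * real (Suc n) + b) at_top sequentially"
    by (intro filterlim_at_top_add_const[OF filterlim_tendsto_pos_mult_at_top[OF tendsto_const True]])
  from filterlim_compose[OF ramp_at_top this] show ?thesis using True by (simp add: mult.commute)
next
  case False
  then have a: "a < 0" using assms by simp
  have "filterlim (\<lambda>n. real (Suc n)) at_top sequentially"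
    by (rule filterlim_compose[OF filterlim_real_sequentially filterlim_Suc])
  then have "filterlim (\<lambda>n. (- a) * real (Suc n) + (- b)) at_top sequentially"
    using a by (intro filterlim_at_top_add_const[OF filterlim_tendsto_pos_mult_at_top[OF tendsto_const]]) auto
  then have "\<forall>\<^sub>F n in sequentially. 0 \<le> (- a) * real (Suc n) + (- b)"
    by (simp only: filterlim_at_top)
  then have "\<forall>\<^sub>F n in sequentially. ramp (real (Suc n) * a + b) = 0"
    by eventually_elim (simp add: algebra_simps)
  then show ?thesis using False by (simp add: tendsto_eventually)
qed

lemma integrable_continuous_compact_support:
  fixes f :: "'a::euclidean_space \<Rightarrow> real"
  assumes "continuous_on UNIV f" "\<And>x. x \<notin> cball 0 R \<Longrightarrow> f x = 0"
  shows "integrable lborel f"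
proof -
  have "integrable lborel (\<lambda>x. indicator (cball 0 R) x *\<^sub>R f x)"
    using assms(1) by (intro borel_integrable_compact) (auto intro: continuous_on_subset)
  moreover have "(\<lambda>x. indicator (cball 0 R) x *\<^sub>R f x) = f"
  proof
    fix x show "indicator (cball 0 R) x *\<^sub>R f x = f x"
      using assms(2)[of x] by (cases "x \<in> cball 0 R") simp_all
  qed
  ultimately show ?thesis by simp
qed

lemma continuous_compact_support_bounded:
  fixes f :: "'a::euclidean_space \<Rightarrow> real"
  assumes "continuous_on UNIV f" "\<And>x. x \<notin> cball 0 R \<Longrightarrow> f x = 0"
  obtains M where "M \<ge> 0" "\<And>x. \<bar>f x\<bar> \<le> M"
proof -
  have "compact (f ` cball 0 R)"
    using assms(1) by (intro compact_continuous_image) (auto intro: continuous_on_subset)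
  then obtain M where M: "\<forall>x\<in>cball 0 R. \<bar>f x\<bar> \<le> M" using compact_imp_bounded bounded_real by (metis imageI)
  have "\<bar>f x\<bar> \<le> max 0 M" for x
    using M assms(2)[of x] by (cases "x \<in> cball 0 R") (auto simp: max.coboundedI2)
  then show ?thesis using that[of "max 0 M"] by simp
qed

lemma lborel_translate:
  fixes f :: "'a::euclidean_space \<Rightarrow> real"
  assumes [measurable]: "f \<in> borel_measurable borel"
  shows "(LINT x|lborel. f (x + t)) = (LINT x|lborel. f x)"
    "integrable lborel f \<Longrightarrow> integrable lborel (\<lambda>x. f (x + t))"
proof -
  have "(LINT x|lborel. f x) = (LINT x|distr lborel borel ((+) t). f x)" by (simp add: lborel_distr_plus)
  also have "\<dots> = (LINT x|lborel. f (t + x))" by (rule integral_distr) auto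
  finally show "(LINT x|lborel. f (x + t)) = (LINT x|lborel. f x)" by (simp add: add.commute)
  assume "integrable lborel f"
  then have "integrable (distr lborel borel ((+) t)) f" by (simp add: lborel_distr_plus)
  then show "integrable lborel (\<lambda>x. f (x + t))"
    by (subst (asm) integrable_distr_eq) (auto simp: add.commute)
qed

text \<open>Difference quotients have integral zero by translation invariance, and they converge
  boundedly to the derivative on a fixed ball.\<close>

lemma integral_derivative_compact_support:
  fixes g D :: "'a::euclidean_space \<Rightarrow> real"
  assumes g: "continuous_on UNIV g" and D: "continuous_on UNIV D"
    and supp: "\<And>x. x \<notin> cball 0 R \<Longrightarrow> g x = 0" "\<And>x. x \<notin> cball 0 R \<Longrightarrow> D x = 0"
    and deriv: "\<And>x. ((\<lambda>t. g (x + t *\<^sub>R e)) has_real_derivative D x) (at 0)"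
  shows "(LINT x|lborel. D x) = 0"
proof -
  obtain M where M: "M \<ge> 0" "\<And>x. \<bar>D x\<bar> \<le> M"
    using continuous_compact_support_bounded[OF D supp(2)] by blast
  have [measurable]: "g \<in> borel_measurable borel" "D \<in> borel_measurable borel"
    using g D by (auto intro: borel_measurable_continuous_onI)
  have ig: "integrable lborel g" by (rule integrable_continuous_compact_support[OF g supp(1)])
  have deriv': "((\<lambda>t. g (x + t *\<^sub>R e)) has_real_derivative D (x + s *\<^sub>R e)) (at s)" for x s
    using deriv[of "x + s *\<^sub>R e"] DERIV_shift[of "\<lambda>t. g (x + t *\<^sub>R e)" _ 0 s]
    by (simp add: algebra_simps)
  define t where "t n = inverse (real (Suc n))" for n
  have t: "0 < t n" "t n \<le> 1" for n by (simp_all add: t_def field_simps)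
  define q where "q n x = (g (x + t n *\<^sub>R e) - g x) / t n" for n x
  have q0: "(LINT x|lborel. q n x) = 0" for n
    unfolding q_def using ig lborel_translate[of g "t n *\<^sub>R e"] by simp
  \<comment> \<open>The mean value theorem bounds the quotient by the bound of \<open>D\<close>.
    Enlarging the radius by \<open>norm e\<close> suffices because all step lengths
    \<open>t n\<close> are at most 1.\<close>
  have qb: "\<bar>q n x\<bar> \<le> M * indicator (cball 0 (R + norm e)) x" for n x
  proof (cases "x \<in> cball 0 (R + norm e)")
    case True
    obtain z where "0 < z" "z < t n" "g (x + t n *\<^sub>R e) - g (x + 0 *\<^sub>R e) = (t n - 0) * D (x + z *\<^sub>R e)"
      using MVT2[OF t(1)[of n], of "\<lambda>t. g (x + t *\<^sub>R e)" "\<lambda>s. D (x + s *\<^sub>R e)"] deriv' by blast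
    then have "q n x = D (x + z *\<^sub>R e)" using t(1)[of n] by (simp add: q_def)
    then show ?thesis using M True by simp
  next
    case False
    have "norm x \<le> norm (x + t n *\<^sub>R e) + norm (t n *\<^sub>R e)" by (metis add_diff_cancel_right' norm_triangle_ineq4)
    moreover have "norm (t n *\<^sub>R e) \<le> norm e" using t[of n] by (simp add: mult_left_le_one_le)
    ultimately have "x + t n *\<^sub>R e \<notin> cball 0 R" using False by simp
    moreover have "x \<notin> cball 0 R" using False norm_ge_zero[of e] by (simp del: norm_ge_zero)
    ultimately show ?thesis using supp(1) False by (simp add: q_def)
  qed
  have "(\<lambda>n. LINT x|lborel. q n x) \<longlonglongrightarrow> (LINT x|lborel. D x)"
  proof (rule integral_dominated_convergence)
    show "integrable lborel (\<lambda>x. M * indicator (cball 0 (R + norm e)) x)"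
      using emeasure_lborel_cball_finite by (intro integrable_mult_right) (auto simp: integrable_indicator_iff)
    show "AE x in lborel. (\<lambda>n. q n x) \<longlonglongrightarrow> D x"
    proof (rule AE_I2)
      fix x
      have "((\<lambda>h. (g (x + h *\<^sub>R e) - g x) / h) \<longlongrightarrow> D x) (at 0)"
        using deriv[of x] by (simp add: DERIV_def)
      moreover have "filterlim t (at 0) sequentially"
      proof (rule filterlim_atI)
        show "t \<longlonglongrightarrow> 0" unfolding t_def by (rule LIMSEQ_inverse_real_of_nat)
        show "\<forall>\<^sub>F n in sequentially. t n \<noteq> 0" using t(1) by (auto intro: always_eventually simp: less_imp_neq[symmetric])
      qed
      ultimately show "(\<lambda>n. q n x) \<longlonglongrightarrow> D x" unfolding q_def by (rule filterlim_compose)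
    qed
  qed (use qb in \<open>auto simp: q_def\<close>)
  then show ?thesis unfolding q0 by (simp add: LIMSEQ_const_iff)
qed

section \<open>Concentration on the facets and the divergence theorem for a simplex\<close>

lemma facet_hyperplane_set:
  fixes C :: "'a::euclidean_space set"
  assumes bary: "barycentric C g b" and card: "card C = DIM('a) + 1" and c: "c \<in> C"
  shows "hyperplane_set (convex hull (C - {c})) (g c /\<^sub>R norm (g c))" and "g c \<noteq> 0"
proof -
  obtain a where a: "a \<in> C" "a \<noteq> c" using bary_two[OF bary card c] by blast
  show g0: "g c \<noteq> 0" using bary_gradient_nz[OF bary c a] .
  show "hyperplane_set (convex hull (C - {c})) (g c /\<^sub>R norm (g c))"
  proof
    show "convex hull (C - {c}) \<noteq> {}" using a by auto
    show "norm (g c /\<^sub>R norm (g c)) = 1" using g0 by simp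
  next
    fix x y assume "x \<in> convex hull (C - {c})" "y \<in> convex hull (C - {c})"
    then have "g c \<bullet> x + b c = 0" "g c \<bullet> y + b c = 0"
      using convex_hull_bary_facet[OF bary c] by auto
    then have "g c \<bullet> (y - x) = 0" by (simp add: inner_diff_right)
    then show "(g c /\<^sub>R norm (g c)) \<bullet> (y - x) = 0" by simp
  next
    fix u assume "\<And>x y. x \<in> convex hull (C - {c}) \<Longrightarrow> y \<in> convex hull (C - {c}) \<Longrightarrow> u \<bullet> (y - x) = 0"
    from facet_normal[OF bary c a this] have "u = (u \<bullet> (c - a)) *\<^sub>R g c" .
    also have "\<dots> = ((u \<bullet> (c - a)) * norm (g c)) *\<^sub>R (g c /\<^sub>R norm (g c))" using g0 by (simp add: mult.assoc)
    finally show "\<exists>\<kappa>. u = \<kappa> *\<^sub>R (g c /\<^sub>R norm (g c))" by blast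
  qed
qed

text \<open>\<open>h n\<close> is the term of the product rule in which the derivative falls on the
  ramp of the coordinate of \<open>c\<close>, up to the factor from the direction. On each line
  normal to the facet the factor \<open>real (Suc n)\<close> is absorbed by rescaling, which leaves
  a unit mass divided by \<open>norm (g c)\<close>; the other ramps tend to the indicator of the
  facet within its hyperplane.\<close>

lemma facet_limit:
  fixes C :: "'a::euclidean_space set" and f :: "'a \<Rightarrow> real"
  assumes bary: "barycentric C g b" and card: "card C = DIM('a) + 1" and c: "c \<in> C"
    and f: "continuous_on UNIV f"
  defines "F \<equiv> convex hull (C - {c})"
    and "h \<equiv> \<lambda>n x. real (Suc n) * ramp' (real (Suc n) * (g c \<bullet> x + b c)) * f x *
      (\<Prod>c'\<in>C - {c}. ramp (real (Suc n) * (g c' \<bullet> x + b c')))"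
  shows "integrable lborel (h n)"
    and "(\<lambda>n. LINT x|lborel. h n x) \<longlonglongrightarrow> (LINT x:F|hull_lebesgue F. f x) / norm (g c)"
    and "x \<notin> convex hull C \<Longrightarrow> h n x = 0"
proof -
  define m where "m = g c /\<^sub>R norm (g c)"
  interpret hyperplane_set F m
    unfolding F_def m_def by (rule facet_hyperplane_set[OF bary card c])
  have g0: "g c \<noteq> 0" by (rule facet_hyperplane_set(2)[OF bary card c])
  have fin: "finite C" by (rule bary_finite[OF bary])
  have gm: "g c \<bullet> m = norm (g c)" using g0 by (simp add: m_def dot_square_norm power2_eq_square)
  obtain R where R: "convex hull C \<subseteq> cball 0 R"
    using compact_imp_bounded[OF finite_imp_compact_convex_hull[OF fin]] by (metis bounded_iff mem_cball_0 subsetI)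
  obtain M0 where M0: "\<And>x. x \<in> convex hull C \<Longrightarrow> \<bar>f x\<bar> \<le> M0"
  proof -
    have "compact (f ` (convex hull C))"
      using f fin by (intro compact_continuous_image finite_imp_compact_convex_hull) (auto intro: continuous_on_subset)
    from compact_imp_bounded[OF this] show ?thesis using that by (auto simp: bounded_real)
  qed
  define M where "M = max 0 M0"
  have M: "0 \<le> M" "x \<in> convex hull C \<Longrightarrow> \<bar>f x\<bar> \<le> M" for x using M0[of x] by (auto simp: M_def)
  have hz: "ramp' (real (Suc n) * (g c \<bullet> x + b c)) * (\<Prod>c'\<in>C - {c}. ramp (real (Suc n) * (g c' \<bullet> x + b c'))) = 0"
    if "x \<notin> convex hull C" for n x
  proof -
    obtain c' where c': "c' \<in> C" "g c' \<bullet> x + b c' < 0"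
      using \<open>x \<notin> convex hull C\<close> convex_hull_bary[OF bary] by (auto simp: not_le)
    then have neg: "real (Suc n) * (g c' \<bullet> x + b c') \<le> 0" by (intro mult_nonneg_nonpos) auto
    show ?thesis
    proof (cases "c' = c")
      case True then show ?thesis using neg by simp
    next
      case False
      then have "(\<Prod>c'\<in>C - {c}. ramp (real (Suc n) * (g c' \<bullet> x + b c'))) = 0"
        using fin c'(1) neg by (intro prod_zero) (auto intro!: bexI[of _ c'])
      then show ?thesis by simp
    qed
  qed
  have prod_le: "\<bar>\<Prod>c'\<in>A. ramp (r c')\<bar> \<le> 1" for A :: "'a set" and r
    unfolding abs_prod by (rule prod_le_1) (simp add: ramp_bounds)
  have hcont: "continuous_on UNIV (h n)" for n
    unfolding h_def using f by (intro continuous_intros) auto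
  have h0: "h n x = 0" if "x \<notin> convex hull C" for n x
    using hz[OF that, of n] by (auto simp: h_def)
  then show "x \<notin> convex hull C \<Longrightarrow> h n x = 0" .
  show int: "integrable lborel (h n)" for n
    by (rule integrable_continuous_compact_support[OF hcont, of R]) (use h0 R in blast)
  have [measurable]: "h n \<in> borel_measurable borel" for n
    using hcont by (rule borel_measurable_continuous_onI)
  have base0: "g c \<bullet> base + b c = 0"
    using base convex_hull_bary_facet[OF bary c] by (auto simp: F_def)
  have lam0: "g c \<bullet> y + b c = 0" if "m \<bullet> y = m \<bullet> base" for y
    using that base0 g0 by (simp add: m_def)
  \<comment> \<open>The integrand on one normal line in the variable
    \<open>\<rho> = real (Suc n) * norm (g c) * r\<close>, with the factor
    \<open>real (Suc n)\<close> removed. In this variable the argument of \<open>ramp'\<close> is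
    \<open>\<rho>\<close> itself.\<close>
  define H where "H n y \<rho> = ramp' \<rho> * (f (y + (\<rho> / (real (Suc n) * norm (g c))) *\<^sub>R m) *
      (\<Prod>c'\<in>C - {c}. ramp (real (Suc n) * (g c' \<bullet> y + b c') + \<rho> * (g c' \<bullet> m) / norm (g c))))" for n y \<rho>
  have slice: "(LINT r|lborel. h n (y + r *\<^sub>R m)) = (LINT \<rho>|lborel. H n y \<rho>) / norm (g c)"
    and Hpt: "real (Suc n) * H n y \<rho> = h n (y + (\<rho> / (real (Suc n) * norm (g c))) *\<^sub>R m)"
    if y: "m \<bullet> y = m \<bullet> base" for n y \<rho>
  proof -
    let ?k = "real (Suc n) * norm (g c)"
    have k: "?k > 0" using g0 by simp
    have arg: "real (Suc n) * (g c' \<bullet> (y + (\<rho> / ?k) *\<^sub>R m) + b c') =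
        real (Suc n) * (g c' \<bullet> y + b c') + \<rho> * (g c' \<bullet> m) / norm (g c)" for c' \<rho>
      using k g0 by (simp add: inner_add_right field_simps del: of_nat_Suc)
    have argc: "real (Suc n) * (g c \<bullet> (y + (\<rho> / ?k) *\<^sub>R m) + b c) = \<rho>" for \<rho>
      unfolding arg using lam0[OF y] gm g0 by simp
    show Hpt: "real (Suc n) * H n y \<rho> = h n (y + (\<rho> / ?k) *\<^sub>R m)" for \<rho>
      unfolding H_def h_def argc unfolding arg by simp
    have "(LINT r|lborel. h n (y + r *\<^sub>R m)) = (1 / ?k) * (LINT \<rho>|lborel. h n (y + (\<rho> / ?k) *\<^sub>R m))"
      using lborel_integral_real_affine[of "1 / ?k" "\<lambda>r. h n (y + r *\<^sub>R m)" 0] k g0 by simp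
    also have "\<dots> = (1 / ?k) * (real (Suc n) * (LINT \<rho>|lborel. H n y \<rho>))"
      unfolding Hpt[symmetric] by (simp only: integral_mult_right_zero)
    finally show "(LINT r|lborel. h n (y + r *\<^sub>R m)) = (LINT \<rho>|lborel. H n y \<rho>) / norm (g c)"
      using g0 by (simp add: field_simps del: of_nat_Suc)
  qed
  \<comment> \<open>\<open>M\<close> bounds \<open>f\<close> on the simplex only; at points outside
    it \<open>h\<close>, and with it \<open>H\<close>, is zero.\<close>
  have Hbound: "\<bar>H n y \<rho>\<bar> \<le> ramp' \<rho> * M" if y: "m \<bullet> y = m \<bullet> base" for n y \<rho>
  proof -
    let ?x = "y + (\<rho> / (real (Suc n) * norm (g c))) *\<^sub>R m"
    show ?thesis
    proof (cases "?x \<in> convex hull C")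
      case True
      have "\<bar>f ?x * (\<Prod>c'\<in>C - {c}. ramp (real (Suc n) * (g c' \<bullet> y + b c') + \<rho> * (g c' \<bullet> m) / norm (g c)))\<bar> \<le> M * 1"
        unfolding abs_mult by (intro mult_mono M(2) True prod_le M(1)) auto
      then show ?thesis unfolding H_def abs_mult[of "ramp' \<rho>"]
        using ramp'_nonneg[of \<rho>] by (simp add: mult_left_mono)
    next
      case False
      then have "H n y \<rho> = 0" using Hpt[OF y, of n \<rho>] h0 by simp
      then show ?thesis using ramp'_nonneg[of \<rho>] M(1) by simp
    qed
  qed
  have Hmeas [measurable]: "H n y \<in> borel_measurable borel" for n y
    unfolding H_def using f g0
    by (intro borel_measurable_continuous_onI continuous_intros continuous_on_compose2[OF f]) auto
  have int_bound: "integrable lborel (\<lambda>\<rho>. ramp' \<rho> * M)" "(LINT \<rho>|lborel. ramp' \<rho> * M) = M"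
    using has_bochner_integral_ramp' by (auto simp: has_bochner_integral_iff)
  have inner_bound: "\<bar>LINT \<rho>|lborel. H n y \<rho>\<bar> \<le> M" if y: "m \<bullet> y = m \<bullet> base" for n y
  proof -
    have "\<bar>LINT \<rho>|lborel. H n y \<rho>\<bar> \<le> (LINT \<rho>|lborel. \<bar>H n y \<rho>\<bar>)" by (rule integral_abs_bound)
    also have "\<dots> \<le> (LINT \<rho>|lborel. ramp' \<rho> * M)"
      by (rule integral_mono[OF _ int_bound(1)])
        (use Hbound[OF y] M(1) in \<open>auto simp: abs_mult ramp'_nonneg intro!: integrable_abs Bochner_Integration.integrable_bound[OF int_bound(1)]\<close>)
    finally show ?thesis unfolding int_bound(2) .
  qed
  \<comment> \<open>If a normal line through \<open>y\<close> meets the simplex, the meeting point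
    has norm at most \<open>R\<close> and its distance from \<open>y\<close> is at most
    \<open>R + \<bar>m \<bullet> base\<bar>\<close>; the sum of the two is
    \<open>R'\<close>.\<close>
  define R' where "R' = 2 * R + \<bar>m \<bullet> base\<bar>"
  have inner_zero: "(LINT r|lborel. h n (y + r *\<^sub>R m)) = 0" if y: "m \<bullet> y = m \<bullet> base" "y \<notin> cball 0 R'" for n y
  proof -
    have "h n (y + r *\<^sub>R m) = 0" for r
    proof (rule h0, rule)
      assume "y + r *\<^sub>R m \<in> convex hull C"
      then have n: "norm (y + r *\<^sub>R m) \<le> R" using R by auto
      have "\<bar>m \<bullet> (y + r *\<^sub>R m)\<bar> \<le> R"
        using Cauchy_Schwarz_ineq2[of m "y + r *\<^sub>R m"] unit n by simp
      then have "\<bar>r\<bar> \<le> R + \<bar>m \<bullet> base\<bar>" using y(1) unit by (simp add: inner_add_right dot_square_norm)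
      moreover have "norm y \<le> norm (y + r *\<^sub>R m) + norm (r *\<^sub>R m)" by (metis add_diff_cancel_right' norm_triangle_ineq4)
      ultimately have "norm y \<le> R'" using n unit by (simp add: R'_def)
      then show False using y(2) by simp
    qed
    then show ?thesis by simp
  qed
  \<comment> \<open>\<open>ramp_scaled_limit\<close> asks for a nonzero coordinate. The points of
    the hyperplane where another coordinate vanishes form a null set, since the vertex
    \<open>c'\<close> lies on the facet and has coordinate 1.\<close>
  have AE_nz: "AE y in hull_lebesgue F. \<forall>c'\<in>C - {c}. g c' \<bullet> y + b c' \<noteq> 0"
  proof (subst AE_finite_all)
    show "finite (C - {c})" using fin by simp
    show "\<forall>c'\<in>C - {c}. AE y in hull_lebesgue F. g c' \<bullet> y + b c' \<noteq> 0"
    proof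
      fix c' assume c': "c' \<in> C - {c}"
      show "AE y in hull_lebesgue F. g c' \<bullet> y + b c' \<noteq> 0"
        by (rule AE_affine_nonzero[of c']) (use c' bary_vertex[OF bary, of c' c'] in \<open>auto simp: F_def hull_inc\<close>)
    qed
  qed
  have "(\<lambda>n. LINT y|hull_lebesgue F. LINT r|lborel. h n (y + r *\<^sub>R m)) \<longlonglongrightarrow>
      (LINT y|hull_lebesgue F. indicator F y * f y / norm (g c))"
  proof (rule integral_dominated_convergence)
    have [measurable]: "F \<in> sets borel" unfolding F_def
      using fin by (intro borel_closed compact_imp_closed finite_imp_compact_convex_hull) auto
    have [measurable]: "f \<in> borel_measurable borel" using f by (rule borel_measurable_continuous_onI)
    show "(\<lambda>y. indicator F y * f y / norm (g c)) \<in> borel_measurable (hull_lebesgue F)" by measurable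
    show "(\<lambda>y. LINT r|lborel. h n (y + r *\<^sub>R m)) \<in> borel_measurable (hull_lebesgue F)" for n by measurable
    show "integrable (hull_lebesgue F) (\<lambda>y. (M / norm (g c)) * indicator (cball 0 R') y)"
      using emeasure_bounded by (intro integrable_mult_right) (auto simp: integrable_indicator_iff)
    show "AE y in hull_lebesgue F. norm (LINT r|lborel. h n (y + r *\<^sub>R m)) \<le> (M / norm (g c)) * indicator (cball 0 R') y" for n
      using AE_hyperplane
    proof eventually_elim
      case (elim y)
      show ?case
      proof (cases "y \<in> cball 0 R'")
        case True then show ?thesis using inner_bound[OF elim, of n] g0
          by (simp add: slice[OF elim] divide_right_mono)
      next
        case False then show ?thesis using inner_zero[OF elim] by simp
      qed
    qed
    show "AE y in hull_lebesgue F. (\<lambda>n. LINT r|lborel. h n (y + r *\<^sub>R m)) \<longlonglongrightarrow> indicator F y * f y / norm (g c)"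
      using AE_hyperplane AE_nz
    proof eventually_elim
      case (elim y)
      let ?L = "\<lambda>\<rho>. ramp' \<rho> * (f y * (\<Prod>c'\<in>C - {c}. if g c' \<bullet> y + b c' > 0 then 1 else 0))"
      have "(\<lambda>n. LINT \<rho>|lborel. H n y \<rho>) \<longlonglongrightarrow> (LINT \<rho>|lborel. ?L \<rho>)"
      proof (rule integral_dominated_convergence[OF _ _ int_bound(1)])
        show "AE \<rho> in lborel. (\<lambda>n. H n y \<rho>) \<longlonglongrightarrow> ?L \<rho>"
        proof (rule AE_I2)
          fix \<rho> :: real
          have "(\<lambda>n. inverse (real (Suc n)) * (\<rho> / norm (g c))) \<longlonglongrightarrow> 0 * (\<rho> / norm (g c))"
            by (intro tendsto_mult tendsto_const LIMSEQ_inverse_real_of_nat)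
          then have "(\<lambda>n. \<rho> / (real (Suc n) * norm (g c))) \<longlonglongrightarrow> 0" by (simp add: field_simps)
          then have "(\<lambda>n. y + (\<rho> / (real (Suc n) * norm (g c))) *\<^sub>R m) \<longlonglongrightarrow> y + 0 *\<^sub>R m"
            by (intro tendsto_intros)
          then have "(\<lambda>n. f (y + (\<rho> / (real (Suc n) * norm (g c))) *\<^sub>R m)) \<longlonglongrightarrow> f y"
            using continuous_on_tendsto_compose[OF f, of "\<lambda>n. y + (\<rho> / (real (Suc n) * norm (g c))) *\<^sub>R m" y sequentially] by simp
          moreover have "(\<lambda>n. ramp (real (Suc n) * (g c' \<bullet> y + b c') + \<rho> * (g c' \<bullet> m) / norm (g c)))
              \<longlonglongrightarrow> (if g c' \<bullet> y + b c' > 0 then 1 else 0)" if "c' \<in> C - {c}" for c'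
            using ramp_scaled_limit elim(2) that by blast
          ultimately show "(\<lambda>n. H n y \<rho>) \<longlonglongrightarrow> ?L \<rho>"
            unfolding H_def by (intro tendsto_mult tendsto_const tendsto_prod) auto
        qed
        have [measurable]: "ramp' \<in> borel_measurable borel"
          using continuous_ramp(2)[OF continuous_on_id] by (auto intro: borel_measurable_continuous_onI)
        show "?L \<in> borel_measurable lborel" by measurable
      qed (use Hbound[OF elim(1)] in auto)
      also have "(LINT \<rho>|lborel. ?L \<rho>) = f y * (\<Prod>c'\<in>C - {c}. if g c' \<bullet> y + b c' > 0 then 1 else 0)"
        using has_bochner_integral_ramp' by (simp add: has_bochner_integral_iff)
      \<comment> \<open>On the hyperplane the coordinate of \<open>c\<close> is zero, so the signs
        of the other coordinates alone decide membership in \<open>F\<close>.\<close>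
      also have "(\<Prod>c'\<in>C - {c}. if g c' \<bullet> y + b c' > 0 then 1 else 0) = (indicator F y :: real)"
      proof (cases "\<forall>c'\<in>C - {c}. g c' \<bullet> y + b c' > 0")
        case True
        then have "y \<in> convex hull C" unfolding convex_hull_bary[OF bary]
          using lam0[OF elim(1)] by (auto, metis Diff_iff insert_iff less_imp_le order_refl singletonD)
        then have "y \<in> F" using lam0[OF elim(1)] convex_hull_bary_facet[OF bary c] by (simp add: F_def)
        then show ?thesis using True by simp
      next
        case False
        then obtain c' where c': "c' \<in> C - {c}" "g c' \<bullet> y + b c' < 0" using elim(2) by (metis linorder_less_linear)
        then have "y \<notin> convex hull C" unfolding convex_hull_bary[OF bary] by force
        then have "y \<notin> F" using convex_hull_bary_facet[OF bary c] by (simp add: F_def)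
        moreover have "(\<Prod>c'\<in>C - {c}. if g c' \<bullet> y + b c' > 0 then 1 else 0) = (0::real)"
          using fin c' by (intro prod_zero) (auto intro!: bexI[of _ c'])
        ultimately show ?thesis by simp
      qed
      finally show "(\<lambda>n. LINT r|lborel. h n (y + r *\<^sub>R m)) \<longlonglongrightarrow> indicator F y * f y / norm (g c)"
        unfolding slice[OF elim(1)] using g0 by (intro tendsto_divide) (auto simp: mult.commute)
    qed
  qed
  then show "(\<lambda>n. LINT x|lborel. h n x) \<longlonglongrightarrow> (LINT x:F|hull_lebesgue F. f x) / norm (g c)"
    unfolding integral_slices[OF int] set_lebesgue_integral_def by simp
qed

text \<open>The frontier of a convex set is negligible, so agreement on the interior suffices. This
  matches fields whose values on the mesh skeleton are arbitrary; completeness of Lebesgue measure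
  makes them measurable.\<close>

lemma integral_lebesgue_on_eq_interior:
  fixes f q :: "'a::euclidean_space \<Rightarrow> real"
  assumes T: "convex T" "closed T" and q [measurable]: "q \<in> borel_measurable borel"
    and f: "\<And>x. x \<in> interior T \<Longrightarrow> f x = q x"
  shows "(LINT x|lebesgue_on T. f x) = (LINT x|lborel. indicator (interior T) x * q x)"
proof -
  have [measurable]: "T \<in> sets lebesgue" "T \<in> sets borel" "interior T \<in> sets borel" using T(2) by auto
  have "negligible (frontier T)" using T(1) by (rule negligible_convex_frontier)
  then have "AE x in lebesgue. x \<notin> frontier T"
    by (simp add: AE_not_in negligible_iff_null_sets)
  then have AE: "AE x in lebesgue. indicator (interior T) x *\<^sub>R q x = indicator T x *\<^sub>R f x"
    by eventually_elim (use T(2) interior_subset f in \<open>auto simp: frontier_def indicator_def\<close>)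
  have m: "(\<lambda>x. indicator (interior T) x *\<^sub>R q x) \<in> borel_measurable lebesgue"
    by (rule measurable_completion) measurable
  have "(LINT x|lebesgue_on T. f x) = (LINT x|lebesgue. indicator T x *\<^sub>R f x)"
    by (rule integral_restrict_space) simp
  also have "\<dots> = (LINT x|lebesgue. indicator (interior T) x *\<^sub>R q x)"
    by (rule integral_cong_AE[symmetric, OF m borel_measurable_AE[OF m AE] AE])
  also have "\<dots> = (LINT x|lborel. indicator (interior T) x *\<^sub>R q x)"
    by (rule integral_completion) measurable
  finally show ?thesis by simp
qed

lemma differentiable_line:
  fixes f :: "real^'n \<Rightarrow> real"
  assumes "f differentiable at x"
  shows "((\<lambda>t. f (x + t *\<^sub>R axis j 1)) has_real_derivative partial j f x) (at 0)"
proof -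
  have "(f has_derivative frechet_derivative f (at x)) (at (x + 0 *\<^sub>R axis j 1))"
    using assms frechet_derivative_works by auto
  then have "((\<lambda>t. f (x + t *\<^sub>R axis j 1)) has_derivative (\<lambda>h. frechet_derivative f (at x) (h *\<^sub>R axis j 1))) (at 0)"
    by (rule has_derivative_compose[rotated]) (auto intro!: derivative_eq_intros)
  moreover have "frechet_derivative f (at x) (h *\<^sub>R axis j 1) = partial j f x * h" for h
    using linear_scale[OF linear_frechet_derivative[OF assms]] by (simp add: partial_def mult.commute)
  ultimately show ?thesis by (simp add: has_field_derivative_def)
qed

text \<open>
  The derivative of \<open>f\<close> times the product of the \<open>ramp (n \<lambda>\<^sub>c)\<close>, a \<open>C\<^sup>1\<close> approximation of the
  indicator of \<open>T\<close>, has integral zero; in the limit the derivatives of the ramps concentrate on the facets.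
\<close>

theorem divergence_simplex:
  fixes f :: "real^'n \<Rightarrow> real"
  assumes T: "int DIM(real^'n) simplex T"
    and f: "\<And>x. f differentiable at x" "continuous_on UNIV (partial j f)"
    and N: "\<And>F. F facet_of T \<Longrightarrow> norm (N F) = 1"
      "\<And>F x y. F facet_of T \<Longrightarrow> x \<in> F \<Longrightarrow> y \<in> F \<Longrightarrow> N F \<bullet> (y - x) = 0"
      "\<And>F. F facet_of T \<Longrightarrow> points_outward T F (N F)"
  shows "(LINT x|lebesgue_on T. partial j f x) = (\<Sum>F | F facet_of T. N F $ j * (LINT x:F|hull_lebesgue F. f x))"
proof -
  obtain C g b where bary: "barycentric C g b" and TC: "T = convex hull C"
    and indep: "\<not> affine_dependent C" and card: "card C = DIM(real^'n) + 1"
    using simplex_barycentric[OF T] by blast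
  have fin: "finite C" by (rule bary_finite[OF bary])
  define e :: "real^'n" where "e = axis j 1"
  define lam where "lam c x = g c \<bullet> x + b c" for c x
  define Fc where "Fc c = convex hull (C - {c})" for c
  have fcont: "continuous_on UNIV f"
    using f(1) by (simp add: continuous_at_imp_continuous_on differentiable_imp_continuous_within)
  define h where "h c n x = real (Suc n) * ramp' (real (Suc n) * (g c \<bullet> x + b c)) * f x *
      (\<Prod>c'\<in>C - {c}. ramp (real (Suc n) * (g c' \<bullet> x + b c')))" for c n x
  have h: "integrable lborel (h c n)"
    "(\<lambda>n. LINT x|lborel. h c n x) \<longlonglongrightarrow> (LINT x:Fc c|hull_lebesgue (Fc c). f x) / norm (g c)"
    if c: "c \<in> C" for c n
    using facet_limit(1,2)[OF bary card c fcont] unfolding h_def Fc_def by auto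
  have hout: "h c n x = 0" if "x \<notin> T" "c \<in> C" for c n x
    using facet_limit(3)[OF bary card that(2) fcont] that(1) unfolding h_def TC by blast
  obtain R where R: "convex hull C \<subseteq> cball 0 R"
    using compact_imp_bounded[OF finite_imp_compact_convex_hull[OF fin]] by (metis bounded_iff mem_cball_0 subsetI)
  have T_sub: "T \<subseteq> cball 0 R" using R TC by simp
  define P where "P n x = (\<Prod>c\<in>C. ramp (real (Suc n) * (g c \<bullet> x + b c)))" for n x
  have P0: "P n x = 0" if "c \<in> C" "g c \<bullet> x + b c \<le> 0" for n x c
  proof -
    have "real (Suc n) * (g c \<bullet> x + b c) \<le> 0" using that(2) by (intro mult_nonneg_nonpos) auto
    then show ?thesis unfolding P_def using fin that(1) by (intro prod_zero) (auto intro!: bexI[of _ c])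
  qed
  have Pout: "P n x = 0" if "x \<notin> T" for n x
    using that P0[of _ x n] unfolding TC convex_hull_bary[OF bary] by (auto simp: not_le intro: less_imp_le)
  have Pb: "\<bar>P n x\<bar> \<le> 1" for n x
    unfolding P_def abs_prod by (rule prod_le_1) (simp add: ramp_bounds)
  have Pcont: "continuous_on UNIV (P n)" for n
    unfolding P_def by (intro continuous_intros)
  \<comment> \<open>The product rule for \<open>f\<close> times \<open>P n\<close> in the direction
    \<open>e\<close>: each barycentric coordinate contributes its slope
    \<open>g c \<bullet> e\<close> times the function treated in \<open>facet_limit\<close>.\<close>
  define D where "D n x = partial j f x * P n x + (\<Sum>c\<in>C. (g c \<bullet> e) * h c n x)" for n x
  have hcont: "continuous_on UNIV (h c n)" for c n
    unfolding h_def using fcont by (intro continuous_intros) auto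
  have Dcont: "continuous_on UNIV (D n)" for n
    unfolding D_def using f(2) Pcont hcont by (intro continuous_intros) auto
  have deriv: "((\<lambda>t. f (x + t *\<^sub>R e) * P n (x + t *\<^sub>R e)) has_real_derivative D n x) (at 0)" for n x
  proof -
    have r: "((\<lambda>t. ramp (real (Suc n) * (g c \<bullet> (x + t *\<^sub>R e) + b c))) has_real_derivative
        (g c \<bullet> e) * (real (Suc n) * ramp' (real (Suc n) * (g c \<bullet> x + b c)))) (at 0)" for c
    proof -
      have "((\<lambda>t. real (Suc n) * (g c \<bullet> (x + t *\<^sub>R e) + b c)) has_real_derivative real (Suc n) * (g c \<bullet> e)) (at 0)"
        by (simp only: inner_add_right inner_scaleR_right) (auto intro!: derivative_eq_intros)
      from DERIV_chain2[OF DERIV_ramp this] show ?thesis by (simp add: mult_ac)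
    qed
    have "((\<lambda>t. P n (x + t *\<^sub>R e)) has_real_derivative
        (\<Sum>c\<in>C. (g c \<bullet> e) * (real (Suc n) * ramp' (real (Suc n) * (g c \<bullet> x + b c))) *
          (\<Prod>c'\<in>C - {c}. ramp (real (Suc n) * (g c' \<bullet> x + b c'))))) (at 0)"
      unfolding P_def using has_field_derivative_prod[where A = C, OF r] by (simp del: of_nat_Suc)
    from DERIV_mult[OF differentiable_line[OF f(1)[of x], of j, folded e_def] this]
    show ?thesis by (rule DERIV_cong) (simp add: D_def h_def sum_distrib_left sum_distrib_right mult_ac add.commute)
  qed
  have gcont: "continuous_on UNIV (\<lambda>x. f x * P n x)" for n
    using fcont Pcont by (intro continuous_intros) auto
  have "(LINT x|lborel. D n x) = 0" for n
  proof (rule integral_derivative_compact_support[OF gcont Dcont _ _ deriv, where R = R])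
    fix x :: "real^'n" assume "x \<notin> cball 0 R"
    then have "x \<notin> T" using T_sub by blast
    then show "f x * P n x = 0" "D n x = 0" using Pout hout by (simp_all add: D_def)
  qed
  moreover have int1: "integrable lborel (\<lambda>x. partial j f x * P n x)" for n
  proof (rule integrable_continuous_compact_support[of _ R])
    show "continuous_on UNIV (\<lambda>x. partial j f x * P n x)"
      using f(2) Pcont by (intro continuous_intros) auto
    fix x :: "real^'n" assume "x \<notin> cball 0 R"
    then have "x \<notin> T" using T_sub by blast
    then show "partial j f x * P n x = 0" using Pout by simp
  qed
  ultimately have eq: "(LINT x|lborel. partial j f x * P n x) = - (\<Sum>c\<in>C. (g c \<bullet> e) * (LINT x|lborel. h c n x))" for n
    unfolding D_def using h(1) by (subst (asm) Bochner_Integration.integral_add)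
      (auto simp: Bochner_Integration.integral_sum eq_neg_iff_add_eq_0)
  have lim1: "(\<lambda>n. LINT x|lborel. partial j f x * P n x) \<longlonglongrightarrow> (LINT x|lborel. indicator (interior T) x * partial j f x)"
  proof (rule integral_dominated_convergence)
    have [measurable]: "partial j f \<in> borel_measurable borel" using f(2) by (rule borel_measurable_continuous_onI)
    show "(\<lambda>x. indicator (interior T) x * partial j f x) \<in> borel_measurable lborel" by measurable
    show "(\<lambda>x. partial j f x * P n x) \<in> borel_measurable lborel" for n using int1 by auto
    have "continuous_on (cball 0 R) (\<lambda>x. \<bar>partial j f x\<bar>)"
      using f(2) by (intro continuous_intros) (auto intro: continuous_on_subset)
    then have "integrable lborel (\<lambda>x. indicator (cball 0 R) x *\<^sub>R \<bar>partial j f x\<bar>)"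
      by (intro borel_integrable_compact) auto
    then show "integrable lborel (\<lambda>x. indicator (cball 0 R) x *\<^sub>R \<bar>partial j f x\<bar>)" .
    show "AE x in lborel. norm (partial j f x * P n x) \<le> indicator (cball 0 R) x *\<^sub>R \<bar>partial j f x\<bar>" for n
    proof (rule AE_I2)
      fix x show "norm (partial j f x * P n x) \<le> indicator (cball 0 R) x *\<^sub>R \<bar>partial j f x\<bar>"
      proof (cases "x \<in> T")
        case True
        then have "x \<in> cball 0 R" using T_sub by blast
        then show ?thesis using mult_left_mono[OF Pb[of n x], of "\<bar>partial j f x\<bar>"] by (simp add: abs_mult)
      next
        case False then show ?thesis using Pout by simp
      qed
    qed
    show "AE x in lborel. (\<lambda>n. partial j f x * P n x) \<longlonglongrightarrow> indicator (interior T) x * partial j f x"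
    proof (rule AE_I2)
      fix x show "(\<lambda>n. partial j f x * P n x) \<longlonglongrightarrow> indicator (interior T) x * partial j f x"
      proof (cases "\<forall>c\<in>C. 0 < g c \<bullet> x + b c")
        case True
        then have "x \<in> interior T" unfolding TC by (intro bary_pos_interior[OF bary]) auto
        have "(\<lambda>n. ramp (real (Suc n) * (g c \<bullet> x + b c))) \<longlonglongrightarrow> 1" if "c \<in> C" for c
          using ramp_scaled_limit[of "g c \<bullet> x + b c" 0] True that by auto
        then have "(\<lambda>n. partial j f x * P n x) \<longlonglongrightarrow> partial j f x * (\<Prod>c\<in>C. 1)"
          unfolding P_def by (intro tendsto_mult tendsto_const tendsto_prod) auto
        then show ?thesis using \<open>x \<in> interior T\<close> by simp
      next
        case False
        then obtain c where c: "c \<in> C" "g c \<bullet> x + b c \<le> 0" by (auto simp: not_less)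
        have "g c \<noteq> 0" by (rule facet_hyperplane_set(2)[OF bary card c(1)])
        then have "x \<notin> interior T" using interior_bary_pos[OF bary _ c(1)] c(2) unfolding TC by fastforce
        then show ?thesis using P0[OF c] by simp
      qed
    qed
  qed
  have lim2: "(\<lambda>n. - (\<Sum>c\<in>C. (g c \<bullet> e) * (LINT x|lborel. h c n x))) \<longlonglongrightarrow>
      - (\<Sum>c\<in>C. (g c \<bullet> e) * ((LINT x:Fc c|hull_lebesgue (Fc c). f x) / norm (g c)))"
    by (intro tendsto_minus tendsto_sum tendsto_mult tendsto_const h(2))
  \<comment> \<open>The coordinate of \<open>c\<close> increases into the simplex, so the outward
    unit normal is the negative of its normalised gradient. This sign cancels the minus from moving
    the facet terms to the other side.\<close>
  have Nc: "N (Fc c) = - (g c /\<^sub>R norm (g c))" if c: "c \<in> C" for c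
  proof -
    obtain a where a: "a \<in> C" "a \<noteq> c" using bary_two[OF bary card c] by blast
    have facet: "Fc c facet_of T" unfolding TC Fc_def using simplex_facet_iff[OF indep card] c by blast
    define \<kappa> where "\<kappa> = N (Fc c) \<bullet> (c - a)"
    have N\<kappa>: "N (Fc c) = \<kappa> *\<^sub>R g c"
      unfolding \<kappa>_def by (rule facet_normal[OF bary c a]) (use N(2)[OF facet] in \<open>simp add: Fc_def\<close>)
    have "a \<in> Fc c" "c \<in> T" using a c by (auto simp: Fc_def TC hull_inc)
    then have "\<kappa> \<le> 0" using N(3)[OF facet] by (auto simp: points_outward_def \<kappa>_def)
    moreover have "\<bar>\<kappa>\<bar> * norm (g c) = 1" using N(1)[OF facet] N\<kappa> by simp
    moreover have g0: "g c \<noteq> 0" by (rule facet_hyperplane_set(2)[OF bary card c])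
    ultimately have "\<kappa> = - inverse (norm (g c))" by (simp add: field_simps)
    then show ?thesis using N\<kappa> by simp
  qed
  have "(LINT x|lebesgue_on T. partial j f x) = (LINT x|lborel. indicator (interior T) x * partial j f x)"
    using convex_simplex[OF T] closed_simplex[OF T] f(2)
    by (intro integral_lebesgue_on_eq_interior borel_measurable_continuous_onI) auto
  also have "\<dots> = - (\<Sum>c\<in>C. (g c \<bullet> e) * ((LINT x:Fc c|hull_lebesgue (Fc c). f x) / norm (g c)))"
    using LIMSEQ_unique[OF lim1 lim2[folded eq]] .
  also have "\<dots> = (\<Sum>c\<in>C. N (Fc c) $ j * (LINT x:Fc c|hull_lebesgue (Fc c). f x))"
    unfolding sum_negf[symmetric]
    by (rule sum.cong) (auto simp: Nc e_def inner_axis field_simps)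
  also have "\<dots> = (\<Sum>F\<in>Fc ` C. N F $ j * (LINT x:F|hull_lebesgue F. f x))"
    by (subst sum.reindex) (auto simp: inj_on_def Fc_def intro: simplex_facet_inj[OF bary])
  also have "Fc ` C = {F. F facet_of T}"
    unfolding TC Fc_def using simplex_facet_iff[OF indep card] by auto
  finally show ?thesis .
qed

section \<open>Meshes\<close>

definition face_normal :: "'a::euclidean_space set \<Rightarrow> 'a \<Rightarrow> bool" where
  "face_normal F n \<longleftrightarrow> norm n = 1 \<and> (\<forall>x\<in>F. \<forall>y\<in>F. n \<bullet> (y - x) = 0)"

lemma face_normal_minus: "face_normal F (- n) \<longleftrightarrow> face_normal F n"
  by (auto simp: face_normal_def)

context
  fixes T :: "'a::euclidean_space set"
  assumes T: "int DIM('a) simplex T"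
begin

lemma simplex_full_aff_dim: "aff_dim T = int DIM('a)"
  using T by (rule aff_dim_simplex)

lemma simplex_rel_interior: "rel_interior T = interior T"
  by (rule interior_rel_interior[OF simplex_full_aff_dim])

lemma simplex_interior_nonempty: "interior T \<noteq> {}"
  using rel_interior_eq_empty[OF convex_simplex[OF T]] simplex_rel_interior simplex_full_aff_dim
  by (metis aff_dim_empty of_nat_0_le_iff not_one_le_zero neg_0_le_iff_le le_minus_one_simps(1))

lemma simplex_closure_interior: "closure (interior T) = T"
  using convex_closure_interior[OF convex_simplex[OF T] simplex_interior_nonempty] closed_simplex[OF T] by simp

lemma finite_simplex_facets: "finite {F. F facet_of T}"
  by (rule finite_polytope_facets) (rule simplex_imp_polytope[OF T])

end

text \<open>Every unit normal is a multiple of the gradient of the coordinate that vanishes on the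
  facet, and the sign of the multiple decides the side, since this coordinate is nonnegative on the
  simplex.\<close>

lemma facet_normal_form:
  fixes C :: "'a::euclidean_space set"
  assumes bary: "barycentric C g b" and card: "card C = DIM('a) + 1" and c: "c \<in> C"
    and n: "face_normal (convex hull (C - {c})) n"
  obtains "n = g c /\<^sub>R norm (g c)" "points_outward (convex hull C) (convex hull (C - {c})) (- n)"
  | "n = - (g c /\<^sub>R norm (g c))" "points_outward (convex hull C) (convex hull (C - {c})) n"
proof -
  let ?F = "convex hull (C - {c})"
  obtain a where a: "a \<in> C" "a \<noteq> c" using bary_two[OF bary card c] by blast
  have g0: "g c \<noteq> 0" using bary_gradient_nz[OF bary c a] .
  define \<kappa> where "\<kappa> = n \<bullet> (c - a)"
  have n\<kappa>: "n = \<kappa> *\<^sub>R g c"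
    unfolding \<kappa>_def by (rule facet_normal[OF bary c a]) (use n in \<open>auto simp: face_normal_def\<close>)
  have "\<bar>\<kappa>\<bar> * norm (g c) = 1" using n n\<kappa> by (simp add: face_normal_def)
  then have \<kappa>: "\<bar>\<kappa>\<bar> = inverse (norm (g c))" using g0 by (simp add: field_simps)
  have ge: "g c \<bullet> (y - x) \<ge> 0" if "x \<in> ?F" "y \<in> convex hull C" for x y
  proof -
    have "g c \<bullet> x + b c = 0" using that(1) convex_hull_bary_facet[OF bary c] by auto
    moreover have "0 \<le> g c \<bullet> y + b c" using that(2) convex_hull_bary[OF bary] c by auto
    ultimately show ?thesis by (simp add: inner_diff_right)
  qed
  show ?thesis
  proof (cases "\<kappa> \<ge> 0")
    case True
    then have "n = g c /\<^sub>R norm (g c)" using n\<kappa> \<kappa> by simp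
    moreover have "points_outward (convex hull C) ?F (- n)"
      unfolding points_outward_def n\<kappa> using ge True by simp
    ultimately show ?thesis by (rule that(1))
  next
    case False
    then have "\<kappa> = - inverse (norm (g c))" using \<kappa> by simp
    then have "n = - (g c /\<^sub>R norm (g c))" using n\<kappa> by simp
    moreover have "points_outward (convex hull C) ?F n"
      unfolding points_outward_def n\<kappa> using ge False by (auto intro: mult_nonpos_nonneg)
    ultimately show ?thesis by (rule that(2))
  qed
qed

lemma facet_two_sides:
  fixes T :: "'a::euclidean_space set"
  assumes T: "int DIM('a) simplex T" and F: "F facet_of T" and n: "face_normal F n"
  shows "points_outward T F n \<or> points_outward T F (- n)"
proof -
  obtain C g b where bary: "barycentric C g b" and TC: "T = convex hull C"
    and indep: "\<not> affine_dependent C" and card: "card C = DIM('a) + 1"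
    using simplex_barycentric[OF T] by blast
  obtain c where c: "c \<in> C" "F = convex hull (C - {c})"
    using F simplex_facet_iff[OF indep card] TC by blast
  show ?thesis unfolding TC c(2)
    using facet_normal_form[OF bary card c(1) n[unfolded c(2)]] by metis
qed

text \<open>At a relative interior point of the facet all other coordinates are positive and stay so
  for small \<open>t\<close>, while the coordinate of the opposite vertex equals
  \<open>t * norm (g c)\<close>.\<close>

lemma facet_interior_side:
  fixes T :: "'a::euclidean_space set"
  assumes T: "int DIM('a) simplex T" and F: "F facet_of T" and n: "face_normal F n"
    and out: "points_outward T F n" and x: "x \<in> rel_interior F"
  shows "\<forall>\<^sub>F t in at_right 0. x - t *\<^sub>R n \<in> interior T"
proof -
  obtain C g b where bary: "barycentric C g b" and TC: "T = convex hull C"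
    and indep: "\<not> affine_dependent C" and card: "card C = DIM('a) + 1"
    using simplex_barycentric[OF T] by blast
  have fin: "finite C" by (rule bary_finite[OF bary])
  obtain c where c: "c \<in> C" and Fc: "F = convex hull (C - {c})"
    using F simplex_facet_iff[OF indep card] TC by blast
  obtain a where a: "a \<in> C" "a \<noteq> c" using bary_two[OF bary card c] by blast
  have g0: "g c \<noteq> 0" using bary_gradient_nz[OF bary c a] .
  have xF: "x \<in> F" using x rel_interior_subset by blast
  \<comment> \<open>If the coordinate of \<open>c'\<close> vanished at \<open>x\<close>, prolonging
    the segment from \<open>c'\<close> beyond \<open>x\<close> within the facet would make it
    \<open>1 - e\<close>, which is negative.\<close>
  have pos: "0 < g c' \<bullet> x + b c'" if c': "c' \<in> C" "c' \<noteq> c" for c'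
  proof (rule ccontr)
    assume "\<not> 0 < g c' \<bullet> x + b c'"
    moreover have "x \<in> convex hull C" using xF Fc hull_mono[of "C - {c}" C convex] by blast
    ultimately have 0: "g c' \<bullet> x + b c' = 0" using convex_hull_bary[OF bary] c'(1) by force
    have "c' \<in> F" using c' by (simp add: Fc hull_inc)
    then obtain e where e: "e > 1" "(1 - e) *\<^sub>R c' + e *\<^sub>R x \<in> F"
      using convex_rel_interior_iff[of F x] x xF Fc by (metis convex_convex_hull empty_iff)
    let ?z = "(1 - e) *\<^sub>R c' + e *\<^sub>R x"
    have "?z \<in> convex hull C" using e(2) Fc hull_mono[of "C - {c}" C convex] by blast
    then have "0 \<le> g c' \<bullet> ?z + b c'" using convex_hull_bary[OF bary] c'(1) by blast
    also have "g c' \<bullet> ?z + b c' = (1 - e) * (g c' \<bullet> c' + b c') + e * (g c' \<bullet> x + b c')"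
      by (simp add: inner_add_right algebra_simps)
    also have "\<dots> = 1 - e" using 0 bary_vertex[OF bary c'(1,1)] by simp
    finally show False using e(1) by simp
  qed
  have nf: "n = - (g c /\<^sub>R norm (g c))"
  proof (rule facet_normal_form[OF bary card c n[unfolded Fc]])
    assume n': "n = g c /\<^sub>R norm (g c)"
    have "a \<in> F" "c \<in> T" using a c by (auto simp: Fc TC hull_inc)
    then have "n \<bullet> (c - a) \<le> 0" using out by (auto simp: points_outward_def)
    moreover have "g c \<bullet> (c - a) = 1"
      using bary_vertex[OF bary c c] bary_vertex[OF bary c a(1)] a(2) by (simp add: inner_diff_right)
    ultimately have False using g0 by (simp add: n')
    then show ?thesis ..
  qed
  have "\<forall>\<^sub>F t in at_right 0. 0 < g c' \<bullet> (x - t *\<^sub>R n) + b c'" if c': "c' \<in> C" for c'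
  proof (cases "c' = c")
    case True
    have "g c \<bullet> x + b c = 0" using xF convex_hull_bary_facet[OF bary c] by (auto simp: Fc)
    moreover have "g c \<bullet> n = - norm (g c)"
      unfolding nf using g0 by (simp add: dot_square_norm power2_eq_square)
    ultimately have "g c \<bullet> (x - t *\<^sub>R n) + b c = t * norm (g c)" for t
      by (simp add: inner_diff_right)
    then show ?thesis unfolding True using g0 eventually_at_right_less[of "0::real"]
      by (auto elim: eventually_mono)
  next
    case False
    have "((\<lambda>t. g c' \<bullet> (x - t *\<^sub>R n) + b c') \<longlongrightarrow> g c' \<bullet> (x - 0 *\<^sub>R n) + b c') (at_right 0)"
      by (intro tendsto_intros)
    then show ?thesis using pos[OF c' False] by (intro order_tendstoD) auto
  qed
  then have "\<forall>\<^sub>F t in at_right 0. \<forall>c'\<in>C. 0 < g c' \<bullet> (x - t *\<^sub>R n) + b c'"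
    using fin by (simp add: eventually_ball_finite_distrib)
  then show ?thesis unfolding TC
    by eventually_elim (rule bary_pos_interior[OF bary], blast)
qed

section \<open>The two elements at an interior face\<close>

locale mesh =
  fixes \<Omega> :: "'a::euclidean_space set" and \<T> :: "'a set set" and \<nu> :: "'a set \<Rightarrow> 'a"
  assumes domain: "polytopal_domain \<Omega>" and mesh: "simplicial_mesh \<Omega> \<T>" and normals: "face_normals \<Omega> \<T> \<nu>"
begin

lemma finite_mesh: "finite \<T>" and simplex: "T \<in> \<T> \<Longrightarrow> int DIM('a) simplex T"
  and Union_mesh: "\<Union>\<T> = closure \<Omega>" and mesh_face: "T \<in> \<T> \<Longrightarrow> T' \<in> \<T> \<Longrightarrow> (T \<inter> T') face_of T"
  using mesh unfolding simplicial_mesh_def triangulation_def by blast+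

lemma open_domain: "open \<Omega>" and domain_interior: "interior (closure \<Omega>) = \<Omega>"
  using domain unfolding polytopal_domain_def by metis+

lemma elt_closed: "T \<in> \<T> \<Longrightarrow> closed T" and elt_convex: "T \<in> \<T> \<Longrightarrow> convex T" and elt_compact: "T \<in> \<T> \<Longrightarrow> compact T"
  using simplex closed_simplex convex_simplex compact_simplex by blast+

lemma elt_interior_subset: "T \<in> \<T> \<Longrightarrow> interior T \<subseteq> \<Omega>"
proof -
  assume "T \<in> \<T>"
  then have "T \<subseteq> closure \<Omega>" using Union_mesh by blast
  from interior_mono[OF this] show ?thesis by (simp only: domain_interior)
qed

text \<open>The intersection of two elements is a face of each, and a face that meets the interior
  is the whole element; applied in both directions this gives equality.\<close>

lemma elt_subset_eq:
  assumes "T \<in> \<T>" "T' \<in> \<T>" "x \<in> interior T" "x \<in> T'" shows "T = T'"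
proof -
  have sub: "T1 \<subseteq> T2" if "T1 \<in> \<T>" "T2 \<in> \<T>" "interior T1 \<inter> T2 \<noteq> {}" for T1 T2
  proof -
    have "T1 \<inter> T2 = T1"
    proof (rule ccontr)
      assume "T1 \<inter> T2 \<noteq> T1"
      from face_of_disjoint_interior[OF mesh_face[OF that(1,2)] this]
      show False using that(3) interior_subset by blast
    qed
    then show ?thesis by blast
  qed
  have 1: "T \<subseteq> T'" by (rule sub) (use assms in auto)
  then have "interior T \<subseteq> interior T'" by (rule interior_mono)
  then have "T' \<subseteq> T" using simplex_interior_nonempty[OF simplex[OF assms(1)]] interior_subset assms(1,2)
    by (intro sub) blast+
  with 1 show ?thesis by blast
qed

lemma face_normal: "F \<in> faces \<T> \<Longrightarrow> face_normal F (\<nu> F)"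
  using normals by (auto simp: face_normals_def face_normal_def)

lemma facesI: "T \<in> \<T> \<Longrightarrow> F facet_of T \<Longrightarrow> F \<in> faces \<T>"
  by (auto simp: faces_def)

lemma finite_faces: "finite (faces \<T>)"
proof -
  have "faces \<T> = (\<Union>T\<in>\<T>. {F. F facet_of T})" by (auto simp: faces_def)
  then show ?thesis using finite_mesh finite_simplex_facets[OF simplex] by simp
qed

lemma facet_props:
  assumes "T \<in> \<T>" "F facet_of T"
  shows "F \<noteq> {}" "F \<subseteq> T" "convex F" "compact F" "rel_interior F \<noteq> {}"
proof -
  show ne: "F \<noteq> {}" and "F \<subseteq> T" using assms(2) by (auto simp: facet_of_def dest: face_of_imp_subset)
  have f: "F face_of T" using assms(2) by (simp add: facet_of_def)
  show "convex F" using f face_of_imp_convex by blast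
  then show "rel_interior F \<noteq> {}" using ne rel_interior_eq_empty by blast
  show "compact F" using face_of_imp_compact[OF elt_convex elt_compact f] assms(1) by blast
qed

text \<open>Just behind the face, at \<open>x - t *\<^sub>R n\<close>, the interiors of both
  elements would overlap.\<close>

lemma outward_unique:
  assumes T: "T \<in> \<T>" "F facet_of T" "points_outward T F n" and T': "T' \<in> \<T>" "F facet_of T'" "points_outward T' F n"
    and n: "face_normal F n"
  shows "T = T'"
proof -
  obtain x where x: "x \<in> rel_interior F" using facet_props[OF T(1,2)] by blast
  have "\<forall>\<^sub>F t in at_right 0. x - t *\<^sub>R n \<in> interior T \<and> x - t *\<^sub>R n \<in> interior T'"
    using facet_interior_side[OF simplex[OF T(1)] T(2) n T(3) x]
      facet_interior_side[OF simplex[OF T'(1)] T'(2) n T'(3) x] by (rule eventually_conj)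
  then obtain t where "x - t *\<^sub>R n \<in> interior T" "x - t *\<^sub>R n \<in> interior T'"
    using eventually_happens' trivial_limit_at_right_real by blast
  then show ?thesis using elt_subset_eq[OF T(1) T'(1)] interior_subset by blast
qed

lemma not_outward_both:
  assumes "T \<in> \<T>" "F facet_of T" "points_outward T F n" "face_normal F n"
  shows "\<not> points_outward T F (- n)"
proof
  assume out': "points_outward T F (- n)"
  obtain x where x: "x \<in> rel_interior F" using facet_props[OF assms(1,2)] by blast
  then have xF: "x \<in> F" using rel_interior_subset by blast
  have "\<forall>\<^sub>F t in at_right 0. x - t *\<^sub>R n \<in> interior T \<and> 0 < t"
    by (rule eventually_conj[OF facet_interior_side[OF simplex[OF assms(1)] assms(2,4,3) x] eventually_at_right_less])
  then obtain t where t: "x - t *\<^sub>R n \<in> T" "0 < t"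
    using eventually_happens' trivial_limit_at_right_real interior_subset by blast
  have "- n \<bullet> (x - t *\<^sub>R n - x) \<le> 0" using out' xF t(1) unfolding points_outward_def by blast
  then show False using t(2) assms(4) by (simp add: face_normal_def dot_square_norm)
qed

text \<open>A face not contained in the frontier has a relative interior point in the open domain,
  and the points just beyond it must be covered by some element. That the mesh is conforming and a
  dimension count show that this element has the same face.\<close>

lemma other_side:
  assumes F: "F \<in> interior_faces \<Omega> \<T>" and T: "T \<in> \<T>" "F facet_of T" "points_outward T F n"
    and n: "face_normal F n"
  obtains T' where "T' \<in> \<T>" "F facet_of T'" "points_outward T' F (- n)"
proof -
  note Fp = facet_props[OF T(1,2)]
  have "\<not> F \<subseteq> frontier \<Omega>" using F by (auto simp: interior_faces_def boundary_faces_def)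
  then obtain x1 where x1: "x1 \<in> F" "x1 \<notin> frontier \<Omega>" by blast
  then have "x1 \<in> closure \<Omega>" using Fp(2) T(1) Union_mesh by blast
  then have "x1 \<in> \<Omega>" using x1(2) open_domain by (simp add: frontier_def interior_open)
  moreover have "x1 \<in> closure (rel_interior F)"
    using x1(1) convex_closure_rel_interior[OF Fp(3)] closure_subset by blast
  ultimately obtain x where x: "x \<in> rel_interior F" "x \<in> \<Omega>"
    using open_Int_closure_eq_empty[OF open_domain, of "rel_interior F"] by blast
  have xF: "x \<in> F" using x(1) rel_interior_subset by blast
  have lim: "((\<lambda>t. x + t *\<^sub>R n) \<longlongrightarrow> x + 0 *\<^sub>R n) (at_right 0)" by (intro tendsto_intros)
  have "\<forall>\<^sub>F t in at_right 0. x + t *\<^sub>R n \<in> \<Omega>"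
    using topological_tendstoD[OF lim open_domain] x(2) by simp
  then have ev: "\<forall>\<^sub>F t in at_right 0. \<exists>T'\<in>\<T>. x + t *\<^sub>R n \<in> T'"
    by eventually_elim (use Union_mesh closure_subset in blast)
  \<comment> \<open>Pigeonhole: the mesh is finite, so a single element contains points of the
    normal line arbitrarily close to the face; being closed, it also contains
    \<open>x\<close>.\<close>
  have "\<exists>T'\<in>\<T>. \<exists>\<^sub>F t in at_right 0. x + t *\<^sub>R n \<in> T'"
  proof (rule ccontr)
    assume "\<not> ?thesis"
    then have "\<forall>T'\<in>\<T>. \<forall>\<^sub>F t in at_right 0. x + t *\<^sub>R n \<notin> T'" by (simp add: frequently_def)
    then have "\<forall>\<^sub>F t in at_right 0. \<forall>T'\<in>\<T>. x + t *\<^sub>R n \<notin> T'"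
      using finite_mesh by (simp add: eventually_ball_finite_distrib)
    with ev have "\<forall>\<^sub>F t in at_right (0::real). False" by eventually_elim blast
    then show False by (simp add: eventually_False trivial_limit_at_right_real)
  qed
  then obtain T' where T': "T' \<in> \<T>" "\<exists>\<^sub>F t in at_right 0. x + t *\<^sub>R n \<in> T'" by blast
  have xT': "x \<in> T'"
  proof (rule ccontr)
    assume "x \<notin> T'"
    then have "\<forall>\<^sub>F t in at_right 0. x + t *\<^sub>R n \<in> - T'"
      using elt_closed[OF T'(1)] by (intro topological_tendstoD[OF lim]) auto
    then show False using T'(2) by (simp add: frequently_def)
  qed
  have "\<exists>\<^sub>F t in at_right 0. x + t *\<^sub>R n \<in> T' \<and> 0 < t"
    using T'(2) eventually_at_right_less[of "0::real"] by (rule frequently_rev_mp[OF _ eventually_mono]) auto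
  then obtain t where t: "x + t *\<^sub>R n \<in> T'" "0 < t" using frequently_ex by blast
  have pos: "0 < n \<bullet> (x + t *\<^sub>R n - x)" using t(2) n by (simp add: face_normal_def dot_square_norm)
  have not_out: "\<not> points_outward T' F n"
  proof
    assume "points_outward T' F n"
    then have "n \<bullet> (x + t *\<^sub>R n - x) \<le> 0" unfolding points_outward_def using xF t(1) by blast
    with pos show False by linarith
  qed
  then have "T' \<noteq> T" using T(3) by blast
  have face: "(T \<inter> T') face_of T" and face': "(T \<inter> T') face_of T'"
    using mesh_face[OF T(1) T'(1)] mesh_face[OF T'(1) T(1)] by (auto simp: Int_commute)
  have "T \<inter> T' \<noteq> T"
  proof
    assume "T \<inter> T' = T"
    then obtain z where "z \<in> interior T" "z \<in> T'"
      using simplex_interior_nonempty[OF simplex[OF T(1)]] interior_subset by blast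
    then show False using elt_subset_eq[OF T(1) T'(1)] \<open>T' \<noteq> T\<close> by blast
  qed
  then have dim: "aff_dim (T \<inter> T') < aff_dim T" using face_of_aff_dim_lt[OF elt_convex[OF T(1)] face] by blast
  \<comment> \<open>A face of \<open>T\<close> that meets the relative interior of \<open>F\<close>
    contains all of \<open>F\<close>.\<close>
  have sub: "F \<subseteq> T \<inter> T'"
    using subset_of_face_of[OF face Fp(2)] x(1) xT' xF Fp(2) by blast
  have FT: "F face_of T" and dimF: "aff_dim F = aff_dim T - 1" using T(2) by (auto simp: facet_of_def)
  have "F face_of (T \<inter> T')" using face_of_subset[OF FT sub] by blast
  \<comment> \<open>A proper face would have smaller dimension, but \<open>T \<inter> T'\<close> has
    at most the dimension of \<open>F\<close>.\<close>
  then have "F = T \<inter> T'"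
    using face_of_aff_dim_lt[of "T \<inter> T'" F] dim dimF convex_Int[OF elt_convex[OF T(1)] elt_convex[OF T'(1)]] by fastforce
  then have F': "F facet_of T'" using face' Fp(1) dimF
      simplex_full_aff_dim[OF simplex[OF T(1)]] simplex_full_aff_dim[OF simplex[OF T'(1)]]
    by (simp add: facet_of_def)
  have "points_outward T' F (- n)" using not_out facet_two_sides[OF simplex[OF T'(1)] F' n] by blast
  from that[OF T'(1) F' this] show ?thesis .
qed

text \<open>Existence comes from \<open>other_side\<close> and uniqueness from
  \<open>outward_unique\<close>; together they justify the definite descriptions behind
  \<open>plus_elt\<close> and \<open>minus_elt\<close>.\<close>

lemma interior_face_elts:
  assumes F: "F \<in> interior_faces \<Omega> \<T>"
  shows "plus_elt \<T> \<nu> F \<in> \<T>" "F facet_of plus_elt \<T> \<nu> F" "points_outward (plus_elt \<T> \<nu> F) F (\<nu> F)"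
    and "minus_elt \<T> \<nu> F \<in> \<T>" "F facet_of minus_elt \<T> \<nu> F" "points_outward (minus_elt \<T> \<nu> F) F (- \<nu> F)"
    and "{T\<in>\<T>. F facet_of T} = {plus_elt \<T> \<nu> F, minus_elt \<T> \<nu> F}" "plus_elt \<T> \<nu> F \<noteq> minus_elt \<T> \<nu> F"
proof -
  have Ff: "F \<in> faces \<T>" using F by (simp add: interior_faces_def)
  note n = face_normal[OF Ff]
  have n': "face_normal F (- \<nu> F)" using n by (simp add: face_normal_minus)
  obtain T where T: "T \<in> \<T>" "F facet_of T" using Ff by (auto simp: faces_def)
  obtain T1 T2 where T1: "T1 \<in> \<T>" "F facet_of T1" "points_outward T1 F (\<nu> F)"
    and T2: "T2 \<in> \<T>" "F facet_of T2" "points_outward T2 F (- \<nu> F)"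
  proof (cases "points_outward T F (\<nu> F)")
    case True
    from other_side[OF F T True n] that[OF T True] show ?thesis by metis
  next
    case False
    then have o: "points_outward T F (- \<nu> F)" using facet_two_sides[OF simplex[OF T(1)] T(2) n] by blast
    from other_side[OF F T o n'] obtain T' where "T' \<in> \<T>" "F facet_of T'" "points_outward T' F (\<nu> F)"
      unfolding minus_minus by metis
    from that[OF this T o] show ?thesis .
  qed
  have p: "plus_elt \<T> \<nu> F = T1" unfolding plus_elt_def
  proof (rule the_equality)
    fix T assume T: "T \<in> \<T> \<and> F facet_of T \<and> points_outward T F (\<nu> F)"
    show "T = T1" by (rule outward_unique[OF _ _ _ T1 n]) (use T in blast)+
  qed (use T1 in blast)
  have m: "minus_elt \<T> \<nu> F = T2" unfolding minus_elt_def
  proof (rule the_equality)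
    fix T assume T: "T \<in> \<T> \<and> F facet_of T \<and> points_outward T F (- \<nu> F)"
    show "T = T2" by (rule outward_unique[OF _ _ _ T2 n']) (use T in blast)+
  qed (use T2 in blast)
  show "plus_elt \<T> \<nu> F \<in> \<T>" "F facet_of plus_elt \<T> \<nu> F" "points_outward (plus_elt \<T> \<nu> F) F (\<nu> F)"
    "minus_elt \<T> \<nu> F \<in> \<T>" "F facet_of minus_elt \<T> \<nu> F" "points_outward (minus_elt \<T> \<nu> F) F (- \<nu> F)"
    using T1 T2 by (simp_all add: p m)
  show "{T\<in>\<T>. F facet_of T} = {plus_elt \<T> \<nu> F, minus_elt \<T> \<nu> F}"
    unfolding p m
  proof (intro equalityI subsetI)
    fix T assume T: "T \<in> {T\<in>\<T>. F facet_of T}"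
    then have T': "T \<in> \<T>" "F facet_of T" by auto
    from facet_two_sides[OF simplex[OF T'(1)] T'(2) n] show "T \<in> {T1, T2}"
      using outward_unique[OF T' _ T1 n] outward_unique[OF T' _ T2 n'] by blast
  qed (use T1 T2 in blast)
  show "plus_elt \<T> \<nu> F \<noteq> minus_elt \<T> \<nu> F"
    unfolding p m using not_outward_both[OF T1 n] T2(3) by blast
qed

end

section \<open>Calculus of continuously differentiable fields\<close>

abbreviation C1 :: "(real^'n::finite \<Rightarrow> 'b::real_normed_vector) \<Rightarrow> bool" where
  "C1 f \<equiv> Ck (Suc 0) f"

lemma C1_differentiable: "C1 f \<Longrightarrow> f differentiable at x"
  and C1_partial: "C1 f \<Longrightarrow> continuous_on S (partial j f)"
  by (auto intro: continuous_on_subset)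

lemma C1_continuous: "C1 f \<Longrightarrow> continuous_on S f"
  using C1_differentiable by (metis continuous_at_imp_continuous_on differentiable_imp_continuous_within)

lemma Ck_linear:
  assumes "bounded_linear h" shows "Ck m f \<Longrightarrow> Ck m (\<lambda>x. h (f x))"
proof (induction m arbitrary: f)
  case 0
  then show ?case using bounded_linear.continuous_on[OF assms] by simp
next
  case (Suc m)
  then have d: "f differentiable at x" for x by simp
  have "partial j (\<lambda>x. h (f x)) = (\<lambda>x. h (partial j f x))" for j
    using partial_linear[OF d assms] by auto
  moreover have "(\<lambda>x. h (f x)) differentiable at x" for x
    using bounded_linear.has_derivative[OF assms frechet_derivative_worksI[OF d]] unfolding differentiable_def by blast
  ultimately show ?case using Suc by simp
qed

lemma Ck_add: "Ck m f \<Longrightarrow> Ck m g \<Longrightarrow> Ck m (\<lambda>x. f x + g x)"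
proof (induction m arbitrary: f g)
  case 0 then show ?case by (simp add: continuous_on_add)
next
  case (Suc m)
  then have d: "f differentiable at x" "g differentiable at x" for x by simp_all
  have "partial j (\<lambda>x. f x + g x) = (\<lambda>x. partial j f x + partial j g x)" for j
    using partial_add[OF d] by auto
  then show ?case using Suc d by simp
qed

lemma Ck_sum:
  assumes "finite I" "I \<noteq> {}" "\<And>i. i \<in> I \<Longrightarrow> Ck m (f i)" shows "Ck m (\<lambda>x. \<Sum>i\<in>I. f i x)"
  using assms
proof (induction I rule: finite_ne_induct)
  case (singleton i) then show ?case by simp
next
  case (insert i I)
  then show ?case using Ck_add[of m "f i" "\<lambda>x. \<Sum>i\<in>I. f i x"] by simp
qed

lemma C1_component: "C1 f \<Longrightarrow> C1 (\<lambda>x. f x $ i)"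
  by (rule Ck_linear[OF bounded_linear_vec_nth])

lemma C1_polys: "p \<in> polys k \<Longrightarrow> C1 p"
  using polys_differentiable polys_continuous[OF polys_partial] by auto

lemma C1_mult:
  fixes f g :: "real^'n \<Rightarrow> real"
  assumes "C1 f" "C1 g" shows "C1 (\<lambda>x. f x * g x)"
proof -
  note d = C1_differentiable[OF assms(1)] C1_differentiable[OF assms(2)]
  have "partial j (\<lambda>x. f x * g x) = (\<lambda>x. f x * partial j g x + partial j f x * g x)" for j
    using partial_mult[OF d] by auto
  then show ?thesis
    using d C1_partial[OF assms(1)] C1_partial[OF assms(2)] C1_continuous[OF assms(1)] C1_continuous[OF assms(2)]
    by (auto intro!: continuous_intros)
qed

lemma partial_sum:
  assumes "\<And>i. i \<in> I \<Longrightarrow> f i differentiable at x"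
  shows "partial j (\<lambda>x. \<Sum>i\<in>I. f i x) x = (\<Sum>i\<in>I. partial j (f i) x)"
  using partial_eqI[OF has_derivative_sum[of I f, OF frechet_derivative_worksI[OF assms]]]
  by (simp add: partial_def)

definition grad :: "(real^'n::finite \<Rightarrow> real) \<Rightarrow> real^'n \<Rightarrow> real^'n" where
  "grad f x = (\<chi> j. partial j f x)"

lemma vdiv_scaleR:
  assumes "C1 f" "C1 P"
  shows "vdiv (\<lambda>x. f x *\<^sub>R P x) x = f x * vdiv P x + grad f x \<bullet> P x"
  using C1_differentiable[OF assms(1)] C1_differentiable[OF C1_component[OF assms(2)]]
  by (simp add: vdiv_def partial_mult grad_def inner_vec_def sum.distrib sum_distrib_left)

lemma continuous_on_vec_lambda: "(\<And>i. continuous_on S (\<lambda>x. f x $ i)) \<Longrightarrow> continuous_on S f"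
  for f :: "'a::topological_space \<Rightarrow> 'b::topological_space^'n"
  using continuous_on_vec_lambda[of S "\<lambda>i x. f x $ i"] by simp

lemma continuous_grad: "C1 f \<Longrightarrow> continuous_on S (grad f)"
  by (rule continuous_on_vec_lambda) (simp add: grad_def C1_partial del: Ck.simps)

lemma continuous_vdiv: "C1 w \<Longrightarrow> continuous_on S (vdiv w)"
  unfolding vdiv_def[abs_def] by (intro continuous_on_sum C1_partial C1_component)

lemma polys_grad: "p \<in> polys k \<Longrightarrow> grad p \<in> polys (k - 1)"
  by (rule polys_componentwise) (simp add: grad_def polys_partial)

text \<open>\<open>frechet_derivative\<close> is a choice over \<open>has_derivative\<close>, and
  the latter is a local property. It transfers derivatives from the stress to its polynomial on the
  interior of an element.\<close>

lemma partial_cong_open: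
  assumes "open S" "x \<in> S" "\<And>y. y \<in> S \<Longrightarrow> f y = g y"
  shows "partial j f x = partial j g x"
proof -
  have "(f has_derivative f') (at x) \<longleftrightarrow> (g has_derivative f') (at x)" for f'
    using has_derivative_transform_within_open[of f f' x UNIV S g]
      has_derivative_transform_within_open[of g f' x UNIV S f] assms by auto
  then show ?thesis by (simp add: partial_def frechet_derivative_def)
qed

lemma integrable_indicator_compact:
  fixes q :: "'a::euclidean_space \<Rightarrow> real"
  assumes "compact T" "continuous_on UNIV q"
  shows "integrable lborel (\<lambda>x. indicator (interior T) x * q x)"
proof -
  have [measurable]: "q \<in> borel_measurable borel" "interior T \<in> sets borel"
    using assms by (auto intro: borel_measurable_continuous_onI)
  have "integrable lborel (\<lambda>x. indicator T x *\<^sub>R q x)"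
    using assms by (intro borel_integrable_compact) (auto intro: continuous_on_subset)
  then show ?thesis
    by (rule Bochner_Integration.integrable_bound) (use interior_subset in \<open>auto simp: indicator_def\<close>)
qed

lemma integrable_hull_lebesgue:
  fixes T :: "'a::euclidean_space set" and f :: "'a \<Rightarrow> real"
  assumes T: "int DIM('a) simplex T" and F: "F facet_of T" "compact F" and f: "continuous_on UNIV f"
  shows "set_integrable (hull_lebesgue F) F f"
proof -
  obtain C g b where bary: "barycentric C g b" and TC: "T = convex hull C"
    and indep: "\<not> affine_dependent C" and card: "card C = DIM('a) + 1"
    using simplex_barycentric[OF T] by blast
  obtain c where c: "c \<in> C" and Fc: "F = convex hull (C - {c})"
    using F simplex_facet_iff[OF indep card] TC by blast
  interpret hyperplane_set F "g c /\<^sub>R norm (g c)"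
    unfolding Fc by (rule facet_hyperplane_set(1)[OF bary card c])
  have [measurable]: "f \<in> borel_measurable borel" "F \<in> sets borel"
    using f F(2) by (auto intro: borel_measurable_continuous_onI borel_closed compact_imp_closed)
  obtain R where R: "F \<subseteq> cball 0 R"
    using compact_imp_bounded[OF F(2)] by (metis bounded_iff mem_cball_0 subsetI)
  have "emeasure (hull_lebesgue F) F \<le> emeasure (hull_lebesgue F) (cball 0 R)"
    by (rule emeasure_mono[OF R]) simp
  also have "\<dots> < \<infinity>" by (rule emeasure_bounded)
  finally have fin: "emeasure (hull_lebesgue F) F < \<infinity>" .
  have "compact (f ` F)" using f F(2) by (intro compact_continuous_image) (auto intro: continuous_on_subset)
  from compact_imp_bounded[OF this] obtain M where M: "\<And>x. x \<in> F \<Longrightarrow> \<bar>f x\<bar> \<le> M"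
    by (auto simp: bounded_real)
  have "integrable (hull_lebesgue F) (\<lambda>x. M * indicator F x)"
    using fin by (intro integrable_mult_right) (auto simp: integrable_indicator_iff)
  then have "integrable (hull_lebesgue F) (\<lambda>x. indicator F x *\<^sub>R f x)"
    by (rule Bochner_Integration.integrable_bound) (use M in \<open>force simp: indicator_def\<close>)+
  then show ?thesis by (simp add: set_integrable_def)
qed

text \<open>A simplex is the closure of its interior, so each of its points is a limit point of the
  interior. The limit in \<open>elt_trace\<close> is then unique and equals the value of the
  continuous extension.\<close>

lemma elt_trace_eq:
  fixes T :: "'a::euclidean_space set"
  assumes T: "int DIM('a) simplex T" and x: "x \<in> T" and v: "\<And>y. y \<in> interior T \<Longrightarrow> v y = p y"
    and p: "continuous_on UNIV p"
  shows "elt_trace T v x = p x"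
proof -
  have "x islimpt interior T"
  proof (cases "x \<in> interior T")
    case True then show ?thesis using interior_limit_point[of x "interior T"] by simp
  next
    case False then show ?thesis using x simplex_closure_interior[OF T] by (metis Un_iff closure_def mem_Collect_eq)
  qed
  then have nt: "at x within interior T \<noteq> bot" by (simp add: trivial_limit_within)
  have "(p \<longlongrightarrow> p x) (at x within interior T)"
    using p by (metis continuous_on_def UNIV_I tendsto_within_subset subset_UNIV)
  then have "(v \<longlongrightarrow> p x) (at x within interior T)"
    by (rule Lim_transform_eventually) (use v in \<open>auto simp: eventually_at_filter\<close>)
  then show ?thesis unfolding elt_trace_def by (rule tendsto_Lim[OF nt])
qed

section \<open>The divergence theorem on the mesh\<close>

locale vec_mesh = mesh \<Omega> \<T> \<nu> for \<Omega> :: "(real^'n) set" and \<T> :: "(real^'n) set set" and \<nu> :: "(real^'n) set \<Rightarrow> real^'n"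
begin

abbreviation "pos_elt \<equiv> plus_elt \<T> \<nu>"
abbreviation "neg_elt \<equiv> minus_elt \<T> \<nu>"

lemma integral_elt_cong:
  fixes f q :: "real^'n \<Rightarrow> real"
  assumes "T \<in> \<T>" "continuous_on UNIV q" "\<And>x. x \<in> interior T \<Longrightarrow> f x = q x"
  shows "(LINT x|lebesgue_on T. f x) = (LINT x|lebesgue_on T. q x)"
  using integral_lebesgue_on_eq_interior[OF elt_convex elt_closed borel_measurable_continuous_onI[OF assms(2)], of T] assms(1,3)
  by auto

lemma integral_elt:
  fixes q :: "real^'n \<Rightarrow> real"
  assumes "T \<in> \<T>" "continuous_on UNIV q"
  shows "(LINT x|lebesgue_on T. q x) = (LINT x|lborel. indicator (interior T) x * q x)"
  using integral_lebesgue_on_eq_interior[OF elt_convex elt_closed borel_measurable_continuous_onI[OF assms(2)], of T q] assms(1)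
  by auto

lemma integrable_elt:
  fixes q :: "real^'n \<Rightarrow> real"
  assumes "T \<in> \<T>" "continuous_on UNIV q"
  shows "integrable (lebesgue_on T) q"
proof -
  have T: "compact T" "T \<in> sets lebesgue" using elt_compact[OF assms(1)] elt_closed[OF assms(1)] by auto
  have "integrable lborel (\<lambda>x. indicator T x *\<^sub>R q x)"
    using assms T by (intro borel_integrable_compact) (auto intro: continuous_on_subset)
  then have "integrable lebesgue (\<lambda>x. indicator T x *\<^sub>R q x)"
    by (subst integrable_completion) auto
  then show ?thesis using T by (subst integrable_restrict_space) auto
qed

definition outer :: "(real^'n) set \<Rightarrow> (real^'n) set \<Rightarrow> real^'n" where
  "outer T F = (if points_outward T F (\<nu> F) then \<nu> F else - \<nu> F)"

lemma divergence_elt: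
  assumes T: "T \<in> \<T>" and w: "C1 w"
  shows "(LINT x|lebesgue_on T. vdiv w x) = (\<Sum>F | F facet_of T. LINT x:F|hull_lebesgue F. outer T F \<bullet> w x)"
proof -
  have fn: "face_normal F (outer T F)" if "F facet_of T" for F
    using face_normal[OF facesI[OF T that]] by (simp add: outer_def face_normal_minus)
  have out: "points_outward T F (outer T F)" if "F facet_of T" for F
    using facet_two_sides[OF simplex[OF T] that face_normal[OF facesI[OF T that]]] by (auto simp: outer_def)
  have comp: "(LINT x|lebesgue_on T. partial j (\<lambda>y. w y $ j) x) =
      (\<Sum>F | F facet_of T. outer T F $ j * (LINT x:F|hull_lebesgue F. w x $ j))" for j
    using divergence_simplex[OF simplex[OF T], of "\<lambda>y. w y $ j" j "outer T"]
      C1_differentiable[OF C1_component[OF w]] C1_partial[OF C1_component[OF w]] fn out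
    by (auto simp: face_normal_def)
  have "(LINT x|lebesgue_on T. vdiv w x) = (\<Sum>j\<in>UNIV. LINT x|lebesgue_on T. partial j (\<lambda>y. w y $ j) x)"
    unfolding vdiv_def by (rule Bochner_Integration.integral_sum) (intro integrable_elt T C1_partial C1_component w)
  also have "\<dots> = (\<Sum>F | F facet_of T. \<Sum>j\<in>UNIV. outer T F $ j * (LINT x:F|hull_lebesgue F. w x $ j))"
    unfolding comp by (rule sum.swap)
  also have "\<dots> = (\<Sum>F | F facet_of T. LINT x:F|hull_lebesgue F. outer T F \<bullet> w x)"
  proof (rule sum.cong[OF refl])
    fix F assume "F \<in> {F. F facet_of T}"
    then have F: "F facet_of T" by simp
    have i: "set_integrable (hull_lebesgue F) F (\<lambda>x. w x $ j)" for j
      using integrable_hull_lebesgue[OF simplex[OF T] F facet_props(4)[OF T F]] C1_continuous[OF C1_component[OF w]] by blast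
    have "(LINT x:F|hull_lebesgue F. outer T F \<bullet> w x) = (\<Sum>j\<in>UNIV. LINT x:F|hull_lebesgue F. outer T F $ j * w x $ j)"
      unfolding set_lebesgue_integral_def inner_vec_def
      using set_integrable_mult_right[OF i]
      by (subst Bochner_Integration.integral_sum[symmetric]) (simp_all add: set_integrable_def sum_distrib_left)
    then show "(\<Sum>j\<in>UNIV. outer T F $ j * (LINT x:F|hull_lebesgue F. w x $ j)) = (LINT x:F|hull_lebesgue F. outer T F \<bullet> w x)"
      by simp
  qed
  finally show ?thesis .
qed

text \<open>Exchanging the sums over elements and faces collects two contributions with opposite
  normals at each interior face. Each element carries its own field, since the products with
  multiplier or stress are discontinuous.\<close>

theorem mesh_divergence:
  assumes w: "\<And>T. T \<in> \<T> \<Longrightarrow> C1 (w T)"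
    and bd: "\<And>F T x. F \<in> boundary_faces \<Omega> \<T> \<Longrightarrow> T \<in> \<T> \<Longrightarrow> F facet_of T \<Longrightarrow> x \<in> F \<Longrightarrow> \<nu> F \<bullet> w T x = 0"
  shows "(\<Sum>T\<in>\<T>. LINT x|lebesgue_on T. vdiv (w T) x) =
    (\<Sum>F\<in>interior_faces \<Omega> \<T>. LINT x:F|hull_lebesgue F. \<nu> F \<bullet> (w (pos_elt F) x - w (neg_elt F) x))"
proof -
  let ?I = "\<lambda>T F. LINT x:F|hull_lebesgue F. outer T F \<bullet> w T x"
  have "(\<Sum>T\<in>\<T>. LINT x|lebesgue_on T. vdiv (w T) x) = (\<Sum>T\<in>\<T>. \<Sum>F | F \<in> faces \<T> \<and> F facet_of T. ?I T F)"
  proof (rule sum.cong[OF refl])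
    fix T assume T: "T \<in> \<T>"
    then have "{F. F \<in> faces \<T> \<and> F facet_of T} = {F. F facet_of T}" using facesI by blast
    then show "(LINT x|lebesgue_on T. vdiv (w T) x) = (\<Sum>F | F \<in> faces \<T> \<and> F facet_of T. ?I T F)"
      using divergence_elt[OF T w[OF T]] by (simp only:)
  qed
  also have "\<dots> = (\<Sum>F\<in>faces \<T>. \<Sum>T | T \<in> \<T> \<and> F facet_of T. ?I T F)"
    by (rule sum.swap_restrict[OF finite_mesh finite_faces])
  also have "\<dots> = (\<Sum>F\<in>interior_faces \<Omega> \<T>. \<Sum>T | T \<in> \<T> \<and> F facet_of T. ?I T F)"
  proof (rule sum.mono_neutral_right[OF finite_faces])
    show "interior_faces \<Omega> \<T> \<subseteq> faces \<T>" by (auto simp: interior_faces_def)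
    show "\<forall>F\<in>faces \<T> - interior_faces \<Omega> \<T>. (\<Sum>T | T \<in> \<T> \<and> F facet_of T. ?I T F) = 0"
    proof
      fix F assume "F \<in> faces \<T> - interior_faces \<Omega> \<T>"
      then have F: "F \<in> boundary_faces \<Omega> \<T>" by (auto simp: interior_faces_def)
      have "?I T F = 0" if T: "T \<in> \<T>" "F facet_of T" for T
      proof -
        have "?I T F = (LINT x:F|hull_lebesgue F. (0::real))"
          unfolding set_lebesgue_integral_def
          by (rule Bochner_Integration.integral_cong[OF refl])
            (use bd[OF F T] in \<open>auto simp: outer_def indicator_def\<close>)
        then show ?thesis by (simp add: set_lebesgue_integral_def)
      qed
      then show "(\<Sum>T | T \<in> \<T> \<and> F facet_of T. ?I T F) = 0" by (intro sum.neutral) auto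
    qed
  qed
  also have "\<dots> = (\<Sum>F\<in>interior_faces \<Omega> \<T>. LINT x:F|hull_lebesgue F. \<nu> F \<bullet> (w (pos_elt F) x - w (neg_elt F) x))"
  proof (rule sum.cong[OF refl])
    fix F assume F: "F \<in> interior_faces \<Omega> \<T>"
    note E = interior_face_elts[OF F]
    have n: "face_normal F (\<nu> F)" using F by (intro face_normal) (simp add: interior_faces_def)
    have "\<not> points_outward (neg_elt F) F (\<nu> F)"
      using not_outward_both[OF E(4-6)] n by (simp add: face_normal_minus)
    then have o: "outer (pos_elt F) F = \<nu> F" "outer (neg_elt F) F = - \<nu> F" using E(3) by (auto simp: outer_def)
    have i: "set_integrable (hull_lebesgue F) F (\<lambda>x. \<nu> F \<bullet> w T x)" if "T \<in> \<T>" "F facet_of T" for T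
      by (rule integrable_hull_lebesgue[OF simplex[OF that(1)] that(2) facet_props(4)[OF that]])
        (intro continuous_intros C1_continuous w that)
    have "(\<Sum>T | T \<in> \<T> \<and> F facet_of T. ?I T F) = ?I (pos_elt F) F + ?I (neg_elt F) F"
      using E(7,8) by simp
    also have "\<dots> = (LINT x:F|hull_lebesgue F. \<nu> F \<bullet> w (pos_elt F) x) - (LINT x:F|hull_lebesgue F. \<nu> F \<bullet> w (neg_elt F) x)"
      unfolding o by (simp add: set_lebesgue_integral_def)
    also have "\<dots> = (LINT x:F|hull_lebesgue F. \<nu> F \<bullet> w (pos_elt F) x - \<nu> F \<bullet> w (neg_elt F) x)"
      by (rule set_integral_diff(2)[symmetric]) (use i E in auto)
    finally show "(\<Sum>T | T \<in> \<T> \<and> F facet_of T. ?I T F) = (LINT x:F|hull_lebesgue F. \<nu> F \<bullet> (w (pos_elt F) x - w (neg_elt F) x))"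
      by (simp add: inner_diff_right)
  qed
  finally show ?thesis .
qed

lemma sum_indicator_interior:
  fixes f :: "(real^'n) set \<Rightarrow> 'b::real_vector"
  assumes "T \<in> \<T>" "x \<in> interior T"
  shows "(\<Sum>T'\<in>\<T>. indicator (interior T') x *\<^sub>R f T') = f T"
proof -
  have "(\<Sum>T'\<in>\<T>. indicator (interior T') x *\<^sub>R f T') = (\<Sum>T'\<in>\<T>. if T' = T then f T else 0)"
  proof (rule sum.cong[OF refl])
    fix T' assume T': "T' \<in> \<T>"
    have "x \<in> interior T' \<longleftrightarrow> T' = T"
      using assms elt_subset_eq[OF assms(1) T' assms(2) subsetD[OF interior_subset]] by blast
    then show "indicator (interior T') x *\<^sub>R f T' = (if T' = T then f T else 0)" by auto
  qed
  then show ?thesis using assms(1) finite_mesh by simp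
qed

lemma AE_indicator_domain: "AE x in lebesgue. indicator \<Omega> x = (\<Sum>T\<in>\<T>. indicator (interior T) x :: real)"
proof -
  have "negligible (\<Union>T\<in>\<T>. frontier T)"
    using finite_mesh elt_convex by (auto intro!: negligible_Union negligible_convex_frontier)
  then have "AE x in lebesgue. x \<notin> (\<Union>T\<in>\<T>. frontier T)"
    unfolding negligible_iff_null_sets by (rule AE_not_in)
  then show ?thesis
  proof eventually_elim
    case (elim x)
    show ?case
    proof (cases "\<exists>T\<in>\<T>. x \<in> interior T")
      case True
      then obtain T where T: "T \<in> \<T>" "x \<in> interior T" by blast
      then have "x \<in> \<Omega>" using elt_interior_subset by blast
      moreover have "(\<Sum>T'\<in>\<T>. indicator (interior T') x) = (1::real)"
        using sum_indicator_interior[OF T, of "\<lambda>_. 1 :: real"] by simp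
      ultimately show ?thesis by simp
    next
      case False
      have "x \<notin> \<Omega>"
      proof
        assume "x \<in> \<Omega>"
        then obtain T where "T \<in> \<T>" "x \<in> T" using Union_mesh closure_subset by blast
        then show False using False elim elt_closed by (auto simp: frontier_def)
      qed
      then show ?thesis using False by (simp add: indicator_def)
    qed
  qed
qed

lemma domain_sets [measurable]: "\<Omega> \<in> sets lebesgue" "\<Omega> \<in> sets borel"
  using open_domain by auto

text \<open>Up to the frontiers of the elements, a null set, the domain is the disjoint union of
  their interiors.\<close>

lemma integral_domain:
  fixes f :: "real^'n \<Rightarrow> real"
  assumes f: "\<And>T x. T \<in> \<T> \<Longrightarrow> x \<in> interior T \<Longrightarrow> f x = q T x" and q: "\<And>T. T \<in> \<T> \<Longrightarrow> continuous_on UNIV (q T)"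
  shows "integrable (lebesgue_on \<Omega>) f" and "(LINT x|lebesgue_on \<Omega>. f x) = (\<Sum>T\<in>\<T>. LINT x|lebesgue_on T. q T x)"
proof -
  let ?s = "\<lambda>x. \<Sum>T\<in>\<T>. indicator (interior T) x * q T x"
  have i: "integrable lborel (\<lambda>x. indicator (interior T) x * q T x)" if "T \<in> \<T>" for T
    using integrable_indicator_compact[OF elt_compact[OF that] q[OF that]] .
  have ils: "integrable lborel ?s" using i by (intro Bochner_Integration.integrable_sum) auto
  then have isl: "integrable lebesgue ?s" by (subst integrable_completion) auto
  have AE: "AE x in lebesgue. ?s x = indicator \<Omega> x *\<^sub>R f x"
    using AE_indicator_domain
  proof eventually_elim
    case (elim x)
    have "?s x = (\<Sum>T\<in>\<T>. indicator (interior T) x * f x)"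
      using f by (intro sum.cong) (auto simp: indicator_def)
    also have "\<dots> = indicator \<Omega> x *\<^sub>R f x" by (simp add: elim sum_distrib_right)
    finally show ?case .
  qed
  have ms: "?s \<in> borel_measurable lebesgue" using isl by auto
  note mf = borel_measurable_AE[OF ms AE]
  have "integrable lebesgue (\<lambda>x. indicator \<Omega> x *\<^sub>R f x)"
    using isl integrable_cong_AE[OF ms mf AE] by simp
  then show "integrable (lebesgue_on \<Omega>) f" by (subst integrable_restrict_space) auto
  have "(LINT x|lebesgue_on \<Omega>. f x) = (LINT x|lebesgue. indicator \<Omega> x *\<^sub>R f x)"
    by (rule integral_restrict_space) simp
  also have "\<dots> = (LINT x|lebesgue. ?s x)" by (rule integral_cong_AE[OF mf ms]) (use AE in auto)
  also have "\<dots> = (LINT x|lborel. ?s x)" using ils by (intro integral_completion) auto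
  also have "\<dots> = (\<Sum>T\<in>\<T>. LINT x|lborel. indicator (interior T) x * q T x)"
    using i by (intro Bochner_Integration.integral_sum) auto
  also have "\<dots> = (\<Sum>T\<in>\<T>. LINT x|lebesgue_on T. q T x)"
    using q by (intro sum.cong) (auto simp: integral_elt)
  finally show "(LINT x|lebesgue_on \<Omega>. f x) = (\<Sum>T\<in>\<T>. LINT x|lebesgue_on T. q T x)" .
qed

end

section \<open>Raviart--Thomas fields\<close>

text \<open>A functional that vanishes on the common kernel of finitely many others is a combination
  of them. The operation \<open>comb\<close> stands for \<open>u + c v\<close>, so that a set of
  piecewise fields can play the vector space without a type of its own.\<close>

lemma functional_in_span:
  fixes comb :: "'v \<Rightarrow> real \<Rightarrow> 'v \<Rightarrow> 'v" and g :: "'i \<Rightarrow> 'v \<Rightarrow> real"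
  assumes "finite I" and V: "\<And>u v c. u \<in> V \<Longrightarrow> v \<in> V \<Longrightarrow> comb u c v \<in> V"
    and g: "\<And>i u v c. i \<in> I \<Longrightarrow> u \<in> V \<Longrightarrow> v \<in> V \<Longrightarrow> g i (comb u c v) = g i u + c * g i v"
    and A: "\<And>u v c. u \<in> V \<Longrightarrow> v \<in> V \<Longrightarrow> A (comb u c v) = A u + c * A v"
    and ker: "\<And>v. v \<in> V \<Longrightarrow> (\<And>i. i \<in> I \<Longrightarrow> g i v = 0) \<Longrightarrow> A v = 0"
  shows "\<exists>a. \<forall>v\<in>V. A v = (\<Sum>i\<in>I. a i * g i v)"
  using assms(1) g A ker
proof (induction I arbitrary: A rule: finite_induct)
  case empty then show ?case by auto
next
  case (insert i I)
  show ?case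
  proof (cases "\<forall>v\<in>V. (\<forall>j\<in>I. g j v = 0) \<longrightarrow> A v = 0")
    case True
    have "\<exists>a. \<forall>v\<in>V. A v = (\<Sum>i\<in>I. a i * g i v)"
      by (rule insert.IH) (use insert.prems True in auto)
    then obtain a where a: "\<forall>v\<in>V. A v = (\<Sum>i\<in>I. a i * g i v)" by blast
    have "(\<Sum>j\<in>insert i I. (a(i := 0)) j * g j v) = (\<Sum>j\<in>I. a j * g j v)" for v
    proof -
      have "(\<Sum>j\<in>I. (a(i := 0)) j * g j v) = (\<Sum>j\<in>I. a j * g j v)"
        using insert.hyps by (intro sum.cong) auto
      then show ?thesis using insert.hyps by simp
    qed
    then show ?thesis using a by metis
  next
    case False
    then obtain v0 where v0: "v0 \<in> V" "\<forall>j\<in>I. g j v0 = 0" "A v0 \<noteq> 0" by blast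
    have gi: "g i v0 \<noteq> 0"
    proof
      assume "g i v0 = 0"
      then have "A v0 = 0" using insert.prems(3)[OF v0(1)] v0(2) by auto
      with v0(3) show False by simp
    qed
    \<comment> \<open>With this \<open>q\<close> the functional \<open>A - q * g i\<close> vanishes
      at \<open>v0\<close>, which makes the induction hypothesis applicable to it.\<close>
    define q where "q = A v0 / g i v0"
    have "\<exists>a. \<forall>v\<in>V. A v - q * g i v = (\<Sum>i\<in>I. a i * g i v)"
    proof (rule insert.IH)
      fix j u v c assume "j \<in> I" "u \<in> V" "v \<in> V"
      then show "g j (comb u c v) = g j u + c * g j v" using insert.prems(1) by auto
    next
      fix u v c assume "u \<in> V" "v \<in> V"
      then show "A (comb u c v) - q * g i (comb u c v) = A u - q * g i u + c * (A v - q * g i v)"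
        using insert.prems(1)[of i u v c] insert.prems(2)[of u v c] by (simp add: algebra_simps)
    next
      fix v assume v: "v \<in> V" "\<And>j. j \<in> I \<Longrightarrow> g j v = 0"
      \<comment> \<open>The projection of \<open>v\<close> along \<open>v0\<close> into the kernel
        of \<open>g i\<close>; it stays in the kernels of the other functionals because
        \<open>v0\<close> lies in them.\<close>
      let ?u = "comb v (- (g i v / g i v0)) v0"
      have "g j ?u = 0" if "j \<in> insert i I" for j
        using insert.prems(1)[OF that v(1) v0(1)] that v(2) v0(2) gi by auto
      then have "A ?u = 0" by (rule insert.prems(3)[OF V[OF v(1) v0(1)]])
      then show "A v - q * g i v = 0" using insert.prems(2)[OF v(1) v0(1)] by (simp add: q_def)
    qed
    then obtain a where a: "\<forall>v\<in>V. A v - q * g i v = (\<Sum>i\<in>I. a i * g i v)" by blast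
    have "A v = (\<Sum>j\<in>insert i I. (a(i := q)) j * g j v)" if "v \<in> V" for v
    proof -
      have "(\<Sum>j\<in>I. (a(i := q)) j * g j v) = (\<Sum>j\<in>I. a j * g j v)"
        using insert.hyps by (intro sum.cong) auto
      then show ?thesis using insert.hyps a that by (auto simp: algebra_simps)
    qed
    then show ?thesis by blast
  qed
qed

text \<open>
  Applies the covariance matrix \<open>\<Sum>c. \<lambda>\<^sub>c c c\<^sup>T - x x\<^sup>T\<close> of the barycentric weights \<open>\<lambda>\<^sub>c\<close> of
  \<open>x\<close> to \<open>r\<close>. It is positive definite inside the simplex, and its image is tangential on each facet.
\<close>

definition bubble :: "(real^'n) set \<Rightarrow> (real^'n \<Rightarrow> real^'n) \<Rightarrow> (real^'n \<Rightarrow> real) \<Rightarrow> (real^'n \<Rightarrow> real^'n) \<Rightarrow> real^'n \<Rightarrow> real^'n" where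
  "bubble C g b r x = (\<Sum>c\<in>C. (- ((g c \<bullet> x + b c) * (r x \<bullet> c))) *\<^sub>R (x - c))"

text \<open>The covariance matrix is quadratic in \<open>x\<close>, so its product with
  \<open>r\<close> has degree \<open>k + 1\<close>. In the form of a sum of radial fields with
  coefficients of degree \<open>k\<close>, \<open>RT_radial\<close> applies.\<close>

lemma bubble_RT:
  assumes "r \<in> polys (k - 1)" shows "bubble C g b r \<in> RT k"
  unfolding bubble_def[abs_def]
proof (intro RT_sum RT_radial)
  fix c
  have "(\<lambda>x. r x \<bullet> c) \<in> polys (k - 1)"
    by (rule polys_linear[OF assms]) (simp add: linear_iff inner_add_left)
  from polys_linear[OF polys_mult[OF affine_in_polys this], of uminus "g c" "b c"]
  show "(\<lambda>x. - ((g c \<bullet> x + b c) * (r x \<bullet> c))) \<in> polys k" by (simp add: linear_iff)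
qed

text \<open>On the facet opposite \<open>c'\<close> the summand of \<open>c'\<close> vanishes with
  its coordinate, and in every other summand \<open>x - c\<close> joins two points of the
  facet.\<close>

lemma bubble_tangential:
  assumes bary: "barycentric C g b" and c': "c' \<in> C" and x: "x \<in> convex hull (C - {c'})"
    and n: "face_normal (convex hull (C - {c'})) n"
  shows "n \<bullet> bubble C g b r x = 0"
proof -
  have "(- ((g c \<bullet> x + b c) * (r x \<bullet> c))) * (n \<bullet> (x - c)) = 0" if c: "c \<in> C" for c
  proof (cases "c = c'")
    case True
    then show ?thesis using x convex_hull_bary_facet[OF bary c'] by auto
  next
    case False
    then have "c \<in> convex hull (C - {c'})" using c by (simp add: hull_inc)
    then have "n \<bullet> (x - c) = 0" using n x by (auto simp: face_normal_def)
    then show ?thesis by simp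
  qed
  then show ?thesis unfolding bubble_def inner_sum_right inner_scaleR_right by (intro sum.neutral) auto
qed

lemma bary_inner:
  assumes bary: "barycentric C g b"
  shows "u \<bullet> x = (\<Sum>c\<in>C. (g c \<bullet> x + b c) * (u \<bullet> c))"
proof -
  have "u \<bullet> x = u \<bullet> (\<Sum>c\<in>C. (g c \<bullet> x + b c) *\<^sub>R c)" by (simp only: bary_repr[OF bary])
  then show ?thesis by (simp add: inner_sum_right)
qed

text \<open>The quadratic form of a covariance matrix is a variance, here that of the values
  \<open>r x \<bullet> c\<close> under the barycentric weights, whose mean is
  \<open>r x \<bullet> x\<close>.\<close>

lemma bubble_inner:
  assumes bary: "barycentric C g b"
  shows "r x \<bullet> bubble C g b r x = (\<Sum>c\<in>C. (g c \<bullet> x + b c) * (r x \<bullet> c - r x \<bullet> x)\<^sup>2)"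
proof -
  have mean: "r x \<bullet> x = (\<Sum>c\<in>C. (g c \<bullet> x + b c) * (r x \<bullet> c))"
    by (rule bary_inner[OF bary])
  define \<mu> where "\<mu> = r x \<bullet> x"
  have "(\<Sum>c\<in>C. (g c \<bullet> x + b c) * (r x \<bullet> c - \<mu>)\<^sup>2) =
      (\<Sum>c\<in>C. (g c \<bullet> x + b c) * (r x \<bullet> c) * (r x \<bullet> c - \<mu>)) - \<mu> * ((\<Sum>c\<in>C. (g c \<bullet> x + b c) * (r x \<bullet> c)) - (\<Sum>c\<in>C. g c \<bullet> x + b c) * \<mu>)"
    unfolding sum_distrib_left sum_distrib_right sum_subtractf[symmetric]
    by (intro sum.cong refl) (simp add: power2_eq_square algebra_simps)
  also have "\<dots> = (\<Sum>c\<in>C. (g c \<bullet> x + b c) * (r x \<bullet> c) * (r x \<bullet> c - \<mu>))"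
    unfolding mean[symmetric] bary_sum[OF bary] \<mu>_def by simp
  also have "\<dots> = r x \<bullet> bubble C g b r x"
    unfolding bubble_def inner_sum_right inner_scaleR_right \<mu>_def
    by (intro sum.cong refl) (simp add: inner_diff_right algebra_simps)
  finally show ?thesis by (simp add: \<mu>_def)
qed

lemma bubble_inner_nonneg:
  assumes bary: "barycentric C g b" and x: "x \<in> convex hull C"
  shows "0 \<le> r x \<bullet> bubble C g b r x"
  unfolding bubble_inner[OF bary] using x convex_hull_bary[OF bary] by (auto intro!: sum_nonneg mult_nonneg_nonneg)

text \<open>With positive weights a zero variance makes \<open>r x \<bullet> c\<close> the same at
  all vertices. The linear form is then constant on the whole space, so it is zero.\<close>

lemma bubble_inner_eq_0:
  assumes bary: "barycentric C g b" and pos: "\<And>c. c \<in> C \<Longrightarrow> 0 < g c \<bullet> x + b c"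
    and zero: "r x \<bullet> bubble C g b r x = 0"
  shows "r x = 0"
proof -
  have nonneg: "0 \<le> (g c \<bullet> x + b c) * (r x \<bullet> c - r x \<bullet> x)\<^sup>2" if "c \<in> C" for c
    using pos[OF that] by simp
  have "\<forall>c\<in>C. (g c \<bullet> x + b c) * (r x \<bullet> c - r x \<bullet> x)\<^sup>2 = 0"
    using zero unfolding bubble_inner[OF bary]
    by (subst (asm) sum_nonneg_eq_0_iff) (use bary_finite[OF bary] nonneg in auto)
  then have c: "r x \<bullet> c = r x \<bullet> x" if "c \<in> C" for c using pos[OF that] that by fastforce
  have const: "r x \<bullet> z = r x \<bullet> x" for z
  proof -
    have "r x \<bullet> z = (\<Sum>c\<in>C. (g c \<bullet> z + b c) * (r x \<bullet> c))"
      by (rule bary_inner[OF bary])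
    also have "\<dots> = (\<Sum>c\<in>C. g c \<bullet> z + b c) * (r x \<bullet> x)" using c by (simp add: sum_distrib_right)
    finally show ?thesis by (simp add: bary_sum[OF bary])
  qed
  have "r x \<bullet> r x = 0" using const[of "r x"] const[of 0] by simp
  then show ?thesis by simp
qed

text \<open>Take the radial field centred at the vertex \<open>c\<close> opposite \<open>F\<close>.
  Every other facet contains \<open>c\<close>, so the field is tangential there; on \<open>F\<close>
  the normal component of \<open>x - c\<close> is a nonzero constant, by which \<open>s\<close> is
  divided.\<close>

lemma facet_function:
  fixes T :: "(real^'n) set" and s :: "real^'n \<Rightarrow> real"
  assumes T: "int DIM(real^'n) simplex T" and F: "F facet_of T" and n: "face_normal F n"
    and s: "s \<in> polys k"
  obtains P where "P \<in> RT k" "\<And>x. x \<in> F \<Longrightarrow> n \<bullet> P x = s x"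
    "\<And>F' n' x. F' facet_of T \<Longrightarrow> F' \<noteq> F \<Longrightarrow> face_normal F' n' \<Longrightarrow> x \<in> F' \<Longrightarrow> n' \<bullet> P x = 0"
proof -
  obtain C g b where bary: "barycentric C g b" and TC: "T = convex hull C"
    and indep: "\<not> affine_dependent C" and card: "card C = DIM(real^'n) + 1"
    using simplex_barycentric[OF T] by blast
  obtain c where c: "c \<in> C" and Fc: "F = convex hull (C - {c})"
    using F simplex_facet_iff[OF indep card] TC by blast
  obtain a where a: "a \<in> C" "a \<noteq> c" using bary_two[OF bary card c] by blast
  have aF: "a \<in> F" using a by (simp add: Fc hull_inc)
  define \<kappa> where "\<kappa> = n \<bullet> (a - c)"
  have \<kappa>: "n \<bullet> (x - c) = \<kappa>" if "x \<in> F" for x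
  proof -
    have "n \<bullet> (x - a) = 0" using n aF that by (auto simp: face_normal_def)
    then show ?thesis by (simp add: \<kappa>_def inner_diff_right)
  qed
  have "n = (n \<bullet> (c - a)) *\<^sub>R g c"
    by (rule facet_normal[OF bary c a]) (use n in \<open>auto simp: face_normal_def Fc\<close>)
  then have "n \<bullet> (c - a) \<noteq> 0" using n by (auto simp: face_normal_def)
  then have \<kappa>0: "\<kappa> \<noteq> 0" by (simp add: \<kappa>_def inner_diff_right)
  show ?thesis
  proof (rule that[of "\<lambda>x. (s x / \<kappa>) *\<^sub>R (x - c)"])
    have "(\<lambda>x. s x / \<kappa>) \<in> polys k"
      using polys_linear[OF s, of "\<lambda>y. y / \<kappa>"] by (simp add: linear_iff add_divide_distrib)
    then show "(\<lambda>x. (s x / \<kappa>) *\<^sub>R (x - c)) \<in> RT k" by (rule RT_radial)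
    show "n \<bullet> ((s x / \<kappa>) *\<^sub>R (x - c)) = s x" if "x \<in> F" for x using \<kappa>[OF that] \<kappa>0 by simp
    fix F' n' x assume F': "F' facet_of T" "F' \<noteq> F" "face_normal F' n'" "x \<in> F'"
    then obtain c' where c': "c' \<in> C" "F' = convex hull (C - {c'})"
      using simplex_facet_iff[OF indep card] TC by blast
    then have "c \<noteq> c'" using F'(2) Fc by blast
    then have "c \<in> F'" using c c' by (simp add: hull_inc)
    then have "n' \<bullet> (x - c) = 0" using F'(3,4) by (auto simp: face_normal_def)
    then show "n' \<bullet> ((s x / \<kappa>) *\<^sub>R (x - c)) = 0" by simp
  qed
qed

lemma polys_row_div: "p \<in> polys k \<Longrightarrow> row_div p \<in> polys (k - 1)"
proof (rule polys_componentwise)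
  fix i assume p: "p \<in> polys k"
  have "(\<lambda>y. p y $ i $ j) \<in> polys k" for j using polys_comp[OF polys_comp[OF p]] .
  then show "(\<lambda>x. row_div p x $ i) \<in> polys (k - 1)"
    unfolding row_div_def by (simp add: polys_sum polys_partial)
qed

lemma linear_quadratic_form: "linear (\<lambda>M::real^'n^'n. n \<bullet> (M *v n))"
  by (rule linearI) (simp_all add: matrix_vector_mult_add_rdistrib inner_add_right scaleR_matrix_vector_assoc[symmetric])

text \<open>The transpose of \<open>M\<close> applied to \<open>\<phi>\<close>. Its divergence
  splits into the row-wise divergence of \<open>M\<close> paired with \<open>\<phi>\<close> and the
  pairing of \<open>M\<close> with the gradient of \<open>\<phi>\<close>.\<close>

definition transported :: "(real^'n \<Rightarrow> real^'n^'n) \<Rightarrow> (real^'n \<Rightarrow> real^'n) \<Rightarrow> real^'n \<Rightarrow> real^'n" where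
  "transported M \<phi> x = (\<chi> j. \<Sum>i\<in>UNIV. M x $ i $ j * \<phi> x $ i)"

definition jac :: "(real^'n::finite \<Rightarrow> real^'n) \<Rightarrow> real^'n \<Rightarrow> real^'n^'n" where
  "jac \<phi> x = (\<chi> i j. partial j (\<lambda>y. \<phi> y $ i) x)"

lemma jacobian_eq_jac:
  assumes "\<phi> differentiable at x" shows "jacobian \<phi> (at x) = jac \<phi> x"
  using partial_linear[OF assms bounded_linear_vec_nth]
  by (simp add: jacobian_def matrix_def jac_def partial_def vec_eq_iff)

lemma C1_transported:
  assumes "C1 M" "C1 \<phi>" shows "C1 (\<lambda>x. transported M \<phi> x $ j)"
  unfolding transported_def vec_lambda_beta
  by (rule Ck_sum[OF finite UNIV_not_empty C1_mult[OF C1_component[OF C1_component[OF assms(1)]] C1_component[OF assms(2)]]])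

lemma C1_vecI:
  fixes f :: "real^'a \<Rightarrow> real^'b"
  assumes "\<And>i. C1 (\<lambda>x. f x $ i)" shows "C1 f"
proof -
  have "(\<lambda>x. \<Sum>i\<in>UNIV. axis i (f x $ i)) = f"
    by (simp add: vec_eq_iff axis_def sum.delta fun_eq_iff)
  moreover have "C1 (\<lambda>x. \<Sum>i\<in>UNIV. axis i (f x $ i))"
  proof (rule Ck_sum[OF finite UNIV_not_empty], rule Ck_linear[OF _ assms])
    show "bounded_linear (axis i :: real \<Rightarrow> real^'b)" for i
      unfolding linear_conv_bounded_linear[symmetric] by (rule linearI) (simp_all add: axis_def vec_eq_iff)
  qed
  ultimately show ?thesis by (simp only:)
qed

lemma vdiv_transported:
  assumes "C1 M" "C1 \<phi>"
  shows "vdiv (transported M \<phi>) x = row_div M x \<bullet> \<phi> x + M x \<bullet> jac \<phi> x"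
proof -
  have d: "(\<lambda>x. M x $ i $ j) differentiable at x" "(\<lambda>x. \<phi> x $ i) differentiable at x" for i j
    by (rule C1_differentiable[OF C1_component[OF C1_component[OF assms(1)]]])
      (rule C1_differentiable[OF C1_component[OF assms(2)]])
  have "partial j (\<lambda>y. transported M \<phi> y $ j) x =
      (\<Sum>i\<in>UNIV. M x $ i $ j * partial j (\<lambda>y. \<phi> y $ i) x + partial j (\<lambda>y. M y $ i $ j) x * \<phi> x $ i)" for j
  proof -
    have "partial j (\<lambda>y. \<Sum>i\<in>UNIV. M y $ i $ j * \<phi> y $ i) x = (\<Sum>i\<in>UNIV. partial j (\<lambda>y. M y $ i $ j * \<phi> y $ i) x)"
      by (rule partial_sum) (intro differentiable_mult d)
    then show ?thesis unfolding transported_def partial_mult[OF d] by simp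
  qed
  then have "vdiv (transported M \<phi>) x =
      (\<Sum>j\<in>UNIV. \<Sum>i\<in>UNIV. M x $ i $ j * partial j (\<lambda>y. \<phi> y $ i) x + partial j (\<lambda>y. M y $ i $ j) x * \<phi> x $ i)"
    by (simp add: vdiv_def)
  also have "\<dots> = (\<Sum>i\<in>UNIV. \<Sum>j\<in>UNIV. M x $ i $ j * partial j (\<lambda>y. \<phi> y $ i) x + partial j (\<lambda>y. M y $ i $ j) x * \<phi> x $ i)"
    by (rule sum.swap)
  also have "\<dots> = row_div M x \<bullet> \<phi> x + M x \<bullet> jac \<phi> x"
    unfolding row_div_def inner_vec_def jac_def
    by (simp only: sum.distrib sum_distrib_right inner_real_def vec_lambda_beta add.commute)
  finally show ?thesis .
qed

lemma inner_transported: "n \<bullet> transported M \<phi> x = \<phi> x \<bullet> (M x *v n)"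
proof -
  have "n \<bullet> transported M \<phi> x = (\<Sum>j\<in>UNIV. \<Sum>i\<in>UNIV. n $ j * (M x $ i $ j * \<phi> x $ i))"
    by (simp add: inner_vec_def transported_def sum_distrib_left)
  also have "\<dots> = (\<Sum>i\<in>UNIV. \<Sum>j\<in>UNIV. n $ j * (M x $ i $ j * \<phi> x $ i))" by (rule sum.swap)
  also have "\<dots> = \<phi> x \<bullet> (M x *v n)"
    by (simp add: inner_vec_def matrix_vector_mult_def sum_distrib_left mult_ac)
  finally show ?thesis .
qed

text \<open>The set of interior points where \<open>q\<close> is nonzero is open and null, hence
  empty.\<close>

lemma continuous_integral_zero:
  fixes q :: "real^'n \<Rightarrow> real"
  assumes T: "convex T" "compact T" and q: "continuous_on UNIV q" "\<And>x. x \<in> interior T \<Longrightarrow> 0 \<le> q x"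
    and int: "(LINT x|lebesgue_on T. q x) = 0" and x: "x \<in> interior T"
  shows "q x = 0"
proof -
  have [measurable]: "q \<in> borel_measurable borel" using q(1) by (rule borel_measurable_continuous_onI)
  let ?U = "{x \<in> interior T. q x \<noteq> 0}"
  have "continuous_on (interior T) q" using q(1) by (rule continuous_on_subset) auto
  then have "open ?U" using continuous_open_preimage[of "interior T" q "- {0}"]
    by (auto simp: vimage_def Int_def conj_commute)
  have "(LINT x|lborel. indicator (interior T) x * q x) = 0"
    using int integral_lebesgue_on_eq_interior[OF T(1) compact_imp_closed[OF T(2)], of q q] by simp
  moreover have "AE x in lborel. 0 \<le> indicator (interior T) x * q x"
    using q(2) by (auto simp: indicator_def)
  ultimately have "AE x in lborel. indicator (interior T) x * q x = 0"
    using integral_nonneg_eq_0_iff_AE[OF integrable_indicator_compact[OF T(2) q(1)]] by simp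
  then have "AE x in lborel. x \<notin> ?U" by eventually_elim auto
  then have "AE x in lebesgue. x \<notin> ?U" by (rule AE_completion)
  moreover have "?U \<in> sets lebesgue" using \<open>open ?U\<close> by auto
  ultimately have "?U \<in> null_sets lebesgue" by (simp add: AE_iff_null_sets)
  then have "negligible ?U" by (simp only: negligible_iff_null_sets)
  then have "?U = {}" using open_not_negligible[OF \<open>open ?U\<close>] by blast
  then show ?thesis using x by blast
qed

lemma test_functionsD:
  assumes "\<phi> \<in> test_functions S"
  shows "Ck m \<phi>" "compact (closure {x. \<phi> x \<noteq> 0})" "closure {x. \<phi> x \<noteq> 0} \<subseteq> S"
  using assms by (simp_all add: test_functions_def del: Ck.simps)

lemma borel_lebesgue_on: "f \<in> borel_measurable borel \<Longrightarrow> f \<in> borel_measurable (lebesgue_on S)"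
  by (rule measurable_restrict_space1, rule measurable_completion) simp

lemma RT_C1: "v \<in> RT k \<Longrightarrow> C1 v"
  using C1_polys[OF RT_subset_polys] .

section \<open>Raviart-Thomas fields with continuous normal components\<close>

context vec_mesh
begin

text \<open>Families with one polynomial field per element, each defined everywhere, so that both
  traces on a face are evaluations. The pointwise conditions on the faces stand for membership in
  \<open>Hdiv\<close> with zero normal trace.\<close>

definition RT_fields :: "int \<Rightarrow> ((real^'n) set \<Rightarrow> real^'n \<Rightarrow> real^'n) set" where
  "RT_fields k = {P. (\<forall>T\<in>\<T>. P T \<in> RT k) \<and>
     (\<forall>F\<in>interior_faces \<Omega> \<T>. \<forall>x\<in>F. \<nu> F \<bullet> P (pos_elt F) x = \<nu> F \<bullet> P (neg_elt F) x) \<and>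
     (\<forall>F\<in>boundary_faces \<Omega> \<T>. \<forall>T\<in>\<T>. F facet_of T \<longrightarrow> (\<forall>x\<in>F. \<nu> F \<bullet> P T x = 0))}"

lemma RT_fieldsD:
  assumes "P \<in> RT_fields k"
  shows "T \<in> \<T> \<Longrightarrow> P T \<in> RT k"
    and "F \<in> interior_faces \<Omega> \<T> \<Longrightarrow> x \<in> F \<Longrightarrow> \<nu> F \<bullet> P (pos_elt F) x = \<nu> F \<bullet> P (neg_elt F) x"
    and "F \<in> boundary_faces \<Omega> \<T> \<Longrightarrow> T \<in> \<T> \<Longrightarrow> F facet_of T \<Longrightarrow> x \<in> F \<Longrightarrow> \<nu> F \<bullet> P T x = 0"
  using assms by (simp_all add: RT_fields_def)

lemma RT_fieldsI:
  assumes "\<And>T. T \<in> \<T> \<Longrightarrow> P T \<in> RT k"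
    and "\<And>F x. F \<in> interior_faces \<Omega> \<T> \<Longrightarrow> x \<in> F \<Longrightarrow> \<nu> F \<bullet> P (pos_elt F) x = \<nu> F \<bullet> P (neg_elt F) x"
    and "\<And>F T x. F \<in> boundary_faces \<Omega> \<T> \<Longrightarrow> T \<in> \<T> \<Longrightarrow> F facet_of T \<Longrightarrow> x \<in> F \<Longrightarrow> \<nu> F \<bullet> P T x = 0"
  shows "P \<in> RT_fields k"
  using assms unfolding RT_fields_def by blast

text \<open>The value on the mesh skeleton is 0, a null-set convention that neither the integrals
  nor the traces see.\<close>

definition assemble :: "((real^'n) set \<Rightarrow> real^'n \<Rightarrow> 'b::euclidean_space) \<Rightarrow> real^'n \<Rightarrow> 'b" where
  "assemble P x = (\<Sum>T\<in>\<T>. indicator (interior T) x *\<^sub>R P T x)"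

lemma assemble_eq: "T \<in> \<T> \<Longrightarrow> x \<in> interior T \<Longrightarrow> assemble P x = P T x"
  unfolding assemble_def by (rule sum_indicator_interior)

lemma assemble_L2:
  assumes "\<And>T. T \<in> \<T> \<Longrightarrow> continuous_on UNIV (P T)"
  shows "assemble P \<in> L2 \<Omega>"
proof -
  have "assemble P \<in> borel_measurable borel"
    unfolding assemble_def[abs_def]
    by (intro borel_measurable_sum borel_measurable_scaleR borel_measurable_indicator)
      (auto intro: borel_measurable_continuous_onI assms)
  then have "assemble P \<in> borel_measurable (lebesgue_on \<Omega>)" by (rule borel_lebesgue_on)
  moreover have "integrable (lebesgue_on \<Omega>) (\<lambda>x. (norm (assemble P x))\<^sup>2)"
  proof (rule integral_domain(1)[where q = "\<lambda>T x. (norm (P T x))\<^sup>2"])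
    fix T x assume "T \<in> \<T>" "x \<in> interior T"
    then show "(norm (assemble P x))\<^sup>2 = (norm (P T x))\<^sup>2" by (simp only: assemble_eq[of T])
  qed (intro continuous_intros assms)
  ultimately show ?thesis by (simp add: L2_def)
qed

lemma test_functions_boundary:
  assumes "\<phi> \<in> test_functions \<Omega>" "F \<in> boundary_faces \<Omega> \<T>" "x \<in> F" shows "\<phi> x = 0"
proof (rule ccontr)
  assume "\<phi> x \<noteq> 0"
  then have "x \<in> closure {x. \<phi> x \<noteq> 0}" by (intro subsetD[OF closure_subset]) simp
  then have "x \<in> \<Omega>" using test_functionsD(3)[OF assms(1)] by (rule subsetD[rotated])
  moreover have "x \<in> frontier \<Omega>" using assms(2,3) unfolding boundary_faces_def by blast
  ultimately show False using open_domain by (simp add: frontier_def interior_open)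
qed

text \<open>Integration by parts on every element leaves only face terms: on interior faces they
  cancel because the normal component is single-valued, on boundary faces the test function is
  zero.\<close>

lemma assemble_ker_div:
  assumes P: "P \<in> RT_fields k" and div: "\<And>T x. T \<in> \<T> \<Longrightarrow> x \<in> interior T \<Longrightarrow> vdiv (P T) x = 0"
  shows "has_weak_div \<Omega> (assemble P) (\<lambda>x. 0)"
proof -
  have C: "C1 (P T)" if "T \<in> \<T>" for T by (rule RT_C1[OF RT_fieldsD(1)[OF P that]])
  note cont = C1_continuous[OF C]
  have "(LINT x|lebesgue_on \<Omega>. (\<Sum>j\<in>UNIV. assemble P x $ j * partial j \<phi> x)) = 0" if \<phi>: "\<phi> \<in> test_functions \<Omega>" for \<phi>
  proof -
    note C\<phi> = test_functionsD(1)[OF \<phi>, of "Suc 0"]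
    have CP: "C1 (\<lambda>x. \<phi> x *\<^sub>R P T x)" if "T \<in> \<T>" for T
      by (rule C1_vecI) (simp only: vector_scaleR_component real_scaleR_def, rule C1_mult[OF C\<phi> C1_component[OF C[OF that]]])
    have "(LINT x|lebesgue_on \<Omega>. (\<Sum>j\<in>UNIV. assemble P x $ j * partial j \<phi> x)) =
        (\<Sum>T\<in>\<T>. LINT x|lebesgue_on T. P T x \<bullet> grad \<phi> x)"
    proof (rule integral_domain(2))
      fix T x assume "T \<in> \<T>" "x \<in> interior T"
      then show "(\<Sum>j\<in>UNIV. assemble P x $ j * partial j \<phi> x) = P T x \<bullet> grad \<phi> x"
        by (simp only: assemble_eq[of T]) (simp add: inner_vec_def grad_def)
    qed (intro continuous_intros cont continuous_grad C\<phi>)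
    also have "\<dots> = (\<Sum>T\<in>\<T>. LINT x|lebesgue_on T. vdiv (\<lambda>x. \<phi> x *\<^sub>R P T x) x)"
    proof (rule sum.cong[OF refl])
      fix T assume T: "T \<in> \<T>"
      show "(LINT x|lebesgue_on T. P T x \<bullet> grad \<phi> x) = (LINT x|lebesgue_on T. vdiv (\<lambda>x. \<phi> x *\<^sub>R P T x) x)"
        by (rule integral_elt_cong[OF T continuous_vdiv[OF CP[OF T]]])
          (simp add: vdiv_scaleR[OF C\<phi> C[OF T]] div[OF T] inner_commute)
    qed
    also have "\<dots> = (\<Sum>F\<in>interior_faces \<Omega> \<T>. LINT x:F|hull_lebesgue F.
        \<nu> F \<bullet> (\<phi> x *\<^sub>R P (pos_elt F) x - \<phi> x *\<^sub>R P (neg_elt F) x))"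
      by (rule mesh_divergence[OF CP]) (use test_functions_boundary[OF \<phi>] in auto)
    also have "\<dots> = 0"
    proof (intro sum.neutral ballI)
      fix F assume F: "F \<in> interior_faces \<Omega> \<T>"
      have "(LINT x:F|hull_lebesgue F. \<nu> F \<bullet> (\<phi> x *\<^sub>R P (pos_elt F) x - \<phi> x *\<^sub>R P (neg_elt F) x)) =
          (LINT x:F|hull_lebesgue F. (0::real))"
        unfolding set_lebesgue_integral_def
      proof (rule Bochner_Integration.integral_cong[OF refl])
        fix x
        have "x \<in> F \<Longrightarrow> \<nu> F \<bullet> P (pos_elt F) x = \<nu> F \<bullet> P (neg_elt F) x" using RT_fieldsD(2)[OF P F] .
        then show "indicator F x *\<^sub>R (\<nu> F \<bullet> (\<phi> x *\<^sub>R P (pos_elt F) x - \<phi> x *\<^sub>R P (neg_elt F) x)) = indicator F x *\<^sub>R 0"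
          by (cases "x \<in> F") (simp_all add: inner_diff_right)
      qed
      then show "(LINT x:F|hull_lebesgue F. \<nu> F \<bullet> (\<phi> x *\<^sub>R P (pos_elt F) x - \<phi> x *\<^sub>R P (neg_elt F) x)) = 0"
        by (simp add: set_lebesgue_integral_def)
    qed
    finally show ?thesis .
  qed
  then show ?thesis by (simp add: has_weak_div_def L2_def)
qed

lemma RT_fields_comb:
  assumes "P \<in> RT_fields k" "Q \<in> RT_fields k"
  shows "(\<lambda>T x. P T x + c *\<^sub>R Q T x) \<in> RT_fields k"
  using RT_fieldsD[OF assms(1)] RT_fieldsD[OF assms(2)]
  by (intro RT_fieldsI RT_add RT_scaleR) (simp_all add: inner_add_right)

lemma RT_fields_C1: "P \<in> RT_fields k \<Longrightarrow> T \<in> \<T> \<Longrightarrow> C1 (P T)"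
  by (rule RT_C1[OF RT_fieldsD(1)])

text \<open>Since the bubble has no normal component on any facet, its extension by zero to the
  other elements is admissible. Its product with \<open>r\<close> is nonnegative, so testing with it
  isolates the residual of one element.\<close>

lemma bubble_field:
  assumes T: "T \<in> \<T>" and r: "r \<in> polys (k - 1)"
  obtains B where "B \<in> RT k" "(\<lambda>T'. if T' = T then B else (\<lambda>x. 0)) \<in> RT_fields k"
    "\<And>F x. F facet_of T \<Longrightarrow> x \<in> F \<Longrightarrow> \<nu> F \<bullet> B x = 0"
    "\<And>x. x \<in> interior T \<Longrightarrow> 0 \<le> r x \<bullet> B x"
    "\<And>x. x \<in> interior T \<Longrightarrow> r x \<bullet> B x = 0 \<Longrightarrow> r x = 0"
proof -
  obtain C g b where bary: "barycentric C g b" and TC: "T = convex hull C"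
    and indep: "\<not> affine_dependent C" and card: "card C = DIM(real^'n) + 1"
    using simplex_barycentric[OF simplex[OF T]] by blast
  let ?B = "bubble C g b r"
  have tang: "\<nu> F \<bullet> ?B x = 0" if F: "F facet_of T" "x \<in> F" for F x
  proof -
    obtain c where c: "c \<in> C" "F = convex hull (C - {c})"
      using F(1) simplex_facet_iff[OF indep card] TC by blast
    show ?thesis using bubble_tangential[OF bary c(1)] F(2) face_normal[OF facesI[OF T F(1)]] c(2) by blast
  qed
  have RT: "?B \<in> RT k" by (rule bubble_RT[OF r])
  have zero: "(\<lambda>x::real^'n. 0) \<in> RT k" using RT_scaleR[OF RT, of 0] by simp
  show ?thesis
  proof (rule that[OF RT _ tang])
    show "(\<lambda>T'. if T' = T then ?B else (\<lambda>x. 0)) \<in> RT_fields k"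
      by (rule RT_fieldsI) (use RT zero tang interior_face_elts(2,5) in \<open>auto split: if_splits\<close>)
    fix x assume x: "x \<in> interior T"
    then show "0 \<le> r x \<bullet> ?B x" using bubble_inner_nonneg[OF bary] interior_subset TC by blast
    have "0 < g c \<bullet> x + b c" if "c \<in> C" for c
      using interior_bary_pos[OF bary _ that] x TC facet_hyperplane_set(2)[OF bary card that] by blast
    then show "r x = 0" if "r x \<bullet> ?B x = 0" using bubble_inner_eq_0[OF bary _ that] by blast
  qed
qed

text \<open>The facet functions of the two neighbours are built with the same normal
  \<open>\<nu> F\<close>, so their normal components agree on \<open>F\<close>; on all other facets
  both are tangential.\<close>

lemma face_field:
  assumes F: "F \<in> interior_faces \<Omega> \<T>" and s: "s \<in> polys k"
  obtains P where "P \<in> RT_fields k" "\<And>x. x \<in> F \<Longrightarrow> \<nu> F \<bullet> P (pos_elt F) x = s x"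
    "\<And>F' x. F' \<in> interior_faces \<Omega> \<T> \<Longrightarrow> F' \<noteq> F \<Longrightarrow> x \<in> F' \<Longrightarrow> \<nu> F' \<bullet> P (pos_elt F') x = 0"
proof -
  note E = interior_face_elts[OF F]
  have n: "face_normal F (\<nu> F)" using F by (intro face_normal) (simp add: interior_faces_def)
  obtain P1 where P1: "P1 \<in> RT k" "\<And>x. x \<in> F \<Longrightarrow> \<nu> F \<bullet> P1 x = s x"
    "\<And>F' n' x. F' facet_of pos_elt F \<Longrightarrow> F' \<noteq> F \<Longrightarrow> face_normal F' n' \<Longrightarrow> x \<in> F' \<Longrightarrow> n' \<bullet> P1 x = 0"
    using facet_function[OF simplex[OF E(1)] E(2) n s] by metis
  obtain P2 where P2: "P2 \<in> RT k" "\<And>x. x \<in> F \<Longrightarrow> \<nu> F \<bullet> P2 x = s x"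
    "\<And>F' n' x. F' facet_of neg_elt F \<Longrightarrow> F' \<noteq> F \<Longrightarrow> face_normal F' n' \<Longrightarrow> x \<in> F' \<Longrightarrow> n' \<bullet> P2 x = 0"
    using facet_function[OF simplex[OF E(4)] E(5) n s] by metis
  define P where "P T = (if T = pos_elt F then P1 else if T = neg_elt F then P2 else (\<lambda>x. 0))" for T
  have zero: "(\<lambda>x::real^'n. 0) \<in> RT k" using RT_scaleR[OF P1(1), of 0] by simp
  have RT: "P T \<in> RT k" for T using P1(1) P2(1) zero by (simp add: P_def)
  have other: "\<nu> F' \<bullet> P T x = 0" if "T \<in> \<T>" "F' facet_of T" "F' \<noteq> F" "x \<in> F'" for T F' x
  proof -
    note n' = face_normal[OF facesI[OF that(1,2)]]
    consider "T = pos_elt F" | "T = neg_elt F" "T \<noteq> pos_elt F" | "T \<noteq> neg_elt F" "T \<noteq> pos_elt F" by blast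
    then show ?thesis
    proof cases
      case 1 then show ?thesis using P1(3)[OF _ that(3) n' that(4)] that(2) by (simp add: P_def)
    next
      case 2 then show ?thesis using P2(3)[OF _ that(3) n' that(4)] that(2) by (simp add: P_def)
    next
      case 3 then show ?thesis by (simp add: P_def)
    qed
  qed
  have same: "\<nu> F \<bullet> P (pos_elt F) x = s x" "\<nu> F \<bullet> P (neg_elt F) x = s x" if "x \<in> F" for x
    using P1(2) P2(2) that E(8) by (auto simp: P_def)
  show ?thesis
  proof (rule that[of P])
    have int: "\<nu> F' \<bullet> P (pos_elt F') x = \<nu> F' \<bullet> P (neg_elt F') x" if F': "F' \<in> interior_faces \<Omega> \<T>" "x \<in> F'" for F' x
    proof (cases "F' = F")
      case True then show ?thesis using same F'(2) by simp
    next
      case False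
      note E' = interior_face_elts[OF F'(1)]
      show ?thesis using other[OF E'(1,2) False F'(2)] other[OF E'(4,5) False F'(2)] by simp
    qed
    have bd: "\<nu> F' \<bullet> P T x = 0" if F': "F' \<in> boundary_faces \<Omega> \<T>" "T \<in> \<T>" "F' facet_of T" "x \<in> F'" for F' T x
    proof -
      have "F' \<noteq> F" using F F'(1) by (auto simp: interior_faces_def)
      from other[OF F'(2,3) this F'(4)] show ?thesis .
    qed
    show "P \<in> RT_fields k" by (rule RT_fieldsI[OF RT int bd])
    show "\<nu> F \<bullet> P (pos_elt F) x = s x" if "x \<in> F" for x by (rule same[OF that])
    show "\<nu> F' \<bullet> P (pos_elt F') x = 0" if F': "F' \<in> interior_faces \<Omega> \<T>" "F' \<noteq> F" "x \<in> F'" for F' x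
      using other[OF interior_face_elts(1,2)[OF F'(1)] F'(2,3)] .
  qed
qed

lemma facet_integrable:
  fixes f :: "real^'n \<Rightarrow> real"
  assumes "F \<in> interior_faces \<Omega> \<T>" "continuous_on UNIV f"
  shows "set_integrable (hull_lebesgue F) F f"
proof -
  note E = interior_face_elts(1,2)[OF assms(1)]
  show ?thesis by (rule integrable_hull_lebesgue[OF simplex[OF E(1)] E(2) facet_props(4)[OF E] assms(2)])
qed

end

section \<open>The weak divergence on Raviart--Thomas fields\<close>

lemma vdiv_comb:
  assumes "C1 P" "C1 Q" shows "vdiv (\<lambda>x. P x + c *\<^sub>R Q x) x = vdiv P x + c * vdiv Q x"
proof -
  have P: "(\<lambda>y. P y $ j) differentiable at x" for j by (rule C1_differentiable[OF C1_component[OF assms(1)]])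
  have Q: "(\<lambda>y. Q y $ j) differentiable at x" for j by (rule C1_differentiable[OF C1_component[OF assms(2)]])
  have cQ: "(\<lambda>y. c * Q y $ j) differentiable at x" for j by (intro differentiable_mult Q) simp
  have "partial j (\<lambda>y. c * Q y $ j) x = c * partial j (\<lambda>y. Q y $ j) x" for j
    by (rule partial_linear[OF Q]) (rule bounded_linear_mult_right)
  then show ?thesis
    unfolding vdiv_def by (simp add: partial_add[OF P cQ] sum.distrib sum_distrib_left)
qed

text \<open>\<open>\<sigma> T\<close> is the polynomial with which the stress coincides inside
  \<open>T\<close>; the vanishing tangential jump becomes an equation between two such polynomials
  on the face.\<close>

locale stress_mesh = vec_mesh \<Omega> \<T> \<nu>
  for \<Omega> :: "(real^'n) set" and \<T> :: "(real^'n) set set" and \<nu> :: "(real^'n) set \<Rightarrow> real^'n" +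
  fixes k :: nat and \<sigma> :: "(real^'n) set \<Rightarrow> real^'n \<Rightarrow> real^'n^'n"
  assumes \<sigma>_polys: "\<And>T. T \<in> \<T> \<Longrightarrow> \<sigma> T \<in> polys (int k)"
    and tangential_continuity: "\<And>F x. F \<in> interior_faces \<Omega> \<T> \<Longrightarrow> x \<in> F \<Longrightarrow>
      tangential (\<nu> F) (\<sigma> (pos_elt F) x *v \<nu> F) = tangential (\<nu> F) (\<sigma> (neg_elt F) x *v \<nu> F)"
begin

definition nn_jump :: "(real^'n) set \<Rightarrow> real^'n \<Rightarrow> real" where
  "nn_jump F x = \<nu> F \<bullet> (\<sigma> (pos_elt F) x *v \<nu> F) - \<nu> F \<bullet> (\<sigma> (neg_elt F) x *v \<nu> F)"

definition weak_div :: "((real^'n) set \<Rightarrow> real^'n \<Rightarrow> real^'n) \<Rightarrow> real" where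
  "weak_div P = (\<Sum>T\<in>\<T>. LINT x|lebesgue_on T. row_div (\<sigma> T) x \<bullet> P T x) -
     (\<Sum>F\<in>interior_faces \<Omega> \<T>. LINT x:F|hull_lebesgue F. nn_jump F x * (\<nu> F \<bullet> P (pos_elt F) x))"

lemma nn_jump_polys:
  assumes "F \<in> interior_faces \<Omega> \<T>" shows "nn_jump F \<in> polys (int k)"
proof -
  have "(\<lambda>x. \<nu> F \<bullet> (\<sigma> T x *v \<nu> F)) \<in> polys (int k)" if "T \<in> \<T>" for T
    by (rule polys_linear[OF \<sigma>_polys[OF that] linear_quadratic_form])
  note p = this[OF interior_face_elts(1)[OF assms]] this[OF interior_face_elts(4)[OF assms]]
  have "(\<lambda>x. - (\<nu> F \<bullet> (\<sigma> (neg_elt F) x *v \<nu> F))) \<in> polys (int k)"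
    by (rule polys_linear[OF p(2)]) (simp add: linear_iff)
  from polys_add[OF p(1) this] show ?thesis by (simp add: nn_jump_def[abs_def])
qed

lemma nn_jump_continuous: "F \<in> interior_faces \<Omega> \<T> \<Longrightarrow> continuous_on UNIV (nn_jump F)"
  by (rule polys_continuous[OF nn_jump_polys])

lemma row_div_continuous: "T \<in> \<T> \<Longrightarrow> continuous_on UNIV (row_div (\<sigma> T))"
  by (rule polys_continuous[OF polys_row_div[OF \<sigma>_polys]])

lemma weak_div_comb:
  assumes P: "\<And>T. T \<in> \<T> \<Longrightarrow> continuous_on UNIV (P T)" and Q: "\<And>T. T \<in> \<T> \<Longrightarrow> continuous_on UNIV (Q T)"
  shows "weak_div (\<lambda>T x. P T x + c *\<^sub>R Q T x) = weak_div P + c * weak_div Q"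
proof -
  have 1: "(LINT x|lebesgue_on T. row_div (\<sigma> T) x \<bullet> (P T x + c *\<^sub>R Q T x)) =
      (LINT x|lebesgue_on T. row_div (\<sigma> T) x \<bullet> P T x) + c * (LINT x|lebesgue_on T. row_div (\<sigma> T) x \<bullet> Q T x)" if T: "T \<in> \<T>" for T
  proof -
    have "integrable (lebesgue_on T) (\<lambda>x. row_div (\<sigma> T) x \<bullet> P T x)" "integrable (lebesgue_on T) (\<lambda>x. row_div (\<sigma> T) x \<bullet> Q T x)"
      by (intro integrable_elt T continuous_intros row_div_continuous P Q)+
    then show ?thesis by (simp add: inner_add_right)
  qed
  have 2: "(LINT x:F|hull_lebesgue F. nn_jump F x * (\<nu> F \<bullet> (P (pos_elt F) x + c *\<^sub>R Q (pos_elt F) x))) =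
      (LINT x:F|hull_lebesgue F. nn_jump F x * (\<nu> F \<bullet> P (pos_elt F) x)) + c * (LINT x:F|hull_lebesgue F. nn_jump F x * (\<nu> F \<bullet> Q (pos_elt F) x))"
    if F: "F \<in> interior_faces \<Omega> \<T>" for F
  proof -
    note E = interior_face_elts(1)[OF F]
    have i: "set_integrable (hull_lebesgue F) F (\<lambda>x. nn_jump F x * (\<nu> F \<bullet> P (pos_elt F) x))"
      "set_integrable (hull_lebesgue F) F (\<lambda>x. nn_jump F x * (\<nu> F \<bullet> Q (pos_elt F) x))"
      by (intro facet_integrable F continuous_intros nn_jump_continuous P[OF E] Q[OF E])+
    have "(LINT x:F|hull_lebesgue F. nn_jump F x * (\<nu> F \<bullet> (P (pos_elt F) x + c *\<^sub>R Q (pos_elt F) x))) =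
      (LINT x:F|hull_lebesgue F. nn_jump F x * (\<nu> F \<bullet> P (pos_elt F) x) + c * (nn_jump F x * (\<nu> F \<bullet> Q (pos_elt F) x)))"
      by (simp add: inner_add_right algebra_simps)
    then show ?thesis using set_integral_add(2)[OF i(1) set_integrable_mult_right[OF i(2), of c]] by simp
  qed
  show ?thesis
    unfolding weak_div_def
    by (simp only: 1 2 sum.distrib sum_distrib_left[symmetric] cong: sum.cong) (simp add: algebra_simps)
qed

text \<open>The functionals are the moments of the divergence against monomials on each element. The
  divergence is itself of degree \<open>k\<close>, so it vanishes once these moments do, and
  \<open>functional_in_span\<close> applies; its coefficients are those of the multiplier.\<close>

lemma weak_div_representation:
  assumes ker: "\<And>P. P \<in> RT_fields (int k) \<Longrightarrow> (\<And>T x. T \<in> \<T> \<Longrightarrow> x \<in> interior T \<Longrightarrow> vdiv (P T) x = 0) \<Longrightarrow> weak_div P = 0"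
  obtains p where "\<And>T. T \<in> \<T> \<Longrightarrow> p T \<in> polys (int k)"
    "\<And>P. P \<in> RT_fields (int k) \<Longrightarrow> weak_div P = (\<Sum>T\<in>\<T>. LINT x|lebesgue_on T. p T x * vdiv (P T) x)"
proof -
  let ?E = "{\<alpha>::'n \<Rightarrow> nat. int (sum \<alpha> UNIV) \<le> int k}"
  define m where "m i P = (LINT x|lebesgue_on (fst i). monomial (snd i) x * vdiv (P (fst i)) x)"
    for i :: "(real^'n) set \<times> ('n \<Rightarrow> nat)" and P :: "(real^'n) set \<Rightarrow> real^'n \<Rightarrow> real^'n"
  have cm: "continuous_on UNIV (monomial \<alpha> :: real^'n \<Rightarrow> real)" for \<alpha>
    unfolding monomial_def[abs_def] by (intro continuous_intros)
  have cv: "continuous_on UNIV (vdiv (P T))" if "P \<in> RT_fields (int k)" "T \<in> \<T>" for P T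
    by (rule continuous_vdiv[OF RT_fields_C1[OF that]])
  have mi: "integrable (lebesgue_on T) (\<lambda>x. monomial \<alpha> x * vdiv (P T) x)" if "P \<in> RT_fields (int k)" "T \<in> \<T>" for P T \<alpha>
    by (intro integrable_elt that continuous_intros cm cv)
  have "\<exists>a. \<forall>P\<in>RT_fields (int k). weak_div P = (\<Sum>i\<in>\<T> \<times> ?E. a i * m i P)"
  proof (rule functional_in_span[where comb = "\<lambda>P c Q T x. P T x + c *\<^sub>R Q T x"])
    show "finite (\<T> \<times> ?E)" by (rule finite_cartesian_product[OF finite_mesh finite_exponents])
    show "(\<lambda>T x. P T x + c *\<^sub>R Q T x) \<in> RT_fields (int k)" if "P \<in> RT_fields (int k)" "Q \<in> RT_fields (int k)" for P Q c
      by (rule RT_fields_comb[OF that])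
    show "m i (\<lambda>T x. P T x + c *\<^sub>R Q T x) = m i P + c * m i Q"
      if "i \<in> \<T> \<times> ?E" "P \<in> RT_fields (int k)" "Q \<in> RT_fields (int k)" for i P Q c
    proof -
      have T: "fst i \<in> \<T>" using that(1) by auto
      have "m i (\<lambda>T x. P T x + c *\<^sub>R Q T x) = (LINT x|lebesgue_on (fst i).
          monomial (snd i) x * vdiv (P (fst i)) x + c * (monomial (snd i) x * vdiv (Q (fst i)) x))"
        unfolding m_def vdiv_comb[OF RT_fields_C1[OF that(2) T] RT_fields_C1[OF that(3) T]]
        by (simp add: algebra_simps)
      then show ?thesis unfolding m_def using mi[OF that(2) T] mi[OF that(3) T] by simp
    qed
    show "weak_div (\<lambda>T x. P T x + c *\<^sub>R Q T x) = weak_div P + c * weak_div Q"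
      if "P \<in> RT_fields (int k)" "Q \<in> RT_fields (int k)" for P Q c
      by (rule weak_div_comb[OF C1_continuous[OF RT_fields_C1[OF that(1)]] C1_continuous[OF RT_fields_C1[OF that(2)]]])
    fix P assume P: "P \<in> RT_fields (int k)" and z: "\<And>i. i \<in> \<T> \<times> ?E \<Longrightarrow> m i P = 0"
    show "weak_div P = 0"
    proof (rule ker[OF P])
      fix T x assume T: "T \<in> \<T>" and x: "x \<in> interior T"
      have "vdiv (P T) \<in> polys (int k)"
        using polys_vdiv[OF RT_subset_polys[OF RT_fieldsD(1)[OF P T]]] by simp
      then obtain c where c: "vdiv (P T) = (\<lambda>x. \<Sum>\<alpha>\<in>?E. monomial \<alpha> x *\<^sub>R c \<alpha>)" by (auto simp: polys_def)
      \<comment> \<open>Expanding one factor of the squared divergence in monomials turns its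
        integral into a combination of the vanishing moments.\<close>
      have "(LINT x|lebesgue_on T. vdiv (P T) x * vdiv (P T) x) =
          (LINT x|lebesgue_on T. (\<Sum>\<alpha>\<in>?E. c \<alpha> * (monomial \<alpha> x * vdiv (P T) x)))"
      proof (rule Bochner_Integration.integral_cong[OF refl])
        fix x
        have "(\<Sum>\<alpha>\<in>?E. monomial \<alpha> x *\<^sub>R c \<alpha>) * V = (\<Sum>\<alpha>\<in>?E. c \<alpha> * (monomial \<alpha> x * V))" for V
          unfolding sum_distrib_right by (intro sum.cong refl) simp
        moreover have "vdiv (P T) x = (\<Sum>\<alpha>\<in>?E. monomial \<alpha> x *\<^sub>R c \<alpha>)" by (subst c) (rule refl)
        then have "vdiv (P T) x * vdiv (P T) x = (\<Sum>\<alpha>\<in>?E. monomial \<alpha> x *\<^sub>R c \<alpha>) * vdiv (P T) x"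
          by (rule arg_cong)
        ultimately show "vdiv (P T) x * vdiv (P T) x = (\<Sum>\<alpha>\<in>?E. c \<alpha> * (monomial \<alpha> x * vdiv (P T) x))"
          by (rule trans[rotated])
      qed
      also have "\<dots> = (\<Sum>\<alpha>\<in>?E. LINT x|lebesgue_on T. c \<alpha> * (monomial \<alpha> x * vdiv (P T) x))"
        by (rule Bochner_Integration.integral_sum) (intro integrable_mult_right mi P T)
      also have "\<dots> = (\<Sum>\<alpha>\<in>?E. c \<alpha> * m (T, \<alpha>) P)" by (simp add: m_def)
      also have "\<dots> = 0"
      proof (rule sum.neutral, rule ballI)
        fix \<alpha> assume "\<alpha> \<in> ?E"
        with T have "m (T, \<alpha>) P = 0" by (intro z SigmaI)
        then show "c \<alpha> * m (T, \<alpha>) P = 0" by simp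
      qed
      finally have "(LINT x|lebesgue_on T. vdiv (P T) x * vdiv (P T) x) = 0" .
      then have "vdiv (P T) x * vdiv (P T) x = 0"
        by (rule continuous_integral_zero[OF elt_convex[OF T] elt_compact[OF T]
              continuous_on_mult[OF cv[OF P T] cv[OF P T]] zero_le_square _ x])
      then show "vdiv (P T) x = 0" by simp
    qed
  qed
  then obtain a where a: "\<And>P. P \<in> RT_fields (int k) \<Longrightarrow> weak_div P = (\<Sum>i\<in>\<T> \<times> ?E. a i * m i P)" by blast
  define p where "p T x = (\<Sum>\<alpha>\<in>?E. monomial \<alpha> x *\<^sub>R a (T, \<alpha>))" for T x
  show ?thesis
  proof (rule that[of p])
    show "p T \<in> polys (int k)" for T unfolding p_def[abs_def] by (rule polysI) simp
    fix P assume P: "P \<in> RT_fields (int k)"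
    have "(LINT x|lebesgue_on T. p T x * vdiv (P T) x) = (\<Sum>\<alpha>\<in>?E. a (T, \<alpha>) * m (T, \<alpha>) P)" if T: "T \<in> \<T>" for T
    proof -
      have "(LINT x|lebesgue_on T. p T x * vdiv (P T) x) =
          (LINT x|lebesgue_on T. (\<Sum>\<alpha>\<in>?E. a (T, \<alpha>) * (monomial \<alpha> x * vdiv (P T) x)))"
        unfolding p_def sum_distrib_right by (simp add: mult_ac)
      also have "\<dots> = (\<Sum>\<alpha>\<in>?E. LINT x|lebesgue_on T. a (T, \<alpha>) * (monomial \<alpha> x * vdiv (P T) x))"
        by (rule Bochner_Integration.integral_sum) (intro integrable_mult_right mi P T)
      finally show ?thesis by (simp add: m_def)
    qed
    then show "weak_div P = (\<Sum>T\<in>\<T>. LINT x|lebesgue_on T. p T x * vdiv (P T) x)"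
      unfolding a[OF P] by (simp add: sum.cartesian_product split_def del: of_nat_sum)
  qed
qed

text \<open>
  The multiplier \<open>p\<close> of the discrete divergence constraint turns \<open>weak_div\<close> minus the divergence
  term into integrals against the residuals \<open>r\<close> and \<open>s\<close>; the bubble and face fields built from
  \<open>r\<close> and \<open>s\<close> themselves then force these residuals to vanish.
\<close>

lemma weak_div_identity:
  assumes p: "\<And>T. T \<in> \<T> \<Longrightarrow> p T \<in> polys (int k)"
    and P: "\<And>T. T \<in> \<T> \<Longrightarrow> C1 (P T)"
    and int: "\<And>F x. F \<in> interior_faces \<Omega> \<T> \<Longrightarrow> x \<in> F \<Longrightarrow> \<nu> F \<bullet> P (pos_elt F) x = \<nu> F \<bullet> P (neg_elt F) x"
    and bd: "\<And>F T x. F \<in> boundary_faces \<Omega> \<T> \<Longrightarrow> T \<in> \<T> \<Longrightarrow> F facet_of T \<Longrightarrow> x \<in> F \<Longrightarrow> \<nu> F \<bullet> P T x = 0"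
  shows "weak_div P - (\<Sum>T\<in>\<T>. LINT x|lebesgue_on T. p T x * vdiv (P T) x) =
    (\<Sum>T\<in>\<T>. LINT x|lebesgue_on T. (row_div (\<sigma> T) x + grad (p T) x) \<bullet> P T x) -
    (\<Sum>F\<in>interior_faces \<Omega> \<T>. LINT x:F|hull_lebesgue F.
       (nn_jump F x + (p (pos_elt F) x - p (neg_elt F) x)) * (\<nu> F \<bullet> P (pos_elt F) x))"
proof -
  have Cp: "C1 (p T)" if "T \<in> \<T>" for T by (rule C1_polys[OF p[OF that]])
  have CpP: "C1 (\<lambda>x. p T x *\<^sub>R P T x)" if "T \<in> \<T>" for T
    by (rule C1_vecI) (simp only: vector_scaleR_component real_scaleR_def, rule C1_mult[OF Cp[OF that] C1_component[OF P[OF that]]])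
  have cg: "continuous_on UNIV (\<lambda>x. grad (p T) x \<bullet> P T x)" if "T \<in> \<T>" for T
    by (intro continuous_intros continuous_grad Cp C1_continuous P that)
  have cr: "continuous_on UNIV (\<lambda>x. row_div (\<sigma> T) x \<bullet> P T x)" if "T \<in> \<T>" for T
    by (intro continuous_intros row_div_continuous C1_continuous P that)
  have cv: "continuous_on UNIV (\<lambda>x. p T x * vdiv (P T) x)" if "T \<in> \<T>" for T
    by (intro continuous_intros C1_continuous Cp continuous_vdiv P that)
  \<comment> \<open>The divergence theorem is applied to \<open>p T x *\<^sub>R P T x\<close>, which
    moves the derivative from the test field to the multiplier at the price of the jumps of
    \<open>p\<close>.\<close>
  have "(\<Sum>T\<in>\<T>. LINT x|lebesgue_on T. vdiv (\<lambda>x. p T x *\<^sub>R P T x) x) =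
      (\<Sum>F\<in>interior_faces \<Omega> \<T>. LINT x:F|hull_lebesgue F. \<nu> F \<bullet> (p (pos_elt F) x *\<^sub>R P (pos_elt F) x - p (neg_elt F) x *\<^sub>R P (neg_elt F) x))"
    by (rule mesh_divergence[OF CpP]) (use bd in auto)
  \<comment> \<open>Because \<open>\<nu> F \<bullet> P\<close> is single-valued on the face, the
    jump of the product is the jump of \<open>p\<close> times this value.\<close>
  also have "\<dots> = (\<Sum>F\<in>interior_faces \<Omega> \<T>. LINT x:F|hull_lebesgue F. (p (pos_elt F) x - p (neg_elt F) x) * (\<nu> F \<bullet> P (pos_elt F) x))"
    unfolding set_lebesgue_integral_def
  proof (intro sum.cong refl Bochner_Integration.integral_cong)
    fix F x assume "F \<in> interior_faces \<Omega> \<T>"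
    then show "indicator F x *\<^sub>R (\<nu> F \<bullet> (p (pos_elt F) x *\<^sub>R P (pos_elt F) x - p (neg_elt F) x *\<^sub>R P (neg_elt F) x)) =
        indicator F x *\<^sub>R ((p (pos_elt F) x - p (neg_elt F) x) * (\<nu> F \<bullet> P (pos_elt F) x))"
      using int by (cases "x \<in> F") (simp_all add: inner_diff_right left_diff_distrib)
  qed
  finally have flux: "(\<Sum>T\<in>\<T>. LINT x|lebesgue_on T. vdiv (\<lambda>x. p T x *\<^sub>R P T x) x) = \<dots>" .
  have "(LINT x|lebesgue_on T. vdiv (\<lambda>x. p T x *\<^sub>R P T x) x) =
      (LINT x|lebesgue_on T. p T x * vdiv (P T) x) + (LINT x|lebesgue_on T. grad (p T) x \<bullet> P T x)" if T: "T \<in> \<T>" for T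
    unfolding vdiv_scaleR[OF Cp[OF T] P[OF T]]
    by (rule Bochner_Integration.integral_add) (intro integrable_elt T cv cg)+
  then have vol: "(\<Sum>T\<in>\<T>. LINT x|lebesgue_on T. p T x * vdiv (P T) x) =
      (\<Sum>F\<in>interior_faces \<Omega> \<T>. LINT x:F|hull_lebesgue F. (p (pos_elt F) x - p (neg_elt F) x) * (\<nu> F \<bullet> P (pos_elt F) x)) -
      (\<Sum>T\<in>\<T>. LINT x|lebesgue_on T. grad (p T) x \<bullet> P T x)"
    using flux by (simp add: sum.distrib)
  have "(LINT x|lebesgue_on T. (row_div (\<sigma> T) x + grad (p T) x) \<bullet> P T x) =
      (LINT x|lebesgue_on T. row_div (\<sigma> T) x \<bullet> P T x) + (LINT x|lebesgue_on T. grad (p T) x \<bullet> P T x)" if T: "T \<in> \<T>" for T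
    unfolding inner_add_left by (rule Bochner_Integration.integral_add) (intro integrable_elt T cr cg)+
  then have 1: "(\<Sum>T\<in>\<T>. LINT x|lebesgue_on T. (row_div (\<sigma> T) x + grad (p T) x) \<bullet> P T x) =
      (\<Sum>T\<in>\<T>. LINT x|lebesgue_on T. row_div (\<sigma> T) x \<bullet> P T x) + (\<Sum>T\<in>\<T>. LINT x|lebesgue_on T. grad (p T) x \<bullet> P T x)"
    by (simp add: sum.distrib)
  have "(LINT x:F|hull_lebesgue F. (nn_jump F x + (p (pos_elt F) x - p (neg_elt F) x)) * (\<nu> F \<bullet> P (pos_elt F) x)) =
      (LINT x:F|hull_lebesgue F. nn_jump F x * (\<nu> F \<bullet> P (pos_elt F) x)) +
      (LINT x:F|hull_lebesgue F. (p (pos_elt F) x - p (neg_elt F) x) * (\<nu> F \<bullet> P (pos_elt F) x))" if F: "F \<in> interior_faces \<Omega> \<T>" for F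
    unfolding distrib_right
    by (rule set_integral_add(2))
      (intro facet_integrable F continuous_intros nn_jump_continuous C1_continuous Cp P interior_face_elts(1,4)[OF F])+
  then have 2: "(\<Sum>F\<in>interior_faces \<Omega> \<T>. LINT x:F|hull_lebesgue F. (nn_jump F x + (p (pos_elt F) x - p (neg_elt F) x)) * (\<nu> F \<bullet> P (pos_elt F) x)) =
      (\<Sum>F\<in>interior_faces \<Omega> \<T>. LINT x:F|hull_lebesgue F. nn_jump F x * (\<nu> F \<bullet> P (pos_elt F) x)) +
      (\<Sum>F\<in>interior_faces \<Omega> \<T>. LINT x:F|hull_lebesgue F. (p (pos_elt F) x - p (neg_elt F) x) * (\<nu> F \<bullet> P (pos_elt F) x))"
    by (simp add: sum.distrib)
  show ?thesis unfolding 1 2 vol weak_div_def by simp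
qed

end

lemma continuous_jac: "C1 \<phi> \<Longrightarrow> continuous_on S (jac \<phi>)"
  by (intro continuous_on_vec_lambda) (simp add: jac_def C1_partial C1_component del: Ck.simps)

context stress_mesh
begin

text \<open>A bubble carries no flux through faces, so it sees only the residual of its element.
  Once these are zero, the face field with normal component \<open>s\<close> leaves the integral of
  the square of \<open>s\<close>. Hence \<open>s\<close> vanishes almost everywhere on the face,
  which is recorded as vanishing against every \<open>\<psi>\<close>.\<close>

lemma residuals_vanish:
  assumes p: "\<And>T. T \<in> \<T> \<Longrightarrow> p T \<in> polys (int k)"
    and rep: "\<And>P. P \<in> RT_fields (int k) \<Longrightarrow> weak_div P = (\<Sum>T\<in>\<T>. LINT x|lebesgue_on T. p T x * vdiv (P T) x)"
  shows "\<And>T x. T \<in> \<T> \<Longrightarrow> x \<in> interior T \<Longrightarrow> row_div (\<sigma> T) x + grad (p T) x = 0"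
    and "\<And>F \<psi>. F \<in> interior_faces \<Omega> \<T> \<Longrightarrow>
      (LINT x:F|hull_lebesgue F. (nn_jump F x + (p (pos_elt F) x - p (neg_elt F) x)) * \<psi> x) = 0"
proof -
  define r where "r T x = row_div (\<sigma> T) x + grad (p T) x" for T x
  define s where "s F x = nn_jump F x + (p (pos_elt F) x - p (neg_elt F) x)" for F x
  have r: "r T \<in> polys (int k - 1)" if "T \<in> \<T>" for T
    unfolding r_def[abs_def] by (rule polys_add[OF polys_row_div[OF \<sigma>_polys[OF that]] polys_grad[OF p[OF that]]])
  have s: "s F \<in> polys (int k)" if F: "F \<in> interior_faces \<Omega> \<T>" for F
  proof -
    note pp = p[OF interior_face_elts(1)[OF F]] p[OF interior_face_elts(4)[OF F]]
    have "(\<lambda>x. - p (neg_elt F) x) \<in> polys (int k)" by (rule polys_linear[OF pp(2)]) (simp add: linear_iff)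
    from polys_add[OF nn_jump_polys[OF F] polys_add[OF pp(1) this]] show ?thesis by (simp add: s_def[abs_def])
  qed
  have id: "(\<Sum>T\<in>\<T>. LINT x|lebesgue_on T. r T x \<bullet> P T x) =
      (\<Sum>F\<in>interior_faces \<Omega> \<T>. LINT x:F|hull_lebesgue F. s F x * (\<nu> F \<bullet> P (pos_elt F) x))"
    if P: "P \<in> RT_fields (int k)" for P
    using weak_div_identity[where p = p and P = P, OF p RT_fields_C1[OF P] RT_fieldsD(2,3)[OF P]] rep[OF P] by (simp add: r_def s_def)
  \<comment> \<open>The test field is the bubble built from \<open>r T\<close> itself, extended by
    zero; all face terms of \<open>id\<close> drop out.\<close>
  have r0: "r T x = 0" if T: "T \<in> \<T>" and x: "x \<in> interior T" for T x
  proof -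
    obtain B where B: "B \<in> RT (int k)" "(\<lambda>T'. if T' = T then B else (\<lambda>x. 0)) \<in> RT_fields (int k)"
      "\<And>F x. F facet_of T \<Longrightarrow> x \<in> F \<Longrightarrow> \<nu> F \<bullet> B x = 0"
      "\<And>x. x \<in> interior T \<Longrightarrow> 0 \<le> r T x \<bullet> B x"
      "\<And>x. x \<in> interior T \<Longrightarrow> r T x \<bullet> B x = 0 \<Longrightarrow> r T x = 0"
      using bubble_field[OF T r[OF T]] by metis
    define P where "P = (\<lambda>T'. if T' = T then B else (\<lambda>x. 0))"
    have PRT: "P \<in> RT_fields (int k)" using B(2) by (simp only: P_def)
    have "(\<Sum>T'\<in>\<T>. LINT x|lebesgue_on T'. r T' x \<bullet> P T' x) = (\<Sum>T'\<in>\<T>. if T' = T then LINT x|lebesgue_on T. r T x \<bullet> B x else 0)"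
      by (rule sum.cong) (auto simp: P_def)
    then have "(LINT x|lebesgue_on T. r T x \<bullet> B x) = (\<Sum>T'\<in>\<T>. LINT x|lebesgue_on T'. r T' x \<bullet> P T' x)"
      using T finite_mesh by simp
    also have "\<dots> = (\<Sum>F\<in>interior_faces \<Omega> \<T>. LINT x:F|hull_lebesgue F. s F x * (\<nu> F \<bullet> P (pos_elt F) x))"
      by (rule id[OF PRT])
    also have "\<dots> = 0"
    proof (rule sum.neutral, rule ballI)
      fix F assume F: "F \<in> interior_faces \<Omega> \<T>"
      have "\<nu> F \<bullet> P (pos_elt F) x = 0" if "x \<in> F" for x
        using B(3)[of F x] interior_face_elts(2)[OF F] that by (auto simp: P_def)
      then have "(\<lambda>x. indicator F x *\<^sub>R (s F x * (\<nu> F \<bullet> P (pos_elt F) x))) = (\<lambda>x. 0)" by (auto simp: indicator_def)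
      then show "(LINT x:F|hull_lebesgue F. s F x * (\<nu> F \<bullet> P (pos_elt F) x)) = 0"
        by (simp add: set_lebesgue_integral_def)
    qed
    finally have 0: "(LINT x|lebesgue_on T. r T x \<bullet> B x) = 0" .
    have c: "continuous_on UNIV (\<lambda>x. r T x \<bullet> B x)"
      by (rule continuous_on_inner[OF polys_continuous[OF r[OF T]] C1_continuous[OF RT_C1[OF B(1)]]])
    have "r T x \<bullet> B x = 0"
      by (rule continuous_integral_zero[OF elt_convex[OF T] elt_compact[OF T] c B(4) 0 x])
    then show ?thesis by (rule B(5)[OF x])
  qed
  then show "\<And>T x. T \<in> \<T> \<Longrightarrow> x \<in> interior T \<Longrightarrow> row_div (\<sigma> T) x + grad (p T) x = 0" by (simp add: r_def)
  fix F \<psi> assume F: "F \<in> interior_faces \<Omega> \<T>"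
  obtain P where P: "P \<in> RT_fields (int k)" "\<And>x. x \<in> F \<Longrightarrow> \<nu> F \<bullet> P (pos_elt F) x = s F x"
    "\<And>F' x. F' \<in> interior_faces \<Omega> \<T> \<Longrightarrow> F' \<noteq> F \<Longrightarrow> x \<in> F' \<Longrightarrow> \<nu> F' \<bullet> P (pos_elt F') x = 0"
    using face_field[OF F s[OF F]] by metis
  \<comment> \<open>With the element residuals gone, \<open>id\<close> for the face field contains
    nothing but the term of \<open>F\<close>.\<close>
  have "(LINT x|lebesgue_on T. r T x \<bullet> P T x) = 0" if T: "T \<in> \<T>" for T
    using integral_elt_cong[OF T continuous_on_const, of "\<lambda>x. r T x \<bullet> P T x" 0] r0[OF T] by simp
  then have "0 = (\<Sum>T\<in>\<T>. LINT x|lebesgue_on T. r T x \<bullet> P T x)" by simp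
  also have "\<dots> = (\<Sum>F'\<in>interior_faces \<Omega> \<T>. LINT x:F'|hull_lebesgue F'. s F' x * (\<nu> F' \<bullet> P (pos_elt F') x))"
    by (rule id[OF P(1)])
  also have "\<dots> = (\<Sum>F'\<in>interior_faces \<Omega> \<T>. if F' = F then LINT x:F|hull_lebesgue F. s F x * s F x else 0)"
  proof (rule sum.cong[OF refl])
    fix F' assume F': "F' \<in> interior_faces \<Omega> \<T>"
    show "(LINT x:F'|hull_lebesgue F'. s F' x * (\<nu> F' \<bullet> P (pos_elt F') x)) =
        (if F' = F then LINT x:F|hull_lebesgue F. s F x * s F x else 0)"
    proof (cases "F' = F")
      case True
      have "(\<lambda>x. indicator F x *\<^sub>R (s F x * (\<nu> F \<bullet> P (pos_elt F) x))) = (\<lambda>x. indicator F x *\<^sub>R (s F x * s F x))"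
        using P(2) by (auto simp: indicator_def)
      then show ?thesis using True by (simp add: set_lebesgue_integral_def)
    next
      case False
      then have "(\<lambda>x. indicator F' x *\<^sub>R (s F' x * (\<nu> F' \<bullet> P (pos_elt F') x))) = (\<lambda>x. 0)"
        using P(3)[OF F'] by (auto simp: indicator_def)
      then show ?thesis using False by (simp add: set_lebesgue_integral_def)
    qed
  qed
  also have "\<dots> = (LINT x:F|hull_lebesgue F. s F x * s F x)"
    using F finite_subset[OF _ finite_faces, of "interior_faces \<Omega> \<T>"] by (auto simp: interior_faces_def)
  finally have 0: "(LINT x|hull_lebesgue F. indicator F x *\<^sub>R (s F x * s F x)) = 0"
    by (simp add: set_lebesgue_integral_def)
  have i: "integrable (hull_lebesgue F) (\<lambda>x. indicator F x *\<^sub>R (s F x * s F x))"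
    using facet_integrable[OF F continuous_on_mult[OF polys_continuous[OF s[OF F]] polys_continuous[OF s[OF F]]]]
    by (simp add: set_integrable_def)
  have "AE x in hull_lebesgue F. indicator F x *\<^sub>R (s F x * s F x) = 0"
    using 0 by (subst (asm) integral_nonneg_eq_0_iff_AE[OF i]) auto
  then have ae: "AE x in hull_lebesgue F. indicator F x *\<^sub>R (s F x * \<psi> x) = 0"
    by eventually_elim (auto simp: indicator_def)
  have "(LINT x|hull_lebesgue F. indicator F x *\<^sub>R (s F x * \<psi> x)) = 0"
    by (rule integral_eq_zero_AE[OF ae])
  then show "(LINT x:F|hull_lebesgue F. (nn_jump F x + (p (pos_elt F) x - p (neg_elt F) x)) * \<psi> x) = 0"
    by (simp add: set_lebesgue_integral_def s_def)
qed

text \<open>Integration by parts for the transposed stress applied to \<open>\<phi>\<close>. The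
  tangential part of the stress vector is continuous, so on an interior face only the normal-normal
  jump survives, which is the face term of \<open>weak_div\<close>.\<close>

lemma weak_div_smooth:
  assumes \<phi>: "C1 \<phi>" and bd: "\<And>F x. F \<in> boundary_faces \<Omega> \<T> \<Longrightarrow> x \<in> F \<Longrightarrow> \<phi> x = 0"
  shows "(\<Sum>T\<in>\<T>. LINT x|lebesgue_on T. \<sigma> T x \<bullet> jac \<phi> x) = - weak_div (\<lambda>T. \<phi>)"
proof -
  have CM: "C1 (transported (\<sigma> T) \<phi>)" if "T \<in> \<T>" for T
    by (rule C1_vecI, rule C1_transported[OF C1_polys[OF \<sigma>_polys[OF that]] \<phi>])
  have "(LINT x|lebesgue_on T. vdiv (transported (\<sigma> T) \<phi>) x) =
      (LINT x|lebesgue_on T. row_div (\<sigma> T) x \<bullet> \<phi> x) + (LINT x|lebesgue_on T. \<sigma> T x \<bullet> jac \<phi> x)" if T: "T \<in> \<T>" for T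
    unfolding vdiv_transported[OF C1_polys[OF \<sigma>_polys[OF T]] \<phi>]
    by (rule Bochner_Integration.integral_add)
      (intro integrable_elt T continuous_intros row_div_continuous C1_continuous \<phi> continuous_jac polys_continuous[OF \<sigma>_polys[OF T]])+
  then have "(\<Sum>T\<in>\<T>. LINT x|lebesgue_on T. \<sigma> T x \<bullet> jac \<phi> x) =
      (\<Sum>T\<in>\<T>. LINT x|lebesgue_on T. vdiv (transported (\<sigma> T) \<phi>) x) - (\<Sum>T\<in>\<T>. LINT x|lebesgue_on T. row_div (\<sigma> T) x \<bullet> \<phi> x)"
    by (simp add: sum.distrib)
  also have "(\<Sum>T\<in>\<T>. LINT x|lebesgue_on T. vdiv (transported (\<sigma> T) \<phi>) x) =
      (\<Sum>F\<in>interior_faces \<Omega> \<T>. LINT x:F|hull_lebesgue F. \<nu> F \<bullet> (transported (\<sigma> (pos_elt F)) \<phi> x - transported (\<sigma> (neg_elt F)) \<phi> x))"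
    by (rule mesh_divergence[OF CM]) (auto simp: inner_transported bd)
  also have "\<dots> = (\<Sum>F\<in>interior_faces \<Omega> \<T>. LINT x:F|hull_lebesgue F. nn_jump F x * (\<nu> F \<bullet> \<phi> x))"
    unfolding set_lebesgue_integral_def
  proof (intro sum.cong refl Bochner_Integration.integral_cong)
    fix F x assume F: "F \<in> interior_faces \<Omega> \<T>"
    show "indicator F x *\<^sub>R (\<nu> F \<bullet> (transported (\<sigma> (pos_elt F)) \<phi> x - transported (\<sigma> (neg_elt F)) \<phi> x)) =
        indicator F x *\<^sub>R (nn_jump F x * (\<nu> F \<bullet> \<phi> x))"
    proof (cases "x \<in> F")
      case True
      let ?a = "\<sigma> (pos_elt F) x *v \<nu> F" and ?b = "\<sigma> (neg_elt F) x *v \<nu> F"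
      \<comment> \<open>Equal tangential parts leave a jump vector that is parallel to the
        normal.\<close>
      have "?a - ?b = nn_jump F x *\<^sub>R \<nu> F"
        using tangential_continuity[OF F True]
        by (simp add: tangential_def nn_jump_def inner_commute algebra_simps)
      then have "\<phi> x \<bullet> (?a - ?b) = nn_jump F x * (\<nu> F \<bullet> \<phi> x)" by (simp add: inner_commute)
      then show ?thesis by (simp add: inner_diff_right inner_transported)
    qed simp
  qed
  finally show ?thesis by (simp add: weak_div_def)
qed

text \<open>\<open>weak_div_identity\<close> speaks of any continuously differentiable family with
  matching normal components, so the constant family \<open>\<phi>\<close> may be inserted directly.
  Its right-hand side vanishes with the residuals.\<close>

lemma smooth_pairing:
  assumes ker: "\<And>P. P \<in> RT_fields (int k) \<Longrightarrow> (\<And>T x. T \<in> \<T> \<Longrightarrow> x \<in> interior T \<Longrightarrow> vdiv (P T) x = 0) \<Longrightarrow> weak_div P = 0"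
  obtains p where "\<And>T. T \<in> \<T> \<Longrightarrow> p T \<in> polys (int k)"
    "\<And>\<phi>. \<phi> \<in> test_functions \<Omega> \<Longrightarrow>
      (\<Sum>T\<in>\<T>. LINT x|lebesgue_on T. \<sigma> T x \<bullet> jac \<phi> x + p T x * vdiv \<phi> x) = 0"
proof -
  show ?thesis
  proof (rule weak_div_representation[OF ker])
    fix p assume p: "\<And>T. T \<in> \<T> \<Longrightarrow> p T \<in> polys (int k)"
      and rep: "\<And>P. P \<in> RT_fields (int k) \<Longrightarrow> weak_div P = (\<Sum>T\<in>\<T>. LINT x|lebesgue_on T. p T x * vdiv (P T) x)"
    show ?thesis
  proof (rule that[OF p])
    fix \<phi> :: "real^'n \<Rightarrow> real^'n" assume \<phi>: "\<phi> \<in> test_functions \<Omega>"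
    note C = test_functionsD(1)[OF \<phi>, of "Suc 0"]
    note bd = test_functions_boundary[OF \<phi>]
    have "(LINT x|lebesgue_on T. (row_div (\<sigma> T) x + grad (p T) x) \<bullet> \<phi> x) = 0" if T: "T \<in> \<T>" for T
      using integral_elt_cong[OF T continuous_on_const, of "\<lambda>x. (row_div (\<sigma> T) x + grad (p T) x) \<bullet> \<phi> x" 0]
        residuals_vanish(1)[where p = p, OF p rep T] by simp
    moreover have "weak_div (\<lambda>T. \<phi>) - (\<Sum>T\<in>\<T>. LINT x|lebesgue_on T. p T x * vdiv \<phi> x) =
      (\<Sum>T\<in>\<T>. LINT x|lebesgue_on T. (row_div (\<sigma> T) x + grad (p T) x) \<bullet> \<phi> x) -
      (\<Sum>F\<in>interior_faces \<Omega> \<T>. LINT x:F|hull_lebesgue F.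
         (nn_jump F x + (p (pos_elt F) x - p (neg_elt F) x)) * (\<nu> F \<bullet> \<phi> x))"
      by (rule weak_div_identity[OF p C]) (simp_all add: bd)
    ultimately have "weak_div (\<lambda>T. \<phi>) = (\<Sum>T\<in>\<T>. LINT x|lebesgue_on T. p T x * vdiv \<phi> x)"
      using residuals_vanish(2)[where p = p, OF p rep] by simp
    then have "(\<Sum>T\<in>\<T>. LINT x|lebesgue_on T. \<sigma> T x \<bullet> jac \<phi> x) + (\<Sum>T\<in>\<T>. LINT x|lebesgue_on T. p T x * vdiv \<phi> x) = 0"
      using weak_div_smooth[OF C bd] by simp
    moreover have "(LINT x|lebesgue_on T. \<sigma> T x \<bullet> jac \<phi> x + p T x * vdiv \<phi> x) =
        (LINT x|lebesgue_on T. \<sigma> T x \<bullet> jac \<phi> x) + (LINT x|lebesgue_on T. p T x * vdiv \<phi> x)" if T: "T \<in> \<T>" for T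
      by (rule Bochner_Integration.integral_add)
        (intro integrable_elt T continuous_intros continuous_jac continuous_vdiv C polys_continuous[OF \<sigma>_polys[OF T]] polys_continuous[OF p[OF T]])+
    ultimately show "(\<Sum>T\<in>\<T>. LINT x|lebesgue_on T. \<sigma> T x \<bullet> jac \<phi> x + p T x * vdiv \<phi> x) = 0"
      by (simp add: sum.distrib)
    qed
  qed
qed

end

section \<open>Passage to the Sobolev space\<close>

lemma L2_measurable: "f \<in> L2 \<Omega> \<Longrightarrow> f \<in> borel_measurable (lebesgue_on \<Omega>)"
  and L2_integrable: "f \<in> L2 \<Omega> \<Longrightarrow> integrable (lebesgue_on \<Omega>) (\<lambda>x. (norm (f x))\<^sup>2)"
  by (simp_all add: L2_def)

lemma L2_bound:
  assumes f: "f \<in> L2 \<Omega>" and g: "g \<in> borel_measurable (lebesgue_on \<Omega>)" and le: "\<And>x. norm (g x) \<le> c * norm (f x)"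
  shows "g \<in> L2 \<Omega>"
proof -
  have "integrable (lebesgue_on \<Omega>) (\<lambda>x. (norm (g x))\<^sup>2)"
  proof (rule Bochner_Integration.integrable_bound[OF integrable_mult_right[OF L2_integrable[OF f], of "c\<^sup>2"]])
    show "(\<lambda>x. (norm (g x))\<^sup>2) \<in> borel_measurable (lebesgue_on \<Omega>)" using g by measurable
    have "(norm (g x))\<^sup>2 \<le> (c * norm (f x))\<^sup>2" for x by (rule power_mono[OF le norm_ge_zero])
    then show "AE x in lebesgue_on \<Omega>. norm ((norm (g x))\<^sup>2) \<le> norm (c\<^sup>2 * (norm (f x))\<^sup>2)"
      by (simp add: power_mult_distrib)
  qed
  then show ?thesis using g by (simp add: L2_def)
qed

lemma L2_linear: "f \<in> L2 \<Omega> \<Longrightarrow> bounded_linear h \<Longrightarrow> (\<lambda>x. h (f x)) \<in> L2 \<Omega>"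
  for h :: "'b::euclidean_space \<Rightarrow> 'c::euclidean_space"
proof -
  assume f: "f \<in> L2 \<Omega>" and h: "bounded_linear h"
  obtain c where "\<And>y. norm (h y) \<le> norm y * c" using bounded_linear.bounded[OF h] by blast
  then have le: "norm (h (f x)) \<le> c * norm (f x)" for x by (metis mult.commute)
  have "h \<in> borel_measurable borel"
    using bounded_linear.continuous_on[OF h continuous_on_id] by (intro borel_measurable_continuous_onI)
  then have "(\<lambda>x. h (f x)) \<in> borel_measurable (lebesgue_on \<Omega>)"
    by (rule measurable_compose[OF L2_measurable[OF f]])
  from L2_bound[OF f this le] show ?thesis .
qed

lemma L2_add:
  assumes "f \<in> L2 \<Omega>" "g \<in> L2 \<Omega>" shows "(\<lambda>x. f x + g x) \<in> L2 \<Omega>"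
proof -
  note m = L2_measurable[OF assms(1)] L2_measurable[OF assms(2)]
  have "integrable (lebesgue_on \<Omega>) (\<lambda>x. 2 * (norm (f x))\<^sup>2 + 2 * (norm (g x))\<^sup>2)"
    using L2_integrable[OF assms(1)] L2_integrable[OF assms(2)] by simp
  then have "integrable (lebesgue_on \<Omega>) (\<lambda>x. (norm (f x + g x))\<^sup>2)"
  proof (rule Bochner_Integration.integrable_bound)
    show "(\<lambda>x. (norm (f x + g x))\<^sup>2) \<in> borel_measurable (lebesgue_on \<Omega>)" using m by measurable
    have "(norm (f x + g x))\<^sup>2 \<le> 2 * (norm (f x))\<^sup>2 + 2 * (norm (g x))\<^sup>2" for x
    proof -
      have "(norm (f x + g x))\<^sup>2 \<le> (norm (f x) + norm (g x))\<^sup>2"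
        by (rule power_mono[OF norm_triangle_ineq norm_ge_zero])
      also have "\<dots> \<le> 2 * (norm (f x))\<^sup>2 + 2 * (norm (g x))\<^sup>2"
        using zero_le_power2[of "norm (f x) - norm (g x)"] by (simp add: power2_eq_square algebra_simps)
      finally show ?thesis .
    qed
    then show "AE x in lebesgue_on \<Omega>. norm ((norm (f x + g x))\<^sup>2) \<le> norm (2 * (norm (f x))\<^sup>2 + 2 * (norm (g x))\<^sup>2)"
      by simp
  qed
  then show ?thesis using m by (simp add: L2_def)
qed

lemma L2_diff:
  assumes "f \<in> L2 \<Omega>" "g \<in> L2 \<Omega>" shows "(\<lambda>x. f x - g x) \<in> L2 \<Omega>"
  using L2_add[OF assms(1) L2_linear[OF assms(2) bounded_linear_minus[OF bounded_linear_ident]]] by simp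

text \<open>Expand the square of \<open>\<delta> * norm a - norm b\<close>; the constants are not
  optimised. Under the integral it takes the place of the Cauchy--Schwarz inequality in
  \<open>H1_0_density\<close>.\<close>

lemma inner_young:
  fixes a b :: "'a::real_inner"
  assumes "0 < \<delta>" shows "\<bar>a \<bullet> b\<bar> \<le> \<delta> * (norm a)\<^sup>2 + (norm b)\<^sup>2 / \<delta>"
proof -
  have "0 \<le> (\<delta> * norm a - norm b)\<^sup>2" by simp
  then have "2 * (\<delta> * (norm a * norm b)) \<le> \<delta> * (\<delta> * (norm a)\<^sup>2) + (norm b)\<^sup>2"
    by (simp add: power2_eq_square algebra_simps)
  moreover have "0 \<le> \<delta> * (norm a * norm b)" using assms by simp
  moreover have "\<delta> * (\<delta> * (norm a)\<^sup>2 + (norm b)\<^sup>2 / \<delta>) = \<delta> * (\<delta> * (norm a)\<^sup>2) + (norm b)\<^sup>2"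
    using assms by (simp add: distrib_left)
  ultimately have "\<delta> * (norm a * norm b) \<le> \<delta> * (\<delta> * (norm a)\<^sup>2 + (norm b)\<^sup>2 / \<delta>)" by linarith
  then have "norm a * norm b \<le> \<delta> * (norm a)\<^sup>2 + (norm b)\<^sup>2 / \<delta>" using assms by simp
  then show ?thesis using Cauchy_Schwarz_ineq2[of a b] by linarith
qed

lemma L2_inner_integrable:
  assumes "f \<in> L2 \<Omega>" "g \<in> L2 \<Omega>" shows "integrable (lebesgue_on \<Omega>) (\<lambda>x. f x \<bullet> g x)"
proof -
  note m = L2_measurable[OF assms(1)] L2_measurable[OF assms(2)]
  have "integrable (lebesgue_on \<Omega>) (\<lambda>x. (norm (f x))\<^sup>2 + (norm (g x))\<^sup>2)"
    using L2_integrable[OF assms(1)] L2_integrable[OF assms(2)] by simp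
  then show ?thesis
  proof (rule Bochner_Integration.integrable_bound)
    show "(\<lambda>x. f x \<bullet> g x) \<in> borel_measurable (lebesgue_on \<Omega>)" using m by measurable
    have "\<bar>f x \<bullet> g x\<bar> \<le> (norm (f x))\<^sup>2 + (norm (g x))\<^sup>2" for x
      using inner_young[of 1 "f x" "g x"] by simp
    then show "AE x in lebesgue_on \<Omega>. norm (f x \<bullet> g x) \<le> norm ((norm (f x))\<^sup>2 + (norm (g x))\<^sup>2)"
      by simp
  qed
qed

section \<open>Test functions and density\<close>

lemma test_functionsI:
  assumes f: "f \<in> test_functions S" and C: "\<And>m. Ck m g" and g: "\<And>x. x \<notin> closure {x. f x \<noteq> 0} \<Longrightarrow> g x = 0"
  shows "g \<in> test_functions S"
proof -
  let ?K = "closure {x. f x \<noteq> 0}"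
  have "{x. g x \<noteq> 0} \<subseteq> ?K" using g by blast
  then have sub: "closure {x. g x \<noteq> 0} \<subseteq> ?K" by (rule closure_minimal) simp
  have "compact (?K \<inter> closure {x. g x \<noteq> 0})"
    by (rule compact_Int_closed[OF test_functionsD(2)[OF f]]) simp
  moreover have "?K \<inter> closure {x. g x \<noteq> 0} = closure {x. g x \<noteq> 0}" using sub by blast
  ultimately have "compact (closure {x. g x \<noteq> 0})" by simp
  then show ?thesis unfolding test_functions_def mem_Collect_eq
    using C subset_trans[OF sub test_functionsD(3)[OF f]] by blast
qed

lemma partial_zero_outside_support:
  assumes "x \<notin> closure {x. f x \<noteq> 0}" shows "partial j f x = 0"
proof -
  have "partial j f x = partial j (\<lambda>x. 0) x"
  proof (rule partial_cong_open)
    show "open (- closure {x. f x \<noteq> 0})" by (rule open_Compl[OF closed_closure])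
    show "x \<in> - closure {x. f x \<noteq> 0}" using assms by simp
    show "f y = 0" if "y \<in> - closure {x. f x \<noteq> 0}" for y
      using that closure_subset[of "{x. f x \<noteq> 0}"] by auto
  qed
  then show ?thesis by (simp add: partial_def)
qed

lemma test_functions_partial_comp:
  fixes \<phi> :: "real^'n \<Rightarrow> real^'m"
  assumes \<phi>: "\<phi> \<in> test_functions S"
  shows "partial j (\<lambda>y. \<phi> y $ i) \<in> test_functions S"
proof (rule test_functionsI[OF \<phi>])
  have "Ck (Suc m) (\<lambda>y. \<phi> y $ i)" for m
    by (rule Ck_linear[OF bounded_linear_vec_nth test_functionsD(1)[OF \<phi>]])
  then show "Ck m (partial j (\<lambda>y. \<phi> y $ i))" for m by simp
  fix x assume x: "x \<notin> closure {x. \<phi> x \<noteq> 0}"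
  have "closure {x. \<phi> x $ i \<noteq> 0} \<subseteq> closure {x. \<phi> x \<noteq> 0}" by (rule closure_mono) auto
  then show "partial j (\<lambda>y. \<phi> y $ i) x = 0" using x by (intro partial_zero_outside_support) blast
qed

lemma test_functions_vdiv:
  fixes \<phi> :: "real^'n \<Rightarrow> real^'n"
  assumes \<phi>: "\<phi> \<in> test_functions S" shows "vdiv \<phi> \<in> test_functions S"
proof (rule test_functionsI[OF \<phi>])
  show "Ck m (vdiv \<phi>)" for m
    unfolding vdiv_def[abs_def]
    by (rule Ck_sum) (auto intro: test_functionsD(1)[OF test_functions_partial_comp[OF \<phi>]])
  fix x assume x: "x \<notin> closure {x. \<phi> x \<noteq> 0}"
  have "closure {x. \<phi> x $ i \<noteq> 0} \<subseteq> closure {x. \<phi> x \<noteq> 0}" for i by (rule closure_mono) auto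
  then have "partial j (\<lambda>y. \<phi> y $ i) x = 0" for i j using x by (intro partial_zero_outside_support) blast
  then show "vdiv \<phi> x = 0" by (simp add: vdiv_def)
qed

lemma continuous_compact_support_L2:
  fixes f :: "real^'n \<Rightarrow> 'b::euclidean_space"
  assumes f: "continuous_on UNIV f" and K: "compact K" "\<And>x. x \<notin> K \<Longrightarrow> f x = 0" and \<Omega>: "\<Omega> \<in> sets lebesgue"
  shows "f \<in> L2 \<Omega>"
proof -
  have c: "continuous_on UNIV (\<lambda>x. (norm (f x))\<^sup>2)" using f by (intro continuous_intros)
  obtain R where R: "K \<subseteq> cball 0 R" using compact_imp_bounded[OF K(1)] by (metis bounded_iff mem_cball_0 subsetI)
  have "integrable lborel (\<lambda>x. (norm (f x))\<^sup>2)"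
  proof (rule integrable_continuous_compact_support[OF c])
    fix x :: "real^'n" assume "x \<notin> cball 0 R"
    then have "x \<notin> K" using R by blast
    then show "(norm (f x))\<^sup>2 = 0" using K(2) by simp
  qed
  then have i: "integrable lebesgue (\<lambda>x. (norm (f x))\<^sup>2)" by (subst integrable_completion) auto
  then have "integrable lebesgue (\<lambda>x. indicator \<Omega> x *\<^sub>R (norm (f x))\<^sup>2)"
    using \<Omega> by (intro integrable_mult_indicator) auto
  then have "integrable (lebesgue_on \<Omega>) (\<lambda>x. (norm (f x))\<^sup>2)" using \<Omega> by (subst integrable_restrict_space) auto
  moreover have "f \<in> borel_measurable (lebesgue_on \<Omega>)"
    using f by (intro measurable_restrict_space1 measurable_completion) (simp add: borel_measurable_continuous_onI)
  ultimately show ?thesis by (simp add: L2_def)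
qed

lemma test_functions_L2:
  assumes "\<phi> \<in> test_functions S" "\<Omega> \<in> sets lebesgue" shows "\<phi> \<in> L2 \<Omega>"
proof (rule continuous_compact_support_L2[OF _ test_functionsD(2)[OF assms(1)] _ assms(2)])
  show "continuous_on UNIV \<phi>" using test_functionsD(1)[OF assms(1), of 0] by simp
  show "\<phi> x = 0" if "x \<notin> closure {x. \<phi> x \<noteq> 0}" for x
    using that closure_subset[of "{x. \<phi> x \<noteq> 0}"] by auto
qed

lemma test_functions_jac_L2:
  assumes \<phi>: "\<phi> \<in> test_functions S" and \<Omega>: "\<Omega> \<in> sets lebesgue" shows "jac \<phi> \<in> L2 \<Omega>"
proof (rule continuous_compact_support_L2[OF _ test_functionsD(2)[OF \<phi>] _ \<Omega>])
  have "continuous_on UNIV (partial j (\<lambda>y. \<phi> y $ i))" for i j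
    using test_functionsD(1)[OF test_functions_partial_comp[OF \<phi>], of 0] by simp
  then show "continuous_on UNIV (jac \<phi>)"
    by (intro continuous_on_vec_lambda) (simp add: jac_def)
  fix x assume x: "x \<notin> closure {x. \<phi> x \<noteq> 0}"
  have "closure {x. \<phi> x $ i \<noteq> 0} \<subseteq> closure {x. \<phi> x \<noteq> 0}" for i by (rule closure_mono) auto
  then have "partial j (\<lambda>y. \<phi> y $ i) x = 0" for i j using x by (intro partial_zero_outside_support) blast
  then show "jac \<phi> x = 0" by (simp add: jac_def vec_eq_iff)
qed

lemma H1_0_weak_grad:
  assumes "v \<in> H1_0 \<Omega>" shows "has_weak_grad \<Omega> v (weak_grad \<Omega> v)" "v \<in> L2 \<Omega>"
proof -
  have "\<exists>G. has_weak_grad \<Omega> v G" using assms by (auto simp: H1_0_def H1_def)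
  then show "has_weak_grad \<Omega> v (weak_grad \<Omega> v)" unfolding weak_grad_def by (rule someI_ex)
  show "v \<in> L2 \<Omega>" using assms by (auto simp: H1_0_def H1_def)
qed

text \<open>The pairing is bounded by \<open>\<delta> * S + E m / \<delta>\<close>, where
  \<open>E m\<close> is the squared distance in the norm of \<open>H1\<close> and \<open>S\<close>
  the squared norm of the stress. Letting \<open>m\<close> grow at fixed \<open>\<delta>\<close>
  removes the second term, a small \<open>\<delta>\<close> the other.\<close>

lemma H1_0_density:
  assumes v: "v \<in> H1_0 \<Omega>" and \<Omega>: "\<Omega> \<in> sets lebesgue" and \<sigma>: "\<sigma> \<in> L2 \<Omega>"
    and zero: "\<And>\<phi>. \<phi> \<in> test_functions \<Omega> \<Longrightarrow> (LINT x|lebesgue_on \<Omega>. \<sigma> x \<bullet> jac \<phi> x) = 0"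
  shows "(LINT x|lebesgue_on \<Omega>. \<sigma> x \<bullet> weak_grad \<Omega> v x) = 0"
proof -
  let ?M = "lebesgue_on \<Omega>" and ?G = "weak_grad \<Omega> v"
  have G: "?G \<in> L2 \<Omega>" and vL: "v \<in> L2 \<Omega>" using H1_0_weak_grad[OF v] by (auto simp: has_weak_grad_def)
  obtain \<phi> where \<phi>: "\<And>m. \<phi> m \<in> test_functions \<Omega>"
    and lim: "(\<lambda>m. LINT x|?M. (norm (\<phi> m x - v x))\<^sup>2 + (norm (jacobian (\<phi> m) (at x) - ?G x))\<^sup>2) \<longlonglongrightarrow> 0"
    using v by (auto simp: H1_0_def)
  have J: "jacobian (\<phi> m) (at x) = jac (\<phi> m) x" for m x
    by (rule jacobian_eq_jac[OF C1_differentiable[OF test_functionsD(1)[OF \<phi>]]])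
  define S where "S = (LINT x|?M. (norm (\<sigma> x))\<^sup>2)"
  define E where "E m = (LINT x|?M. (norm (\<phi> m x - v x))\<^sup>2 + (norm (jac (\<phi> m) x - ?G x))\<^sup>2)" for m
  have limE: "E \<longlonglongrightarrow> 0" using lim unfolding J E_def .
  have S0: "0 \<le> S" by (simp add: S_def)
  define c where "c = \<bar>LINT x|?M. \<sigma> x \<bullet> ?G x\<bar>"
  have bound: "c \<le> \<delta> * S + E m / \<delta>" if \<delta>: "0 < \<delta>" for \<delta> m
  proof -
    have jL: "jac (\<phi> m) \<in> L2 \<Omega>" and pL: "\<phi> m \<in> L2 \<Omega>" 
      using test_functions_jac_L2[OF \<phi> \<Omega>] test_functions_L2[OF \<phi> \<Omega>] by auto
    have dL: "(\<lambda>x. jac (\<phi> m) x - ?G x) \<in> L2 \<Omega>" by (rule L2_diff[OF jL G])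
    have eL: "(\<lambda>x. \<phi> m x - v x) \<in> L2 \<Omega>" by (rule L2_diff[OF pL vL])
    have "(LINT x|?M. \<sigma> x \<bullet> (jac (\<phi> m) x - ?G x)) = (LINT x|?M. \<sigma> x \<bullet> jac (\<phi> m) x) - (LINT x|?M. \<sigma> x \<bullet> ?G x)"
      unfolding inner_diff_right
      by (rule Bochner_Integration.integral_diff[OF L2_inner_integrable[OF \<sigma> jL] L2_inner_integrable[OF \<sigma> G]])
    then have "c = \<bar>LINT x|?M. \<sigma> x \<bullet> (jac (\<phi> m) x - ?G x)\<bar>" by (simp add: zero[OF \<phi>] c_def)
    also have "\<dots> \<le> (LINT x|?M. \<bar>\<sigma> x \<bullet> (jac (\<phi> m) x - ?G x)\<bar>)" by (rule integral_abs_bound)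
    also have "\<dots> \<le> (LINT x|?M. \<delta> * (norm (\<sigma> x))\<^sup>2 + ((norm (\<phi> m x - v x))\<^sup>2 + (norm (jac (\<phi> m) x - ?G x))\<^sup>2) / \<delta>)"
    proof (rule integral_mono)
      show "integrable ?M (\<lambda>x. \<bar>\<sigma> x \<bullet> (jac (\<phi> m) x - ?G x)\<bar>)" by (rule integrable_abs[OF L2_inner_integrable[OF \<sigma> dL]])
      show "integrable ?M (\<lambda>x. \<delta> * (norm (\<sigma> x))\<^sup>2 + ((norm (\<phi> m x - v x))\<^sup>2 + (norm (jac (\<phi> m) x - ?G x))\<^sup>2) / \<delta>)"
        using L2_integrable[OF \<sigma>] L2_integrable[OF dL] L2_integrable[OF eL] by simp
      show "\<bar>\<sigma> x \<bullet> (jac (\<phi> m) x - ?G x)\<bar> \<le> \<delta> * (norm (\<sigma> x))\<^sup>2 + ((norm (\<phi> m x - v x))\<^sup>2 + (norm (jac (\<phi> m) x - ?G x))\<^sup>2) / \<delta>" for x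
      proof -
        have "(norm (jac (\<phi> m) x - ?G x))\<^sup>2 / \<delta> \<le> ((norm (\<phi> m x - v x))\<^sup>2 + (norm (jac (\<phi> m) x - ?G x))\<^sup>2) / \<delta>"
          using \<delta> by (intro divide_right_mono) auto
        then show ?thesis using inner_young[OF \<delta>, of "\<sigma> x" "jac (\<phi> m) x - ?G x"] by linarith
      qed
    qed
    also have "\<dots> = \<delta> * S + E m / \<delta>"
      using L2_integrable[OF \<sigma>] L2_integrable[OF dL] L2_integrable[OF eL] by (simp add: S_def E_def)
    finally show ?thesis .
  qed
  have le: "c \<le> \<delta> * S" if \<delta>: "0 < \<delta>" for \<delta>
  proof (rule LIMSEQ_le_const)
    have "(\<lambda>m. \<delta> * S + E m / \<delta>) \<longlonglongrightarrow> \<delta> * S + 0 / \<delta>" using \<delta> by (intro tendsto_intros limE) auto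
    then show "(\<lambda>m. \<delta> * S + E m / \<delta>) \<longlonglongrightarrow> \<delta> * S" by simp
    show "\<exists>N. \<forall>n\<ge>N. c \<le> \<delta> * S + E n / \<delta>" using bound[OF \<delta>] by blast
  qed
  have "c \<le> 0"
  proof (rule ccontr)
    assume "\<not> c \<le> 0"
    then have c: "c > 0" by simp
    \<comment> \<open>The choice \<open>\<delta> = c / (S + 1)\<close> is positive also for
      \<open>S = 0\<close> and gives a factor \<open>S / (S + 1)\<close> below 1.\<close>
    have "c \<le> (c / (S + 1)) * S" using c S0 by (intro le) simp
    also have "\<dots> < c" using c S0 by (simp add: field_simps)
    finally show False by simp
  qed
  then show ?thesis by (simp add: c_def)
qed

text \<open>Writes a multiplier times the divergence as a Frobenius product with the gradient, so
  that scalar constraints fit the form required by \<open>H1_0_density\<close>.\<close>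

lemma inner_mat_1: "(mat 1 :: real^'n^'n) \<bullet> M = trace M"
  by (simp add: inner_vec_def mat_def trace_def if_distrib[of "\<lambda>c. c * _"] cong: if_cong)

lemma trace_jac: "trace (jac \<phi> x) = vdiv \<phi> x"
  by (simp add: trace_def jac_def vdiv_def)

text \<open>
  The divergence of a test field is again a test function, so it is orthogonal to the trace of
  the weak gradient; by density the latter is orthogonal to itself.
\<close>

lemma H1_0_ker_div_trace:
  fixes v :: "real^'n \<Rightarrow> real^'n"
  assumes v: "v \<in> H1_0 \<Omega>" and div: "v \<in> ker_div \<Omega>" and \<Omega>: "\<Omega> \<in> sets lebesgue"
  shows "AE x in lebesgue_on \<Omega>. trace (weak_grad \<Omega> v x) = 0"
proof -
  let ?M = "lebesgue_on \<Omega>" and ?G = "weak_grad \<Omega> v"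
  note wg = H1_0_weak_grad[OF v]
  have G: "?G \<in> L2 \<Omega>" using wg by (auto simp: has_weak_grad_def)
  have bl: "bounded_linear (\<lambda>M::real^'n^'n. trace M)"
    unfolding inner_mat_1[symmetric] by (rule bounded_linear_inner_right)
  have tr: "(\<lambda>x. trace (?G x)) \<in> L2 \<Omega>" by (rule L2_linear[OF G bl])
  have comp: "(\<lambda>x. ?G x $ i $ j) \<in> L2 \<Omega>" for i j
    using L2_linear[OF L2_linear[OF G bounded_linear_vec_nth] bounded_linear_vec_nth] .
  have ortho: "(LINT x|?M. trace (?G x) * \<phi> x) = 0" if \<phi>: "\<phi> \<in> test_functions \<Omega>" for \<phi>
  proof -
    have \<phi>L: "\<phi> \<in> L2 \<Omega>" by (rule test_functions_L2[OF \<phi> \<Omega>])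
    have p\<phi>L: "partial j \<phi> \<in> L2 \<Omega>" for j
    proof (rule test_functions_L2[OF test_functionsI[OF \<phi>] \<Omega>])
      show "Ck m (partial j \<phi>)" for m using test_functionsD(1)[OF \<phi>, of "Suc m"] by simp
    qed (rule partial_zero_outside_support)
    have "(LINT x|?M. trace (?G x) * \<phi> x) = (\<Sum>i\<in>UNIV. LINT x|?M. ?G x $ i $ i * \<phi> x)"
      unfolding trace_def sum_distrib_right
      by (rule Bochner_Integration.integral_sum) (use L2_inner_integrable[OF comp \<phi>L] in simp)
    also have "\<dots> = (\<Sum>i\<in>UNIV. - (LINT x|?M. v x $ i * partial i \<phi> x))"
      using wg(1) \<phi> by (simp add: has_weak_grad_def)
    also have "\<dots> = - (LINT x|?M. (\<Sum>i\<in>UNIV. v x $ i * partial i \<phi> x))"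
      unfolding sum_negf
      by (subst Bochner_Integration.integral_sum)
        (use L2_inner_integrable[OF L2_linear[OF wg(2) bounded_linear_vec_nth] p\<phi>L] in simp_all)
    also have "\<dots> = 0" using div \<phi> by (simp add: ker_div_def has_weak_div_def)
    finally show ?thesis .
  qed
  have m1: "bounded_linear (\<lambda>c::real. c *\<^sub>R (mat 1 :: real^'n^'n))" by (rule bounded_linear_scaleR_left)
  \<comment> \<open>The density lemma is used with the trace of the weak gradient times the identity
    as stress. On test fields this pairs the trace with a divergence, itself a test function, and
    \<open>ortho\<close> applies; on \<open>v\<close> it yields the square of the trace.\<close>
  have sq: "(LINT x|?M. (trace (?G x) *\<^sub>R (mat 1 :: real^'n^'n)) \<bullet> ?G x) = 0"
    by (rule H1_0_density[OF v \<Omega> L2_linear[OF tr m1]])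
      (simp add: inner_mat_1 trace_jac ortho[OF test_functions_vdiv])
  have "AE x in ?M. (trace (?G x))\<^sup>2 = 0"
  proof (subst integral_nonneg_eq_0_iff_AE[symmetric])
    show "integrable ?M (\<lambda>x. (trace (?G x))\<^sup>2)" using L2_integrable[OF tr] by simp
    show "(LINT x|?M. (trace (?G x))\<^sup>2) = 0" using sq by (simp add: inner_mat_1 power2_eq_square)
  qed simp
  then show ?thesis by eventually_elim simp
qed

theorem lemma2p11:
  fixes \<Omega> :: "(real^'n) set"
    and \<M> :: "(real^'n) set set set"
    and \<T> :: "(real^'n) set set"
    and \<nu> :: "(real^'n) set \<Rightarrow> real^'n"
    and k :: nat and l :: int
    and \<tau> :: "real^'n \<Rightarrow> real^'n^'n"
  assumes "CARD('n) \<ge> 2"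
    and "polytopal_domain \<Omega>"
    and "shape_regular_family \<Omega> \<M>"
    and "\<T> \<in> \<M>"
    and "face_normals \<Omega> \<T> \<nu>"
    and "l \<in> {int k, int k - 1}"
    and "\<tau> \<in> Sigma_tn \<Omega> \<T> \<nu> (int k)"
    and "\<forall>v \<in> Vdiv0 \<Omega> \<T> \<nu> (int k) l \<inter> ker_div \<Omega>. div_w \<Omega> \<T> \<nu> \<tau> v = 0"
  shows "\<forall>v \<in> H1_0 \<Omega> \<inter> ker_div \<Omega>. div_pairing \<Omega> \<tau> v = 0"
proof -
  have mesh: "simplicial_mesh \<Omega> \<T>" using assms(3,4) by (auto simp: shape_regular_family_def)
  interpret M: vec_mesh \<Omega> \<T> \<nu> by unfold_locales (rule assms mesh)+
  have \<tau>L: "\<tau> \<in> L2 \<Omega>" using assms(7) by (simp add: Sigma_tn_def)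
  have "\<forall>T\<in>\<T>. \<exists>p\<in>polys (int k). \<forall>x\<in>interior T. \<tau> x = p x \<and> trace (\<tau> x) = 0"
    using assms(7) by (simp add: Sigma_tn_def)
  then have "\<forall>T\<in>\<T>. \<exists>p. p \<in> polys (int k) \<and> (\<forall>x\<in>interior T. \<tau> x = p x)" by blast
  from bchoice[OF this] obtain \<sigma> where \<sigma>: "\<And>T. T \<in> \<T> \<Longrightarrow> \<sigma> T \<in> polys (int k)"
    and \<tau>\<sigma>: "\<And>T x. T \<in> \<T> \<Longrightarrow> x \<in> interior T \<Longrightarrow> \<tau> x = \<sigma> T x" by blast
  \<comment> \<open>The map \<open>h\<close> is left open because both the tangential part and the
    normal-normal component of the stress vector are needed, one vector-valued and one
    scalar.\<close>
  have trace_at: "elt_trace T (\<lambda>y. h (\<tau> y)) x = h (\<sigma> T x)"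
    if "T \<in> \<T>" "x \<in> T" "continuous_on UNIV h" for T x and h :: "real^'n^'n \<Rightarrow> 'z::real_normed_vector"
    by (rule elt_trace_eq[OF M.simplex[OF that(1)] that(2)])
      (simp add: \<tau>\<sigma>[OF that(1)], rule continuous_on_compose2[OF that(3) polys_continuous[OF \<sigma>[OF that(1)]]], simp)
  have facet_sub: "F \<subseteq> M.pos_elt F" "F \<subseteq> M.neg_elt F" if F: "F \<in> interior_faces \<Omega> \<T>" for F
    using M.facet_props(2)[OF M.interior_face_elts(1,2)[OF F]] M.facet_props(2)[OF M.interior_face_elts(4,5)[OF F]] by auto
  have mv: "continuous_on UNIV (\<lambda>A::real^'n^'n. A *v n)" for n
  proof (rule linear_continuous_on)
    show "bounded_linear (\<lambda>A::real^'n^'n. A *v n)"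
      unfolding linear_conv_bounded_linear[symmetric]
      by (rule linearI) (simp_all add: matrix_vector_mult_add_rdistrib scaleR_matrix_vector_assoc)
  qed
  interpret S: stress_mesh \<Omega> \<T> \<nu> k \<sigma>
  proof
    fix F x assume F: "F \<in> interior_faces \<Omega> \<T>" and x: "x \<in> F"
    have c: "continuous_on UNIV (\<lambda>A::real^'n^'n. tangential (\<nu> F) (A *v \<nu> F))"
      unfolding tangential_def by (intro continuous_intros mv)
    have "jump \<T> \<nu> F (\<lambda>y. tangential (\<nu> F) (\<tau> y *v \<nu> F)) x = 0"
      using assms(7) F x by (simp add: Sigma_tn_def)
    then show "tangential (\<nu> F) (\<sigma> (M.pos_elt F) x *v \<nu> F) = tangential (\<nu> F) (\<sigma> (M.neg_elt F) x *v \<nu> F)"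
      using trace_at[OF M.interior_face_elts(1)[OF F] subsetD[OF facet_sub(1)[OF F] x] c]
        trace_at[OF M.interior_face_elts(4)[OF F] subsetD[OF facet_sub(2)[OF F] x] c]
      by (simp add: jump_def)
  qed (rule \<sigma>)
  \<comment> \<open>The assembled field differs from its polynomials only on the skeleton. Element
    integrals ignore null sets, and traces are limits from the interiors.\<close>
  have div_w_eq: "div_w \<Omega> \<T> \<nu> \<tau> (M.assemble P) = S.weak_div P" if P: "P \<in> M.RT_fields (int k)" for P
  proof -
    have "(LINT x|lebesgue_on T. row_div \<tau> x \<bullet> M.assemble P x) = (LINT x|lebesgue_on T. row_div (\<sigma> T) x \<bullet> P T x)"
      if T: "T \<in> \<T>" for T
    proof (rule M.integral_elt_cong[OF T])
      show "continuous_on UNIV (\<lambda>x. row_div (\<sigma> T) x \<bullet> P T x)"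
        by (rule continuous_on_inner[OF S.row_div_continuous[OF T] C1_continuous[OF M.RT_fields_C1[OF P T]]])
      fix x assume x: "x \<in> interior T"
      have "row_div \<tau> x = row_div (\<sigma> T) x"
        unfolding row_div_def
        by (intro arg_cong[of _ _ vec_lambda] ext sum.cong refl partial_cong_open[OF open_interior x])
          (simp add: \<tau>\<sigma>[OF T])
      then show "row_div \<tau> x \<bullet> M.assemble P x = row_div (\<sigma> T) x \<bullet> P T x"
        by (simp add: M.assemble_eq[OF T x])
    qed
    moreover have "(LINT x:F|hull_lebesgue F. jump \<T> \<nu> F (\<lambda>y. \<nu> F \<bullet> (\<tau> y *v \<nu> F)) x *
          (\<nu> F \<bullet> elt_trace (M.pos_elt F) (M.assemble P) x)) =
        (LINT x:F|hull_lebesgue F. S.nn_jump F x * (\<nu> F \<bullet> P (M.pos_elt F) x))" if F: "F \<in> interior_faces \<Omega> \<T>" for F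
      unfolding set_lebesgue_integral_def
    proof (rule Bochner_Integration.integral_cong[OF refl])
      fix x
      note E = M.interior_face_elts[OF F]
      have c: "continuous_on UNIV (\<lambda>A::real^'n^'n. \<nu> F \<bullet> (A *v \<nu> F))" by (intro continuous_intros mv)
      have "jump \<T> \<nu> F (\<lambda>y. \<nu> F \<bullet> (\<tau> y *v \<nu> F)) x = S.nn_jump F x" if x: "x \<in> F"
        using trace_at[OF E(1) subsetD[OF facet_sub(1)[OF F] x] c] trace_at[OF E(4) subsetD[OF facet_sub(2)[OF F] x] c]
        by (simp add: jump_def S.nn_jump_def)
      moreover have "elt_trace (M.pos_elt F) (M.assemble P) x = P (M.pos_elt F) x" if x: "x \<in> F"
        by (rule elt_trace_eq[where v = "M.assemble P" and p = "P (M.pos_elt F)", OF M.simplex[OF E(1)] subsetD[OF facet_sub(1)[OF F] x] M.assemble_eq[OF E(1)]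
              C1_continuous[OF M.RT_fields_C1[OF P E(1)]]])
      ultimately show "indicator F x *\<^sub>R (jump \<T> \<nu> F (\<lambda>y. \<nu> F \<bullet> (\<tau> y *v \<nu> F)) x *
          (\<nu> F \<bullet> elt_trace (M.pos_elt F) (M.assemble P) x)) = indicator F x *\<^sub>R (S.nn_jump F x * (\<nu> F \<bullet> P (M.pos_elt F) x))"
        by (cases "x \<in> F") simp_all
    qed
    ultimately show ?thesis unfolding div_w_def S.weak_div_def by simp
  qed
  have ker: "S.weak_div P = 0"
    if P: "P \<in> M.RT_fields (int k)" and div: "\<And>T x. T \<in> \<T> \<Longrightarrow> x \<in> interior T \<Longrightarrow> vdiv (P T) x = 0" for P
  proof -
    let ?v = "M.assemble P"
    have L: "?v \<in> L2 \<Omega>" by (rule M.assemble_L2[OF C1_continuous[OF M.RT_fields_C1[OF P]]])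
    have wd: "has_weak_div \<Omega> ?v (\<lambda>x. 0)" by (rule M.assemble_ker_div[OF P div])
    \<comment> \<open>\<open>RT_div_free\<close> gives degree \<open>k\<close> without a radial
      summand. The zero polynomial is homogeneous of every degree and serves as that summand for
      \<open>l = k\<close> and \<open>l = k - 1\<close> alike.\<close>
    have elt: "?v \<in> Vdiv_elt (int k) l T" if T: "T \<in> \<T>" for T
    proof -
      have "P T \<in> polys (int k)"
        by (rule RT_div_free[OF M.RT_fieldsD(1)[OF P T] open_interior simplex_interior_nonempty[OF M.simplex[OF T]] div[OF T]])
      moreover have "\<forall>x\<in>interior T. ?v x = P T x + 0 *\<^sub>R x" using M.assemble_eq[OF T, of _ P] by simp
      ultimately show ?thesis unfolding Vdiv_elt_def mem_Collect_eq
        by (intro bexI[of _ "P T"] bexI[of _ "\<lambda>x. 0"]) simp_all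
    qed
    have bd: "elt_trace T ?v x \<bullet> \<nu> F = 0" if F: "F \<in> boundary_faces \<Omega> \<T>" "T \<in> \<T>" "F facet_of T" "x \<in> F" for F T x
      using elt_trace_eq[where v = ?v and p = "P T", OF M.simplex[OF F(2)] subsetD[OF M.facet_props(2)[OF F(2,3)] F(4)] M.assemble_eq[OF F(2)]
          C1_continuous[OF M.RT_fields_C1[OF P F(2)]]] M.RT_fieldsD(3)[OF P F]
      by (simp add: inner_commute)
    have "?v \<in> Vdiv0 \<Omega> \<T> \<nu> (int k) l \<inter> ker_div \<Omega>"
      unfolding Vdiv0_def Hdiv_def ker_div_def using L wd elt bd by blast
    then show ?thesis using assms(8) div_w_eq[OF P] by simp
  qed
  show ?thesis
  proof (rule S.smooth_pairing[OF ker])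
    fix p assume p: "\<And>T. T \<in> \<T> \<Longrightarrow> p T \<in> polys (int k)"
      and pair: "\<And>\<phi>. \<phi> \<in> test_functions \<Omega> \<Longrightarrow>
        (\<Sum>T\<in>\<T>. LINT x|lebesgue_on T. \<sigma> T x \<bullet> jac \<phi> x + p T x * vdiv \<phi> x) = 0"
    define q where "q = M.assemble p"
    have cp: "continuous_on UNIV (p T)" if "T \<in> \<T>" for T by (rule polys_continuous[OF p[OF that]])
    have q: "q x = p T x" if "T \<in> \<T>" "x \<in> interior T" for T x
      unfolding q_def by (rule M.assemble_eq[OF that])
    have qL: "q \<in> L2 \<Omega>" unfolding q_def by (rule M.assemble_L2[OF cp])
    \<comment> \<open>The multiplier enters as a pressure: this stress is orthogonal to the
      gradients of all test fields, divergence-free or not, which is what the density argument can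
      handle.\<close>
    let ?\<sigma> = "\<lambda>x. \<tau> x + q x *\<^sub>R (mat 1 :: real^'n^'n)"
    have qmL: "(\<lambda>x. q x *\<^sub>R (mat 1 :: real^'n^'n)) \<in> L2 \<Omega>" by (rule L2_linear[OF qL bounded_linear_scaleR_left])
    have \<sigma>L: "?\<sigma> \<in> L2 \<Omega>" by (rule L2_add[OF \<tau>L qmL])
    have zero: "(LINT x|lebesgue_on \<Omega>. ?\<sigma> x \<bullet> jac \<phi> x) = 0" if \<phi>: "\<phi> \<in> test_functions \<Omega>" for \<phi>
    proof -
      note C = test_functionsD(1)[OF \<phi>, of "Suc 0"]
      have "(LINT x|lebesgue_on \<Omega>. ?\<sigma> x \<bullet> jac \<phi> x) =
          (\<Sum>T\<in>\<T>. LINT x|lebesgue_on T. \<sigma> T x \<bullet> jac \<phi> x + p T x * vdiv \<phi> x)"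
      proof (rule M.integral_domain(2))
        fix T x assume T: "T \<in> \<T>" "x \<in> interior T"
        show "?\<sigma> x \<bullet> jac \<phi> x = \<sigma> T x \<bullet> jac \<phi> x + p T x * vdiv \<phi> x"
          by (simp add: \<tau>\<sigma>[OF T] q[OF T] inner_add_left inner_mat_1 trace_jac)
      next
        fix T assume T: "T \<in> \<T>"
        show "continuous_on UNIV (\<lambda>x. \<sigma> T x \<bullet> jac \<phi> x + p T x * vdiv \<phi> x)"
          by (intro continuous_intros polys_continuous[OF \<sigma>[OF T]] cp[OF T] continuous_jac[OF C] continuous_vdiv[OF C])
      qed
      then show ?thesis using pair[OF \<phi>] by simp
    qed
    show ?thesis
    proof
      fix v assume v: "v \<in> H1_0 \<Omega> \<inter> ker_div \<Omega>"
      let ?G = "weak_grad \<Omega> v"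
      have G: "?G \<in> L2 \<Omega>" using H1_0_weak_grad[of v \<Omega>] v by (auto simp: has_weak_grad_def)
      have "0 = (LINT x|lebesgue_on \<Omega>. ?\<sigma> x \<bullet> ?G x)"
        by (rule H1_0_density[OF _ M.domain_sets(1) \<sigma>L zero, symmetric]) (use v in auto)
      also have "\<dots> = (LINT x|lebesgue_on \<Omega>. \<tau> x \<bullet> ?G x) + (LINT x|lebesgue_on \<Omega>. (q x *\<^sub>R (mat 1 :: real^'n^'n)) \<bullet> ?G x)"
        unfolding inner_add_left
        by (rule Bochner_Integration.integral_add[OF L2_inner_integrable[OF \<tau>L G] L2_inner_integrable[OF qmL G]])
      \<comment> \<open>The pressure part pairs with the trace of the weak gradient only, and this
        is where \<open>v\<close> being divergence-free is used.\<close>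
      also have "(LINT x|lebesgue_on \<Omega>. (q x *\<^sub>R (mat 1 :: real^'n^'n)) \<bullet> ?G x) = 0"
      proof (rule integral_eq_zero_AE)
        have "AE x in lebesgue_on \<Omega>. trace (?G x) = 0"
          using v by (intro H1_0_ker_div_trace M.domain_sets(1)) auto
        then show "AE x in lebesgue_on \<Omega>. (q x *\<^sub>R (mat 1 :: real^'n^'n)) \<bullet> ?G x = 0"
          by eventually_elim (simp add: inner_mat_1)
      qed
      finally show "div_pairing \<Omega> \<tau> v = 0" by (simp add: div_pairing_def)
    qed
  qed
qed

end
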